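(* Let $\Phi$ be a point process on a compact subset $\Lambda$ of $\mathbb X$ with Papangelou intensity $c$ and intensity measure $M(\mathrm dx)=m(x)\,\ell(\mathrm dx)$. Let $\zeta$ be a Poisson point process with intensity measure $M$. For any integer $n\ge1$, let $$\Phi_n=\sum_{k=1}^n\frac1n\circ\Phi^{(k)},$$ where $\Phi^{(1)},\dots,\Phi^{(n)}$ are $n$ independent copies of $\Phi$. If there exists an integrable function $K:\Lambda\to\mathbb R_+$ such that $\operatorname{Var}[c(x,\Phi)]\le K(x)$ for any $x\in\Lambda$, then $$\Delta_{TV}^*(\Phi_n,\zeta)\le\frac1{\sqrt n}\int_\Lambda\sqrt{K(x)}\,\ell(\mathrm dx).$$
   Context: $\mathbb X$ is a locally compact metric space with its Borel $\sigma$-algebra, and $\ell$ is a Radon measure on $\mathbb X$ (not necessarily diffuse); integrability on $\Lambda$ is with respect to $\ell$. $N_{\mathbb X}$ is the set of configurations, i.e. nonnegative-integer-valued measures on $\mathbb X$ finite on relatively compact Borel sets, with the smallest $\sigma$-algebra making $\phi\mapsto\phi(A)$ measurable for every relatively compact Borel $A$. Configurations are treated as (multi)sets of points: $\sum_{x\in\phi}f(x)=\int f\,\mathrm d\phi$, $\phi\setminus x=\phi-\delta_x$. A point process is a random element of $N_{\mathbb X}$; its intensity measure is $A\mapsto\mathbb E[\Phi(A)]$. Intensity measures of Poisson point processes are Radon. For $p\in[0,1]$, $p\circ\Phi$ is the independent $p$-thinning: each point of $\Phi$ is kept independently with probability $p$ (thinnings of the different copies being independent). A Papangelou intensity of $\Phi$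 is a measurable $c:\mathbb X\times N_{\mathbb X}\to\mathbb R_+$ such that for all measurable $u:\mathbb X\times N_{\mathbb X}\to\mathbb R_+$, $\mathbb E[\sum_{x\in\Phi}u(x,\Phi\setminus x)]=\int_{\mathbb X}\mathbb E[c(x,\Phi)u(x,\Phi)]\,\ell(\mathrm dx)$. For measures $\nu_1,\nu_2$ on $\mathbb X$, $\Delta_{TV}(\nu_1,\nu_2)=\sup|\nu_1(A)-\nu_2(A)|$, the supremum being over Borel $A$ with $\nu_1(A),\nu_2(A)<\infty$. For point processes $\Phi_1,\Phi_2$ with laws $\mathbb P_1,\mathbb P_2$, $\Delta_{TV}^*(\Phi_1,\Phi_2)=\inf_{\mathbf C}\int\Delta_{TV}(\omega_1,\omega_2)\,\mathbf C(\mathrm d(\omega_1,\omega_2))$, the infimum being over all couplings $\mathbf C$ of $\mathbb P_1$ and $\mathbb P_2$. *)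

theory Defs
  imports "HOL-Probability.Probability"
begin

definition radon_measure :: "'a::metric_space measure \<Rightarrow> bool" where
  "radon_measure \<mu> \<longleftrightarrow>
     sets \<mu> = sets borel \<and>
     (\<forall>C. compact C \<longrightarrow> emeasure \<mu> C < \<infinity>) \<and>
     (\<forall>A\<in>sets borel. emeasure \<mu> A = (SUP C\<in>{C. compact C \<and> C \<subseteq> A}. emeasure \<mu> C))"

definition rel_compact_borel :: "'a::metric_space set set" where
  "rel_compact_borel = {A \<in> sets borel. compact (closure A)}"

text \<open>Integer-valued means with values in the natural numbers extended by infinity;
  infinity is excluded on relatively compact sets only.\<close>

definition configs :: "'a::metric_space measure set" where
  "configs = {\<phi>. sets \<phi> = sets borel \<and>
     (\<forall>A\<in>sets borel. emeasure \<phi> A = \<infinity> \<or> (\<exists>k::nat. emeasure \<phi> A = of_nat k)) \<and>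
     (\<forall>A\<in>rel_compact_borel. emeasure \<phi> A < \<infinity>)}"

definition config_space :: "'a::metric_space measure measure" where
  "config_space = sigma configs
     {(\<lambda>\<phi>. emeasure \<phi> A) -` B \<inter> configs | A B. A \<in> rel_compact_borel \<and> B \<in> sets borel}"

definition point_process :: "'w measure \<Rightarrow> ('w \<Rightarrow> 'a::metric_space measure) \<Rightarrow> bool" where
  "point_process P \<Phi> \<longleftrightarrow> prob_space P \<and> \<Phi> \<in> P \<rightarrow>\<^sub>M config_space"

definition point_process_on ::
    "'a set \<Rightarrow> 'w measure \<Rightarrow> ('w \<Rightarrow> 'a::metric_space measure) \<Rightarrow> bool" where
  "point_process_on \<Lambda> P \<Phi> \<longleftrightarrow>
     point_process P \<Phi> \<and> (AE \<omega> in P. emeasure (\<Phi> \<omega>) (- \<Lambda>) = 0)"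

definition has_intensity_measure ::
    "'w measure \<Rightarrow> ('w \<Rightarrow> 'a::metric_space measure) \<Rightarrow> 'a measure \<Rightarrow> bool" where
  "has_intensity_measure P \<Phi> M \<longleftrightarrow>
     sets M = sets borel \<and>
     (\<forall>A\<in>sets borel. emeasure M A = (\<integral>\<^sup>+\<omega>. emeasure (\<Phi> \<omega>) A \<partial>P))"

definition poisson_process ::
    "'w measure \<Rightarrow> ('w \<Rightarrow> 'a::metric_space measure) \<Rightarrow> 'a measure \<Rightarrow> bool" where
  "poisson_process P \<zeta> M \<longleftrightarrow>
     radon_measure M \<and>
     point_process P \<zeta> \<and>
     (\<forall>A\<in>rel_compact_borel. \<forall>k::nat.
        measure P {\<omega> \<in> space P. emeasure (\<zeta> \<omega>) A = of_nat k}
          = exp (- measure M A) * measure M A ^ k / fact k) \<and>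
     (\<forall>(I::nat set) A. finite I \<and> A ` I \<subseteq> rel_compact_borel \<and> disjoint_family_on A I \<longrightarrow>
        prob_space.indep_vars P (\<lambda>_. borel) (\<lambda>i \<omega>. emeasure (\<zeta> \<omega>) (A i)) I)"

text \<open>The configuration \<open>\<phi> - \<delta>\<^sub>x\<close>; it is only meaningful when \<open>x\<close> is a point of \<open>\<phi>\<close>.\<close>

definition remove_point :: "'a::metric_space measure \<Rightarrow> 'a \<Rightarrow> 'a measure" where
  "remove_point \<phi> x = measure_of UNIV (sets borel) (\<lambda>A. emeasure \<phi> A - indicator A x)"

definition papangelou_intensity ::
    "'a measure \<Rightarrow> 'w measure \<Rightarrow> ('w \<Rightarrow> 'a::metric_space measure) \<Rightarrow>
       ('a \<Rightarrow> 'a measure \<Rightarrow> real) \<Rightarrow> bool" where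
  "papangelou_intensity l P \<Phi> c \<longleftrightarrow>
     (\<lambda>(x, \<phi>). c x \<phi>) \<in> borel_measurable (borel \<Otimes>\<^sub>M config_space) \<and>
     (\<forall>x. \<forall>\<phi>\<in>configs. 0 \<le> c x \<phi>) \<and>
     (\<forall>u :: 'a \<Rightarrow> 'a measure \<Rightarrow> real.
        (\<lambda>(x, \<phi>). u x \<phi>) \<in> borel_measurable (borel \<Otimes>\<^sub>M config_space) \<longrightarrow>
        (\<forall>x. \<forall>\<phi>\<in>configs. 0 \<le> u x \<phi>) \<longrightarrow>
        (\<integral>\<^sup>+\<omega>. (\<integral>\<^sup>+x. ennreal (u x (remove_point (\<Phi> \<omega>) x)) \<partial>\<Phi> \<omega>) \<partial>P)
          = (\<integral>\<^sup>+x. (\<integral>\<^sup>+\<omega>. ennreal (c x (\<Phi> \<omega>) * u x (\<Phi> \<omega>)) \<partial>P) \<partial>l))"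

text \<open>The points of \<open>\<phi>\<close> listed with multiplicity: a location \<open>x\<close> of multiplicity \<open>k\<close>
  contributes the pairs \<open>(x, 0), \<dots>, (x, k - 1)\<close>.\<close>

definition config_points :: "'a::metric_space measure \<Rightarrow> ('a \<times> nat) set" where
  "config_points \<phi> = {(x, i). of_nat i < emeasure \<phi> {x}}"

text \<open>The configuration \<open>\<Sum>\<^bsub>(x, i) \<in> S\<^esub> \<delta>\<^sub>x\<close>.\<close>

definition config_of_points :: "('a::metric_space \<times> nat) set \<Rightarrow> 'a measure" where
  "config_of_points S = distr (count_space S) borel fst"

text \<open>The law of the independent \<open>p\<close>-thinning of a deterministic configuration: every point
  carries an independent Bernoulli mark, and the points marked \<open>True\<close> are kept.\<close>

definition thinning_kernel :: "real \<Rightarrow> 'a::metric_space measure \<Rightarrow> 'a measure measure" where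
  "thinning_kernel p \<phi> =
     distr (\<Pi>\<^sub>M q\<in>config_points \<phi>. measure_pmf (bernoulli_pmf p)) config_space
       (\<lambda>b. config_of_points {q \<in> config_points \<phi>. b q})"

text \<open>\<open>\<Psi>\<close> is a version of \<open>p \<circ> \<Phi>\<close>: conditionally on \<open>\<Phi>\<close>, its law is
  \<open>thinning_kernel p \<Phi>\<close>.\<close>

definition independent_thinning ::
    "'w measure \<Rightarrow> real \<Rightarrow> ('w \<Rightarrow> 'a::metric_space measure) \<Rightarrow> ('w \<Rightarrow> 'a measure) \<Rightarrow> bool" where
  "independent_thinning P p \<Phi> \<Psi> \<longleftrightarrow>
     point_process P \<Phi> \<and> point_process P \<Psi> \<and>
     (\<forall>A\<in>sets config_space. \<forall>B\<in>sets config_space.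
        emeasure P {\<omega> \<in> space P. \<Phi> \<omega> \<in> A \<and> \<Psi> \<omega> \<in> B}
          = (\<integral>\<^sup>+\<omega>. emeasure (thinning_kernel p (\<Phi> \<omega>)) B * indicator A (\<Phi> \<omega>) \<partial>P))"

definition superposition :: "'i set \<Rightarrow> ('i \<Rightarrow> 'a::metric_space measure) \<Rightarrow> 'a measure" where
  "superposition I \<psi> = measure_of UNIV (sets borel) (\<lambda>A. \<Sum>i\<in>I. emeasure (\<psi> i) A)"

definition TV_dist :: "'a::metric_space measure \<Rightarrow> 'a measure \<Rightarrow> ennreal" where
  "TV_dist \<nu>1 \<nu>2 =
     (SUP A\<in>{A \<in> sets borel. emeasure \<nu>1 A < \<infinity> \<and> emeasure \<nu>2 A < \<infinity>}.
        ennreal \<bar>measure \<nu>1 A - measure \<nu>2 A\<bar>)"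

definition couplings :: "'b measure \<Rightarrow> 'c measure \<Rightarrow> ('b \<times> 'c) measure set" where
  "couplings \<mu> \<nu> = {C. prob_space C \<and> sets C = sets (\<mu> \<Otimes>\<^sub>M \<nu>) \<and>
     distr C \<mu> fst = \<mu> \<and> distr C \<nu> snd = \<nu>}"

text \<open>The Kantorovich-Rubinstein distance of two laws on the configuration space, with
  the total variation distance as cost.\<close>

definition TV_star_law ::
    "'a::metric_space measure measure \<Rightarrow> 'a measure measure \<Rightarrow> ennreal" where
  "TV_star_law Q1 Q2 = (INF C\<in>couplings Q1 Q2. \<integral>\<^sup>+(\<omega>1, \<omega>2). TV_dist \<omega>1 \<omega>2 \<partial>C)"

definition TV_star ::
    "'w measure \<Rightarrow> ('w \<Rightarrow> 'a::metric_space measure) \<Rightarrow> 'v measure \<Rightarrow> ('v \<Rightarrow> 'a measure) \<Rightarrow> ennreal" where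
  "TV_star P1 \<Phi>1 P2 \<Phi>2 = TV_star_law (distr P1 config_space \<Phi>1) (distr P2 config_space \<Phi>2)"

end

(* Configurations in the compact set are handled as finite multisets. Summing the GNZ equations of
   the thinned copies shows that the superposition W satisfies
   E [sum of u(x, W - x) over x in W] = integral of E [C(x) u(x, W)] l(dx),
   where C(x) is the average of the n intensities c(x, Phi_k); only the bound
   E |C(x) - m(x)| <= sqrt (K(x) / n) on C is needed. Hence W has a density h with respect to the
   Poisson law pi with intensity M = m l, and
   integral of |h(phi + x) - h(phi)| pi(dphi) M(dx) <= integral of E |C(x) - m(x)| l(dx).
   The coupling is built without duality: pi is the N-fold convolution of the Poisson law with
   intensity M / N, and one couples, increment by increment and conditionally on the past, the
   increments under h pi with independent Poisson increments by maximal coupling. Mecke's equation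
   turns the expected number of mismatched points of one step into 1 / N times the integral above,
   up to O(1 / N^2). *)

theory Submission
  imports Defs
begin

section \<open>Measurable structure on finite multisets\<close>

text \<open>\<open>C\<close> depends on the unthinned copies and not only on \<open>W\<close>, so it
  need not be a Papangelou intensity of \<open>W\<close>. Conditioning on \<open>W\<close> is
  avoided: h(phi + x) pi(dphi) M(dx) and h(phi) pi(dphi) M(dx) are images of measures with densities
  \<open>C\<close> and \<open>m\<close> on the larger sample space, and passing to images does not
  increase the total variation of a difference. This is why a first-moment bound on C - m suffices.
  That \<open>h\<close> exists is not assumed either; the equation for \<open>W\<close> forces
  absolute continuity.

  The space need not be separable, and the cost \<open>TV_dist\<close> is not shown to be
  measurable. So the coupling uses no disintegration, no measurable diagonal and no optimal plan:
  its kernels are explicit densities, and its cost is a lower integral that is only bounded from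
  above. A step at which the increments differ is charged with all their points. This crude charge
  is right to first order, because a Poisson increment of intensity M / N has two or more points
  with probability O(1 / N^2). For each N an error of order 1 / N remains, which the infimum over
  couplings absorbs.\<close>

instance multiset :: (countable) countable
proof
  have "countable (range (mset :: 'a list \<Rightarrow> 'a multiset))"
    by (intro countable_image) auto
  moreover have "range (mset :: 'a list \<Rightarrow> 'a multiset) = UNIV"
    using ex_mset by (metis UNIV_eq_I rangeI)
  ultimately show "\<exists>f :: 'a multiset \<Rightarrow> nat. inj f"
    by (simp add: countable_def)
qed

text \<open>A labelling is a finite Borel partition with numbered cells. Finiteness lets an event
  about labels be decided by finitely many counts; natural numbers as labels allow two partitions to
  be encoded in one and keep the label multisets in a countable type.\<close>

definition labelling :: "('a::topological_space \<Rightarrow> nat) \<Rightarrow> bool" where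
  "labelling f \<longleftrightarrow> f \<in> borel \<rightarrow>\<^sub>M count_space UNIV \<and> finite (range f)"

lemma labelling_indicator: "A \<in> sets borel \<Longrightarrow> labelling (indicator A)"
proof -
  assume [measurable]: "A \<in> sets borel"
  have "range (indicator A) \<subseteq> {0, 1::nat}"
    by (auto simp: indicator_def)
  moreover have "(\<lambda>x. if x \<in> A then 1 else 0 :: nat) \<in> borel \<rightarrow>\<^sub>M count_space UNIV"
    by measurable
  ultimately show ?thesis
    unfolding labelling_def indicator_def of_bool_def by (auto intro: finite_subset)
qed

text \<open>The common refinement of two partitions; both label multisets can be decoded from the
  joint one.\<close>

lemma labelling_pair:
  assumes "labelling f" "labelling g"
  shows "labelling (\<lambda>x. prod_encode (f x, g x))"
proof -
  have [measurable]: "f \<in> borel \<rightarrow>\<^sub>M count_space UNIV" "g \<in> borel \<rightarrow>\<^sub>M count_space UNIV"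
    using assms by (auto simp: labelling_def)
  have "(\<lambda>x. prod_encode (f x, g x)) \<in> borel \<rightarrow>\<^sub>M count_space UNIV"
    by (rule measurable_compose_countable[where f = "\<lambda>i x. prod_encode (i, g x)" and g = f])
       (auto intro: measurable_compose[of g])
  moreover have "range (\<lambda>x. prod_encode (f x, g x)) \<subseteq> prod_encode ` (range f \<times> range g)"
    by auto
  then have "finite (range (\<lambda>x. prod_encode (f x, g x)))"
    by (rule finite_subset) (use assms in \<open>simp add: labelling_def\<close>)
  ultimately show ?thesis
    by (simp add: labelling_def)
qed

text \<open>Generating by finite-valued labels rather than by counts makes the generator
  intersection-stable and turns statements about the generator into discrete ones.\<close>

definition multiset_space :: "'a::topological_space multiset measure" where
  "multiset_space = sigma UNIV {image_mset f -` D | f D. labelling f}"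

lemma space_multiset_space [simp]: "space multiset_space = UNIV"
  by (simp add: multiset_space_def space_measure_of_conv)

lemma sets_multiset_space:
  "sets multiset_space = sigma_sets UNIV {image_mset f -` D | f D. labelling f}"
  by (simp add: multiset_space_def sets_measure_of_conv)

lemma Int_stable_labelling:
  "Int_stable {image_mset f -` D | (f :: 'a::topological_space \<Rightarrow> nat) D. labelling f}"
proof (rule Int_stableI)
  fix a b assume "a \<in> {image_mset f -` D | (f :: 'a \<Rightarrow> nat) D. labelling f}"
    "b \<in> {image_mset f -` D | (f :: 'a \<Rightarrow> nat) D. labelling f}"
  then obtain f g and D E where *: "a = image_mset f -` D" "b = image_mset g -` E" "labelling f" "labelling g"
    by blast
  let ?h = "\<lambda>x. prod_encode (f x, g x)"
  have "image_mset f \<phi> = image_mset (fst \<circ> prod_decode) (image_mset ?h \<phi>)"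
    "image_mset g \<phi> = image_mset (snd \<circ> prod_decode) (image_mset ?h \<phi>)" for \<phi>
    by (simp_all add: multiset.map_comp comp_def)
  then have "a \<inter> b = image_mset ?h -` (image_mset (fst \<circ> prod_decode) -` D \<inter> image_mset (snd \<circ> prod_decode) -` E)"
    unfolding * by auto
  then show "a \<inter> b \<in> {image_mset f -` D | (f :: 'a \<Rightarrow> nat) D. labelling f}"
    using labelling_pair[OF *(3,4)] by blast
qed

lemma measurable_image_labelling [measurable]:
  "labelling f \<Longrightarrow> image_mset f \<in> multiset_space \<rightarrow>\<^sub>M count_space UNIV"
proof (rule measurableI)
  fix D assume "labelling f"
  then have "image_mset f -` D \<in> {image_mset f -` D | f D. labelling f}" by blast
  then show "image_mset f -` D \<inter> space multiset_space \<in> sets multiset_space"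
    by (simp add: sets_multiset_space sigma_sets.Basic)
qed simp

lemma measurable_multiset_spaceI:
  assumes "\<And>f. labelling f \<Longrightarrow> (\<lambda>\<omega>. image_mset f (T \<omega>)) \<in> N \<rightarrow>\<^sub>M count_space UNIV"
  shows "T \<in> N \<rightarrow>\<^sub>M multiset_space"
  unfolding multiset_space_def
proof (rule measurable_measure_of)
  fix A assume "A \<in> {image_mset f -` D | (f :: 'a \<Rightarrow> nat) D. labelling f}"
  then obtain f D where A: "A = image_mset f -` D" "labelling f" by blast
  show "T -` A \<inter> space N \<in> sets N"
    using measurable_sets[OF assms[OF A(2)], of D] by (simp add: A vimage_def)
qed auto

lemma measurable_count_comp2:
  fixes X :: "'w \<Rightarrow> 'b::countable" and Y :: "'w \<Rightarrow> 'c::countable"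
  assumes "X \<in> N \<rightarrow>\<^sub>M count_space UNIV" "Y \<in> N \<rightarrow>\<^sub>M count_space UNIV"
  shows "(\<lambda>\<omega>. G (X \<omega>) (Y \<omega>)) \<in> N \<rightarrow>\<^sub>M count_space UNIV"
  by (rule measurable_compose_countable[where f = "\<lambda>i \<omega>. G i (Y \<omega>)" and g = X])
     (auto intro: measurable_compose[of Y] assms)

lemma measurable_mset_plus [measurable (raw)]:
  assumes [measurable]: "X \<in> N \<rightarrow>\<^sub>M multiset_space" "Y \<in> N \<rightarrow>\<^sub>M multiset_space"
  shows "(\<lambda>\<omega>. X \<omega> + Y \<omega>) \<in> N \<rightarrow>\<^sub>M multiset_space"
  by (rule measurable_multiset_spaceI) (auto intro!: measurable_count_comp2)

lemma measurable_add_mset [measurable (raw)]: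
  assumes [measurable]: "X \<in> N \<rightarrow>\<^sub>M borel" "Y \<in> N \<rightarrow>\<^sub>M multiset_space"
  shows "(\<lambda>\<omega>. add_mset (X \<omega>) (Y \<omega>)) \<in> N \<rightarrow>\<^sub>M multiset_space"
proof (rule measurable_multiset_spaceI)
  fix f :: "'b \<Rightarrow> nat" assume f: "labelling f"
  then have [measurable]: "f \<in> borel \<rightarrow>\<^sub>M count_space UNIV" by (simp add: labelling_def)
  show "(\<lambda>\<omega>. image_mset f (add_mset (X \<omega>) (Y \<omega>))) \<in> N \<rightarrow>\<^sub>M count_space UNIV"
    using measurable_count_comp2[of "\<lambda>\<omega>. f (X \<omega>)" N "\<lambda>\<omega>. image_mset f (Y \<omega>)" add_mset] f by simp
qed

lemma measurable_size [measurable]: "size \<in> multiset_space \<rightarrow>\<^sub>M count_space UNIV"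
proof -
  have "labelling (\<lambda>_. 0)" by (simp add: labelling_def)
  from measurable_compose[OF measurable_image_labelling[OF this], of size "count_space UNIV"]
  show ?thesis by simp
qed

lemma size_eq_sets [measurable]: "{\<phi>. size \<phi> = k} \<in> sets multiset_space"
  using measurable_sets[OF measurable_size, of "{k}"] by (simp add: vimage_def)

lemma measurable_of_nat_size [measurable]:
  "(\<lambda>\<phi>. of_nat (size \<phi>) :: ennreal) \<in> borel_measurable multiset_space"
  by (rule measurable_compose[OF measurable_size]) simp

section \<open>Point counts, and equality of laws on multisets\<close>

definition npoints :: "'a set \<Rightarrow> 'a multiset \<Rightarrow> nat" where
  "npoints A \<phi> = size (filter_mset (\<lambda>x. x \<in> A) \<phi>)"

lemma npoints_simps [simp]:
  "npoints A {#} = 0"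
  "npoints A (add_mset x \<phi>) = (if x \<in> A then Suc (npoints A \<phi>) else npoints A \<phi>)"
  "npoints A (\<phi> + \<psi>) = npoints A \<phi> + npoints A \<psi>"
  by (simp_all add: npoints_def)

lemma npoints_sum: "npoints A (\<Sum>k\<in>S. Y k) = (\<Sum>k\<in>S. npoints A (Y k))"
  by (induction S rule: infinite_finite_induct) auto

lemma npoints_le_size: "npoints A \<phi> \<le> size \<phi>"
  by (simp add: npoints_def size_filter_mset_lesseq)

lemma count_image_mset_eq_npoints: "count (image_mset f \<phi>) j = npoints (f -` {j}) \<phi>"
  by (induction \<phi>) auto

text \<open>Outside \<open>J\<close> both multiplicities are zero, so only the labels in
  \<open>J\<close> have to be compared. For a labelling \<open>J\<close> can be taken finite, which
  turns an event about labels into finitely many events about counts.\<close>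

lemma image_mset_eq_iff_npoints:
  assumes "range f \<union> set_mset \<xi> \<subseteq> J"
  shows "image_mset f \<psi> = \<xi> \<longleftrightarrow> (\<forall>j\<in>J. npoints (f -` {j}) \<psi> = count \<xi> j)"
proof
  assume r: "\<forall>j\<in>J. npoints (f -` {j}) \<psi> = count \<xi> j"
  show "image_mset f \<psi> = \<xi>"
  proof (rule multiset_eqI)
    fix j
    show "count (image_mset f \<psi>) j = count \<xi> j"
    proof (cases "j \<in> J")
      case False
      then have "count \<xi> j = 0" "count (image_mset f \<psi>) j = 0"
        using assms by (auto simp: count_eq_zero_iff)
      then show ?thesis by simp
    qed (use r in \<open>simp add: count_image_mset_eq_npoints\<close>)
  qed
qed (auto simp: count_image_mset_eq_npoints[symmetric])

lemma measurable_npoints [measurable]: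
  fixes A :: "'a::topological_space set"
  assumes "A \<in> sets borel"
  shows "npoints A \<in> multiset_space \<rightarrow>\<^sub>M count_space UNIV"
proof -
  have "npoints A = (\<lambda>\<phi>. count (image_mset (indicator A :: 'a \<Rightarrow> nat) \<phi>) 1)"
    by (auto simp: count_image_mset_eq_npoints fun_eq_iff vimage_def indicator_def)
  also have "\<dots> \<in> multiset_space \<rightarrow>\<^sub>M count_space UNIV"
    by (rule measurable_compose[OF measurable_image_labelling[OF labelling_indicator[OF assms]]]) simp
  finally show ?thesis .
qed

text \<open>Label multisets are countable, so a generator set is a countable disjoint union of sets
  on which the label multiset is fixed; agreement on these is enough. This is the form in which
  Poisson laws are identified.\<close>

lemma multiset_space_eqI:
  assumes sets: "sets \<mu> = sets multiset_space" "sets \<nu> = sets multiset_space"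
    and "prob_space \<mu>"
    and eq: "\<And>f \<xi>. labelling f \<Longrightarrow> emeasure \<mu> (image_mset f -` {\<xi>}) = emeasure \<nu> (image_mset f -` {\<xi>})"
  shows "\<mu> = \<nu>"
proof (rule measure_eqI_generator_eq[OF Int_stable_labelling, where A = "\<lambda>_. UNIV"])
  fix X assume "X \<in> {image_mset f -` D | (f :: 'a \<Rightarrow> nat) D. labelling f}"
  then obtain f :: "'a \<Rightarrow> nat" and D where X: "X = image_mset f -` D" "labelling f" by blast
  have s: "image_mset f -` {\<xi>} \<in> sets multiset_space" for \<xi>
    using measurable_sets[OF measurable_image_labelling[OF X(2)], of "{\<xi>}"] by simp
  have *: "emeasure M X = (\<integral>\<^sup>+\<xi>. emeasure M (image_mset f -` {\<xi>}) \<partial>count_space D)"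
    if "sets M = sets multiset_space" for M :: "'a multiset measure"
  proof -
    have "emeasure M (\<Union>\<xi>\<in>D. image_mset f -` {\<xi>}) = (\<integral>\<^sup>+\<xi>. emeasure M (image_mset f -` {\<xi>}) \<partial>count_space D)"
      by (rule emeasure_UN_countable) (use s that in \<open>auto simp: disjoint_family_on_def\<close>)
    moreover have "(\<Union>\<xi>\<in>D. image_mset f -` {\<xi>}) = X" by (auto simp: X)
    ultimately show ?thesis by simp
  qed
  show "emeasure \<mu> X = emeasure \<nu> X"
    by (simp add: *[OF sets(1)] *[OF sets(2)] eq[OF X(2)])
next
  show "range (\<lambda>_. UNIV) \<subseteq> {image_mset f -` D | (f :: 'a \<Rightarrow> nat) D. labelling f}"
  proof -
    have "labelling (indicator {} :: 'a \<Rightarrow> nat)" by (rule labelling_indicator) simp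
    then have "image_mset (indicator {}) -` UNIV \<in> {image_mset f -` D | (f :: 'a \<Rightarrow> nat) D. labelling f}"
      by blast
    then show ?thesis by auto
  qed
  show "emeasure \<mu> UNIV \<noteq> \<infinity>"
    using prob_space.emeasure_space_1[OF \<open>prob_space \<mu>\<close>] sets_eq_imp_space_eq[OF sets(1)] by simp
qed (use sets in \<open>auto simp: sets_multiset_space\<close>)

section \<open>Sums over the points of a multiset with one point removed\<close>

definition point_sum :: "('a \<Rightarrow> 'a multiset \<Rightarrow> ennreal) \<Rightarrow> 'a multiset \<Rightarrow> ennreal" where
  "point_sum u \<phi> = (\<Sum>x\<in>#\<phi>. u x (\<phi> - {#x#}))"

lemma point_sum_empty [simp]: "point_sum u {#} = 0"
  by (simp add: point_sum_def)

lemma sum_mset_cong_ennreal: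
  "(\<And>x. x \<in># \<phi> \<Longrightarrow> g x = h x) \<Longrightarrow> (\<Sum>x\<in>#\<phi>. g x) = (\<Sum>x\<in>#\<phi>. h x :: ennreal)"
  by (metis (mono_tags, lifting) image_mset_cong)

text \<open>A Leibniz rule: the removed point comes from exactly one of the two summands, and the
  other one stays whole. A location that occurs in both causes no trouble, because each copy is
  removed from the summand that it belongs to.\<close>

lemma point_sum_plus:
  "point_sum u (\<phi> + \<psi>) = point_sum (\<lambda>x \<xi>. u x (\<xi> + \<psi>)) \<phi> + point_sum (\<lambda>x \<xi>. u x (\<phi> + \<xi>)) \<psi>"
proof -
  have "(\<Sum>x\<in>#\<phi>. u x (\<phi> + \<psi> - {#x#})) = (\<Sum>x\<in>#\<phi>. u x (\<phi> - {#x#} + \<psi>))"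
    by (rule sum_mset_cong_ennreal) (simp add: multiset_diff_union_assoc)
  moreover have "(\<Sum>x\<in>#\<psi>. u x (\<phi> + \<psi> - {#x#})) = (\<Sum>x\<in>#\<psi>. u x (\<phi> + (\<psi> - {#x#})))"
    by (rule sum_mset_cong_ennreal) (simp only: diff_union_single_conv)
  ultimately show ?thesis by (simp add: point_sum_def)
qed

lemma point_sum_add_mset:
  "point_sum u (add_mset y \<phi>) = u y \<phi> + point_sum (\<lambda>x \<psi>. u x (add_mset y \<psi>)) \<phi>"
  using point_sum_plus[of u "{#y#}" \<phi>] by (simp add: point_sum_def)

lemma point_sum_const: "point_sum (\<lambda>_ _. a) \<phi> = of_nat (size \<phi>) * a"
  unfolding point_sum_def by (induction \<phi>) (auto simp: distrib_right)

text \<open>Putting the removed point back restores \<open>\<phi>\<close>, so all summands agree.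
  Read from right to left, this turns the weight \<open>size\<close> into a sum to which the Mecke
  equation applies.\<close>

lemma point_sum_total: "point_sum (\<lambda>x \<psi>. F (add_mset x \<psi>)) \<phi> = of_nat (size \<phi>) * F \<phi>"
proof -
  have "point_sum (\<lambda>x \<psi>. F (add_mset x \<psi>)) \<phi> = (\<Sum>x\<in>#\<phi>. F \<phi>)"
    unfolding point_sum_def by (rule sum_mset_cong_ennreal) simp
  also have "\<dots> = of_nat (size \<phi>) * F \<phi>"
    by (induction \<phi>) (auto simp: distrib_right)
  finally show ?thesis .
qed

lemma sum_mset_SUP:
  fixes G :: "nat \<Rightarrow> 'a \<Rightarrow> ennreal"
  assumes "\<And>x. incseq (\<lambda>i. G i x)"
  shows "(\<Sum>x\<in>#\<phi>. SUP i. G i x) = (SUP i. \<Sum>x\<in>#\<phi>. G i x)"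
proof (induction \<phi>)
  case (add y \<phi>)
  have "incseq (\<lambda>i. \<Sum>x\<in>#\<phi>. G i x)"
    using assms by (auto simp: mono_def intro!: sum_mset_mono)
  then show ?case
    using ennreal_SUP_add[of "\<lambda>i. G i y" "\<lambda>i. \<Sum>x\<in>#\<phi>. G i x"] assms add.IH by simp
qed simp

lemma sum_mset_suminf:
  fixes G :: "nat \<Rightarrow> 'a \<Rightarrow> ennreal"
  shows "(\<Sum>x\<in>#\<phi>. \<Sum>i. G i x) = (\<Sum>i. \<Sum>x\<in>#\<phi>. G i x)"
  by (induction \<phi>) (auto simp: suminf_add[symmetric])

text \<open>For a rectangle whose second side is a label cylinder the sum is a function of one label
  multiset, and every such function is measurable because label multisets are discrete. A Dynkin
  argument extends this to all product sets.\<close>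

lemma measurable_point_sum_indicator:
  assumes "B \<in> sets (borel \<Otimes>\<^sub>M (multiset_space :: 'a::topological_space multiset measure))"
  shows "point_sum (\<lambda>x \<psi>. indicator B (x, \<psi>)) \<in> borel_measurable multiset_space"
proof -
  let ?MS = "multiset_space :: 'a multiset measure"
  let ?gen = "{image_mset f -` D | (f :: 'a \<Rightarrow> nat) D. labelling f}"
  let ?E = "{a \<times> b | a b. a \<in> sets (borel :: 'a measure) \<and> b \<in> ?gen}"
  have sets_eq: "sets (borel \<Otimes>\<^sub>M ?MS) = sigma_sets (UNIV \<times> UNIV) ?E"
  proof -
    have "UNIV \<in> ?gen"
    proof -
      have "labelling (indicator {} :: 'a \<Rightarrow> nat)" by (rule labelling_indicator) simp
      then have "image_mset (indicator {}) -` UNIV \<in> ?gen" by blast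
      then show ?thesis by simp
    qed
    moreover have "sets (borel :: 'a measure) = sigma_sets UNIV (sets borel)"
      using sets.sigma_sets_eq[of "borel :: 'a measure"] by simp
    ultimately show ?thesis
      using sets_pair_eq[of "sets (borel :: 'a measure)" borel "{UNIV}" ?gen ?MS "{UNIV}"]
      by (simp add: sets_multiset_space)
  qed
  have "Int_stable ?E"
  proof (rule Int_stableI)
    fix x y assume "x \<in> ?E" "y \<in> ?E"
    then obtain a b c d where *: "x = a \<times> b" "y = c \<times> d" "a \<in> sets borel" "c \<in> sets borel"
      "b \<in> ?gen" "d \<in> ?gen" by blast
    have "b \<inter> d \<in> ?gen" using Int_stableD[OF Int_stable_labelling *(5,6)] .
    moreover have "a \<inter> c \<in> sets borel" using * by blast
    ultimately show "x \<inter> y \<in> ?E" unfolding * Times_Int_Times by blast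
  qed
  have "?E \<subseteq> Pow (UNIV \<times> UNIV)" by auto
  from \<open>Int_stable ?E\<close> this assms[unfolded sets_eq] show ?thesis
  proof (induction rule: sigma_sets_induct_disjoint)
    case (basic A)
    then obtain a f D where A: "A = a \<times> image_mset f -` D" "a \<in> sets borel" "labelling f" by blast
    \<comment> \<open>The joint label carries membership in \<open>a\<close> and the label under
      \<open>f\<close>. Decoding the first half selects the admissible points, decoding the second
      half tests the remaining configuration.\<close>
    let ?h = "\<lambda>x. prod_encode (indicator a x, f x)"
    define G where "G = (\<lambda>\<xi>. \<Sum>y\<in>#\<xi>. if fst (prod_decode y) = 1 \<and>
       image_mset (snd \<circ> prod_decode) (\<xi> - {#y#}) \<in> D then 1 else 0 :: ennreal)"
    have "labelling ?h" using A by (intro labelling_pair labelling_indicator)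
    then have "(\<lambda>\<phi>. G (image_mset ?h \<phi>)) \<in> borel_measurable multiset_space"
      by (auto intro!: measurable_compose[OF measurable_image_labelling])
    also have "(\<lambda>\<phi>. G (image_mset ?h \<phi>)) = point_sum (\<lambda>x \<psi>. indicator A (x, \<psi>))"
    proof
      fix \<phi> :: "'a multiset"
      have "point_sum (\<lambda>x \<psi>. indicator A (x, \<psi>)) \<phi> = (\<Sum>x\<in>#\<phi>. if fst (prod_decode (?h x)) = 1 \<and>
       image_mset (snd \<circ> prod_decode) (image_mset ?h \<phi> - {#?h x#}) \<in> D then 1 else 0)"
        unfolding point_sum_def
      proof (rule sum_mset_cong_ennreal)
        fix x assume "x \<in># \<phi>"
        then have "image_mset ?h \<phi> - {#?h x#} = image_mset ?h (\<phi> - {#x#})"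
          by (simp add: image_mset_Diff)
        then have "image_mset (snd \<circ> prod_decode) (image_mset ?h \<phi> - {#?h x#}) = image_mset f (\<phi> - {#x#})"
          by (simp add: multiset.map_comp comp_def)
        then show "indicator A (x, \<phi> - {#x#}) = (if fst (prod_decode (?h x)) = 1 \<and>
       image_mset (snd \<circ> prod_decode) (image_mset ?h \<phi> - {#?h x#}) \<in> D then 1 else 0 :: ennreal)"
          by (auto simp: A indicator_def)
      qed
      then show "G (image_mset ?h \<phi>) = point_sum (\<lambda>x \<psi>. indicator A (x, \<psi>)) \<phi>"
        by (simp add: G_def multiset.map_comp comp_def)
    qed
    finally show ?case .
  next
    case empty
    then show ?case by (simp add: point_sum_const)
  next
    case (compl A)
    \<comment> \<open>Complements are taken by subtraction, which is legitimate because the sum is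
      at most the finite number \<open>size \<phi>\<close>.\<close>
    have *: "point_sum (\<lambda>x \<psi>. indicator (UNIV \<times> UNIV - A) (x, \<psi>)) \<phi> =
       of_nat (size \<phi>) - point_sum (\<lambda>x \<psi>. indicator A (x, \<psi>)) \<phi>" for \<phi>
    proof -
      let ?I = "point_sum (\<lambda>x \<psi>. indicator A (x, \<psi>)) \<phi>" and ?J = "point_sum (\<lambda>x \<psi>. indicator (UNIV \<times> UNIV - A) (x, \<psi>)) \<phi>"
      have "?J + ?I = point_sum (\<lambda>_ _. 1) \<phi>"
        unfolding point_sum_def sum_mset.distrib[symmetric]
        by (rule sum_mset_cong_ennreal) (auto simp: indicator_def)
      moreover then have "?I \<noteq> \<infinity>"
        by (auto simp: point_sum_const)
      ultimately show ?thesis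
        by (metis ennreal_add_diff_cancel_right infinity_ennreal_def mult.right_neutral point_sum_const)
    qed
    have [measurable]: "point_sum (\<lambda>x \<psi>. indicator A (x, \<psi>)) \<in> borel_measurable multiset_space" by fact
    show ?case unfolding * by measurable
  next
    case (union A)
    have "point_sum (\<lambda>x \<psi>. indicator (\<Union>(range A)) (x, \<psi>)) =
      (\<lambda>\<phi>. \<Sum>i. point_sum (\<lambda>x \<psi>. indicator (A i) (x, \<psi>)) \<phi>)"
      unfolding point_sum_def by (auto simp: sum_mset_suminf[symmetric] suminf_indicator[OF union(1)])
    moreover have "\<dots> \<in> borel_measurable multiset_space"
      using union(3) by measurable
    ultimately show ?case by simp
  qed
qed

lemma measurable_point_sum:
  assumes "(\<lambda>(x, \<psi>). u x \<psi>) \<in> borel_measurable (borel \<Otimes>\<^sub>M (multiset_space :: 'a::topological_space multiset measure))"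
  shows "point_sum u \<in> borel_measurable multiset_space"
proof -
  have "point_sum (\<lambda>x \<psi>. v (x, \<psi>)) \<in> borel_measurable multiset_space"
    if "v \<in> borel_measurable (borel \<Otimes>\<^sub>M (multiset_space :: 'a multiset measure))" for v
    using that
  proof (induction rule: borel_measurable_induct)
    case (cong f g)
    then have "f = g" by (auto simp: fun_eq_iff space_pair_measure)
    with cong show ?case by simp
  next
    case (set A)
    then show ?case by (rule measurable_point_sum_indicator)
  next
    case (mult u c)
    then show ?case
      by (simp add: point_sum_def sum_mset_distrib_left[symmetric])
  next
    case (add u v)
    then show ?case by (simp add: point_sum_def sum_mset.distrib)
  next
    case (seq U)
    have "point_sum (\<lambda>x \<psi>. (SUP i. U i) (x, \<psi>)) = (\<lambda>\<phi>. SUP i. point_sum (\<lambda>x \<psi>. U i (x, \<psi>)) \<phi>)"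
      unfolding point_sum_def using seq(3)
      by (auto simp: fun_eq_iff SUP_apply incseq_def le_fun_def image_comp intro!: sum_mset_SUP)
    with seq show ?case by simp
  qed
  from this[OF assms] show ?thesis by simp
qed

section \<open>Thinnings and Poisson laws of multisets\<close>

definition thin_step :: "real \<Rightarrow> 'a \<Rightarrow> 'a multiset pmf \<Rightarrow> 'a multiset pmf" where
  "thin_step p x \<mu> = bind_pmf (bernoulli_pmf p) (\<lambda>b. map_pmf (\<lambda>\<psi>. if b then add_mset x \<psi> else \<psi>) \<mu>)"

definition thin :: "real \<Rightarrow> 'a multiset \<Rightarrow> 'a multiset pmf" where
  "thin p = fold_mset (thin_step p) (return_pmf {#})"

lemma thin_empty [simp]: "thin p {#} = return_pmf {#}"
  by (simp add: thin_def)

lemma thin_add_mset: "thin p (add_mset x \<phi>) = thin_step p x (thin p \<phi>)"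
proof -
  have commute: "thin_step p x (thin_step p y \<mu>) = thin_step p y (thin_step p x \<mu>)" for x y :: 'a and \<mu>
  proof -
    \<comment> \<open>In this form the two marks are drawn first and independently, so their order
      can be exchanged; \<open>fold_mset\<close> requires this.\<close>
    have *: "thin_step p x (thin_step p y \<mu>) = bind_pmf (bernoulli_pmf p) (\<lambda>a. bind_pmf (bernoulli_pmf p) (\<lambda>b.
       map_pmf (\<lambda>\<psi>. (if a then {#x#} else {#}) + (if b then {#y#} else {#}) + \<psi>) \<mu>))" for x y :: 'a
      unfolding thin_step_def map_bind_pmf map_pmf_comp
      by (intro bind_pmf_cong map_pmf_cong refl) auto
    show ?thesis
      unfolding *[of x y] *[of y x]
      by (subst bind_commute_pmf, intro bind_pmf_cong map_pmf_cong refl) (simp add: ac_simps)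
  qed
  interpret comp_fun_commute "thin_step p :: 'a \<Rightarrow> _"
    by standard (simp add: fun_eq_iff commute)
  show ?thesis by (simp add: thin_def)
qed

text \<open>The marks do not look at the locations. This reduces the measurability of the thinning
  kernel to label multisets, where everything is discrete.\<close>

lemma map_pmf_image_mset_thin: "map_pmf (image_mset f) (thin p \<phi>) = thin p (image_mset f \<phi>)"
proof (induction \<phi>)
  case (add x \<phi>)
  show ?case
    unfolding image_mset_add_mset thin_add_mset add.IH[symmetric] thin_step_def map_bind_pmf map_pmf_comp
    by (intro bind_pmf_cong map_pmf_cong refl) auto
qed simp

lemma nn_integral_thin_add_mset:
  assumes "0 \<le> p" "p \<le> 1"
  shows "(\<integral>\<^sup>+\<psi>. F \<psi> \<partial>thin p (add_mset x \<phi>)) =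
    ennreal p * (\<integral>\<^sup>+\<psi>. F (add_mset x \<psi>) \<partial>thin p \<phi>) + ennreal (1 - p) * (\<integral>\<^sup>+\<psi>. F \<psi> \<partial>thin p \<phi>)"
  using assms by (simp add: thin_add_mset thin_step_def mult.commute)

text \<open>A point of the thinning is a point of \<open>\<phi>\<close> that was kept, with
  probability \<open>p\<close>, and given this the other points are thinned independently. The
  induction conditions on the mark of the added point \<open>y\<close>.\<close>

lemma point_sum_thin:
  assumes p: "0 \<le> p" "p \<le> 1"
  shows "(\<integral>\<^sup>+\<psi>. point_sum u \<psi> \<partial>thin p \<phi>) =
    ennreal p * point_sum (\<lambda>x \<psi>. \<integral>\<^sup>+\<xi>. u x \<xi> \<partial>thin p \<psi>) \<phi>"
proof (induction \<phi> arbitrary: u)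
  case (add y \<phi>)
  let ?I = "\<lambda>u. point_sum (\<lambda>x \<psi>. \<integral>\<^sup>+\<xi>. u x \<xi> \<partial>thin p \<psi>) \<phi>"
  let ?v = "\<lambda>x \<psi>. u x (add_mset y \<psi>)"
  have 1: "ennreal p + ennreal (1 - p) = 1"
    using p by (simp add: ennreal_plus[symmetric] del: ennreal_plus)
  have "(\<integral>\<^sup>+\<psi>. point_sum u \<psi> \<partial>thin p (add_mset y \<phi>)) =
      ennreal p * ((\<integral>\<^sup>+\<psi>. u y \<psi> \<partial>thin p \<phi>) + ennreal p * ?I ?v) + ennreal (1 - p) * (ennreal p * ?I u)"
    by (simp add: nn_integral_thin_add_mset[OF p] point_sum_add_mset nn_integral_add add.IH)
  also have "\<dots> = ennreal p * ((\<integral>\<^sup>+\<psi>. u y \<psi> \<partial>thin p \<phi>) + (ennreal p * ?I ?v + ennreal (1 - p) * ?I u))"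
    by (simp add: distrib_left mult_ac add_ac)
  also have "ennreal p * ?I ?v + ennreal (1 - p) * ?I u =
      point_sum (\<lambda>x \<psi>. \<integral>\<^sup>+\<xi>. u x \<xi> \<partial>thin p (add_mset y \<psi>)) \<phi>"
    unfolding nn_integral_thin_add_mset[OF p]
    by (simp add: point_sum_def sum_mset.distrib sum_mset_distrib_left[symmetric])
  finally show ?case
    by (simp add: point_sum_add_mset)
qed simp

text \<open>\<open>thin p \<phi>\<close> lives on all subsets; its restriction to
  \<open>multiset_space\<close> is the value of a kernel.\<close>

definition thin_law :: "real \<Rightarrow> 'a::topological_space multiset \<Rightarrow> 'a multiset measure" where
  "thin_law p \<phi> = distr (measure_pmf (thin p \<phi>)) multiset_space (\<lambda>\<psi>. \<psi>)"

lemma sets_thin_law [simp, measurable_cong]: "sets (thin_law p \<phi>) = sets multiset_space"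
  by (simp add: thin_law_def)

lemma prob_space_thin_law: "prob_space (thin_law p \<phi>)"
  unfolding thin_law_def by (rule measure_pmf.prob_space_distr) simp

lemma nn_integral_thin_law:
  "F \<in> borel_measurable multiset_space \<Longrightarrow> (\<integral>\<^sup>+\<psi>. F \<psi> \<partial>thin_law p \<phi>) = (\<integral>\<^sup>+\<psi>. F \<psi> \<partial>thin p \<phi>)"
  unfolding thin_law_def by (subst nn_integral_distr) auto

lemma measurable_thin_law [measurable]:
  "thin_law p \<in> multiset_space \<rightarrow>\<^sub>M prob_algebra (multiset_space :: 'a::topological_space multiset measure)"
proof (rule measurable_prob_algebra_generated[OF sets_multiset_space Int_stable_labelling])
  fix A assume "A \<in> {image_mset f -` D | (f :: 'a \<Rightarrow> nat) D. labelling f}"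
  then obtain f :: "'a \<Rightarrow> nat" and D where A: "A = image_mset f -` D" "labelling f" by blast
  then have [measurable]: "A \<in> sets multiset_space"
    using measurable_sets[OF measurable_image_labelling[OF A(2)], of D] by simp
  have "emeasure (thin_law p \<phi>) A = emeasure (measure_pmf (thin p (image_mset f \<phi>))) D" for \<phi>
  proof -
    have "emeasure (thin_law p \<phi>) A = emeasure (measure_pmf (thin p \<phi>)) A"
      unfolding thin_law_def by (subst emeasure_distr) auto
    also have "\<dots> = emeasure (measure_pmf (map_pmf (image_mset f) (thin p \<phi>))) D"
      by (simp add: A)
    finally show ?thesis by (simp add: map_pmf_image_mset_thin)
  qed
  then show "(\<lambda>\<phi>. emeasure (thin_law p \<phi>) A) \<in> borel_measurable multiset_space"
    using measurable_compose[OF measurable_image_labelling[OF A(2)],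
        of "\<lambda>\<xi>. emeasure (measure_pmf (thin p \<xi>)) D" borel] by simp
qed (auto simp: prob_space_thin_law)

lemma singleton_empty_sets [measurable]: "{{#}} \<in> sets multiset_space"
  using size_eq_sets[of 0] by simp

section \<open>The Mecke equation and Poisson laws of finite intensity\<close>

definition mecke :: "'a::topological_space measure \<Rightarrow> 'a multiset measure \<Rightarrow> bool" where
  "mecke M Q \<longleftrightarrow> (\<forall>u. (\<lambda>(x, \<psi>). u x \<psi>) \<in> borel_measurable (borel \<Otimes>\<^sub>M multiset_space) \<longrightarrow>
     (\<integral>\<^sup>+\<phi>. point_sum u \<phi> \<partial>Q) = (\<integral>\<^sup>+x. (\<integral>\<^sup>+\<phi>. u x \<phi> \<partial>Q) \<partial>M))"

lemma meckeD:
  "mecke M Q \<Longrightarrow> (\<lambda>(x, \<psi>). u x \<psi>) \<in> borel_measurable (borel \<Otimes>\<^sub>M multiset_space) \<Longrightarrow>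
     (\<integral>\<^sup>+\<phi>. point_sum u \<phi> \<partial>Q) = (\<integral>\<^sup>+x. (\<integral>\<^sup>+\<phi>. u x \<phi> \<partial>Q) \<partial>M)"
  unfolding mecke_def by blast

text \<open>The Poisson law is encoded by its Mecke equation, the form in which the estimates use
  it. The void probability starts the recursion that gives uniqueness, and its positivity keeps the
  empty configuration out of every null set.\<close>

definition poisson_law :: "'a::topological_space measure \<Rightarrow> 'a multiset measure \<Rightarrow> bool" where
  "poisson_law M Q \<longleftrightarrow> prob_space Q \<and> sets Q = sets multiset_space \<and> mecke M Q \<and>
     emeasure Q {{#}} = ennreal (exp (- measure M UNIV))"

text \<open>The binomial process: \<open>k\<close> independent points of law \<open>\<nu>\<close>,
  with their order forgotten.\<close>

fun iid_law :: "'a::topological_space measure \<Rightarrow> nat \<Rightarrow> 'a multiset measure" where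
  "iid_law \<nu> 0 = return multiset_space {#}"
| "iid_law \<nu> (Suc k) = distr (\<nu> \<Otimes>\<^sub>M iid_law \<nu> k) multiset_space (\<lambda>(x, \<phi>). add_mset x \<phi>)"

context
  fixes \<nu> :: "'a::topological_space measure"
  assumes prob: "prob_space \<nu>" and sets_nu [measurable_cong, simp]: "sets \<nu> = sets borel"
begin

interpretation nu: prob_space \<nu> by (rule prob)

lemma sets_iid_law [simp, measurable_cong]: "sets (iid_law \<nu> k) = sets multiset_space"
  by (cases k) auto

lemma prob_space_iid_law: "prob_space (iid_law \<nu> k)"
proof (induction k)
  case 0
  show ?case by (simp add: prob_space_return)
next
  case (Suc k)
  show ?case unfolding iid_law.simps
    by (rule prob_space.prob_space_distr[OF prob_space_pair[OF prob Suc]]) measurable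
qed

lemma sigma_finite_iid_law: "sigma_finite_measure (iid_law \<nu> k)"
  using prob_space_iid_law prob_space_imp_sigma_finite by blast

lemma nn_integral_iid_law_Suc:
  assumes [measurable]: "F \<in> borel_measurable multiset_space"
  shows "(\<integral>\<^sup>+\<phi>. F \<phi> \<partial>iid_law \<nu> (Suc k)) = (\<integral>\<^sup>+x. (\<integral>\<^sup>+\<phi>. F (add_mset x \<phi>) \<partial>iid_law \<nu> k) \<partial>\<nu>)"
proof -
  interpret sigma_finite_measure "iid_law \<nu> k" by (rule sigma_finite_iid_law)
  have "(\<integral>\<^sup>+\<phi>. F \<phi> \<partial>iid_law \<nu> (Suc k)) = (\<integral>\<^sup>+z. F (add_mset (fst z) (snd z)) \<partial>(\<nu> \<Otimes>\<^sub>M iid_law \<nu> k))"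
    by (simp add: nn_integral_distr split_beta')
  also have "\<dots> = (\<integral>\<^sup>+x. (\<integral>\<^sup>+\<phi>. F (add_mset x \<phi>) \<partial>iid_law \<nu> k) \<partial>\<nu>)"
    by (subst nn_integral_fst[symmetric]) auto
  finally show ?thesis .
qed

text \<open>By exchangeability each of the \<open>k + 1\<close> points may play the removed one, and
  the others are independent of it with law \<open>iid_law \<nu> k\<close>.\<close>

lemma point_sum_iid_law:
  assumes "(\<lambda>(x, \<psi>). u x \<psi>) \<in> borel_measurable (borel \<Otimes>\<^sub>M multiset_space)"
  shows "(\<integral>\<^sup>+\<phi>. point_sum u \<phi> \<partial>iid_law \<nu> (Suc k)) =
    of_nat (Suc k) * (\<integral>\<^sup>+x. (\<integral>\<^sup>+\<phi>. u x \<phi> \<partial>iid_law \<nu> k) \<partial>\<nu>)"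
  using assms
proof (induction k arbitrary: u)
  case (0 u)
  note [measurable] = 0 measurable_point_sum[OF 0]
  have [measurable]: "point_sum (\<lambda>x \<psi>. u x (add_mset y \<psi>)) \<in> borel_measurable multiset_space" for y
    by (rule measurable_point_sum) measurable
  show ?case
    by (simp add: nn_integral_iid_law_Suc nn_integral_return point_sum_add_mset del: iid_law.simps(2))
next
  case (Suc k u)
  interpret K: sigma_finite_measure "iid_law \<nu> k" by (rule sigma_finite_iid_law)
  interpret K': sigma_finite_measure "iid_law \<nu> (Suc k)" by (rule sigma_finite_iid_law)
  interpret P: pair_sigma_finite \<nu> \<nu> ..
  note [measurable] = Suc.prems measurable_point_sum[OF Suc.prems]
  have [measurable]: "point_sum (\<lambda>x \<psi>. u x (add_mset y \<psi>)) \<in> borel_measurable multiset_space" for y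
    by (rule measurable_point_sum) measurable
  let ?U = "(\<integral>\<^sup>+x. (\<integral>\<^sup>+\<phi>. u x \<phi> \<partial>iid_law \<nu> (Suc k)) \<partial>\<nu>)"
  have "(\<integral>\<^sup>+\<phi>. point_sum u \<phi> \<partial>iid_law \<nu> (Suc (Suc k))) =
     (\<integral>\<^sup>+y. (\<integral>\<^sup>+\<phi>. u y \<phi> + point_sum (\<lambda>x \<psi>. u x (add_mset y \<psi>)) \<phi> \<partial>iid_law \<nu> (Suc k)) \<partial>\<nu>)"
    by (subst nn_integral_iid_law_Suc) (simp_all add: point_sum_add_mset del: iid_law.simps)
  also have "\<dots> = (\<integral>\<^sup>+y. (\<integral>\<^sup>+\<phi>. u y \<phi> \<partial>iid_law \<nu> (Suc k)) +
       of_nat (Suc k) * (\<integral>\<^sup>+x. (\<integral>\<^sup>+\<phi>. u x (add_mset y \<phi>) \<partial>iid_law \<nu> k) \<partial>\<nu>) \<partial>\<nu>)"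
  proof (rule nn_integral_cong)
    fix y
    have "(\<integral>\<^sup>+\<phi>. point_sum (\<lambda>x \<psi>. u x (add_mset y \<psi>)) \<phi> \<partial>iid_law \<nu> (Suc k)) =
      of_nat (Suc k) * (\<integral>\<^sup>+x. (\<integral>\<^sup>+\<phi>. u x (add_mset y \<phi>) \<partial>iid_law \<nu> k) \<partial>\<nu>)"
      by (rule Suc.IH) measurable
    then show "(\<integral>\<^sup>+\<phi>. u y \<phi> + point_sum (\<lambda>x \<psi>. u x (add_mset y \<psi>)) \<phi> \<partial>iid_law \<nu> (Suc k)) =
      (\<integral>\<^sup>+\<phi>. u y \<phi> \<partial>iid_law \<nu> (Suc k)) +
       of_nat (Suc k) * (\<integral>\<^sup>+x. (\<integral>\<^sup>+\<phi>. u x (add_mset y \<phi>) \<partial>iid_law \<nu> k) \<partial>\<nu>)"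
      by (subst nn_integral_add) (simp_all del: iid_law.simps)
  qed
  also have "\<dots> = ?U + of_nat (Suc k) * (\<integral>\<^sup>+y. (\<integral>\<^sup>+x. (\<integral>\<^sup>+\<phi>. u x (add_mset y \<phi>) \<partial>iid_law \<nu> k) \<partial>\<nu>) \<partial>\<nu>)"
    by (subst nn_integral_add) (auto simp: nn_integral_cmult simp del: iid_law.simps of_nat_Suc)
  \<comment> \<open>\<open>y\<close> is the point split off and \<open>x\<close> the removed one.
    After the exchange \<open>y\<close> joins the other \<open>k\<close> points, and the inner
    integral becomes the one for \<open>k + 1\<close> points.\<close>
  also have "(\<integral>\<^sup>+y. (\<integral>\<^sup>+x. (\<integral>\<^sup>+\<phi>. u x (add_mset y \<phi>) \<partial>iid_law \<nu> k) \<partial>\<nu>) \<partial>\<nu>) =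
     (\<integral>\<^sup>+x. (\<integral>\<^sup>+y. (\<integral>\<^sup>+\<phi>. u x (add_mset y \<phi>) \<partial>iid_law \<nu> k) \<partial>\<nu>) \<partial>\<nu>)"
    by (rule P.Fubini') measurable
  also have "\<dots> = ?U"
    by (intro nn_integral_cong nn_integral_iid_law_Suc[symmetric]) measurable
  finally show ?case
    by (simp add: distrib_right del: iid_law.simps)
qed

lemma iid_law_empty: "emeasure (iid_law \<nu> k) {{#}} = (if k = 0 then 1 else 0)"
proof (cases k)
  case (Suc j)
  have "emeasure (iid_law \<nu> k) {{#}} = (\<integral>\<^sup>+\<phi>. indicator {{#}} \<phi> \<partial>iid_law \<nu> k)"
    by simp
  also have "\<dots> = 0" unfolding Suc
    by (subst nn_integral_iid_law_Suc) auto
  finally show ?thesis by (simp add: Suc)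
qed simp

text \<open>A Poisson number of independent points. Mecke's equation for the mixture is the binomial
  one averaged with the Poisson weights \<open>p k\<close>, for which passing from \<open>k\<close>
  to \<open>k + 1\<close> points gains exactly the factor \<open>r\<close>:
  \<open>(k + 1) * p (k + 1) = r * p k\<close>.\<close>

lemma poisson_law_mixture:
  assumes r: "0 < r"
  defines "Q \<equiv> measure_pmf (poisson_pmf r) \<bind> iid_law \<nu>"
  shows "poisson_law (scale_measure (ennreal r) \<nu>) Q"
proof -
  have iid [measurable]: "iid_law \<nu> \<in> measure_pmf (poisson_pmf r) \<rightarrow>\<^sub>M prob_algebra multiset_space"
    by (rule measurableI) (auto simp: space_prob_algebra prob_space_iid_law)
  have int: "(\<integral>\<^sup>+\<phi>. F \<phi> \<partial>Q) = (\<Sum>k. ennreal (r ^ k / fact k * exp (-r)) * (\<integral>\<^sup>+\<phi>. F \<phi> \<partial>iid_law \<nu> k))"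
    if [measurable]: "F \<in> borel_measurable multiset_space" for F
    unfolding Q_def using r
    by (simp add: nn_integral_bind[OF that measurable_prob_algebraD[OF iid]] nn_integral_measure_pmf
        nn_integral_count_space_nat)
  have Q_space: "measure_pmf (poisson_pmf r) \<in> space (prob_algebra (measure_pmf (poisson_pmf r)))"
    by (simp add: space_prob_algebra measure_pmf.prob_space_axioms)
  have "prob_space Q" "sets Q = sets multiset_space"
    unfolding Q_def using prob_space_bind'[OF Q_space iid] sets_bind'[OF Q_space iid] by simp_all
  note sets_Q [measurable_cong, simp] = \<open>sets Q = _\<close>
  have "mecke (scale_measure (ennreal r) \<nu>) Q"
    unfolding mecke_def
  proof (intro allI impI)
    fix u :: "'a \<Rightarrow> 'a multiset \<Rightarrow> ennreal"
    assume u [measurable]: "(\<lambda>(x, \<psi>). u x \<psi>) \<in> borel_measurable (borel \<Otimes>\<^sub>M multiset_space)"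
    interpret I: sigma_finite_measure "iid_law \<nu> k" for k by (rule sigma_finite_iid_law)
    interpret Q: prob_space Q by fact
    let ?J = "\<lambda>k. \<integral>\<^sup>+x. (\<integral>\<^sup>+\<phi>. u x \<phi> \<partial>iid_law \<nu> k) \<partial>\<nu>"
    let ?p = "\<lambda>k. r ^ k / fact k * exp (-r)"
    have [measurable]: "(\<lambda>x. \<integral>\<^sup>+\<phi>. u x \<phi> \<partial>iid_law \<nu> k) \<in> borel_measurable borel" for k
      by measurable
    have "(\<integral>\<^sup>+\<phi>. point_sum u \<phi> \<partial>Q) = (\<Sum>k. ennreal (?p k) * (\<integral>\<^sup>+\<phi>. point_sum u \<phi> \<partial>iid_law \<nu> k))"
      by (rule int[OF measurable_point_sum[OF u]])
    \<comment> \<open>The empty configuration contributes nothing, so the series starts at one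
      point.\<close>
    also have "\<dots> = (\<Sum>k. ennreal (?p (Suc k)) * (\<integral>\<^sup>+\<phi>. point_sum u \<phi> \<partial>iid_law \<nu> (Suc k)))"
      by (subst suminf_offset[of _ 1])
         (auto simp: nn_integral_return measurable_point_sum[OF u] simp del: iid_law.simps(2))
    also have "\<dots> = (\<Sum>k. ennreal r * (ennreal (?p k) * ?J k))"
    proof (rule suminf_cong)
      fix k
      have "ennreal (?p (Suc k)) * of_nat (Suc k) = ennreal (?p (Suc k) * real (Suc k))"
        unfolding ennreal_of_nat_eq_real_of_nat
        by (rule ennreal_mult'[symmetric]) (use r in simp)
      also have "?p (Suc k) * real (Suc k) = r * ?p k"
        by (simp add: field_simps del: of_nat_Suc)
      also have "ennreal \<dots> = ennreal r * ennreal (?p k)"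
        by (rule ennreal_mult') (use r in simp)
      finally have "ennreal (?p (Suc k)) * of_nat (Suc k) * ?J k = ennreal r * ennreal (?p k) * ?J k"
        by simp
      then show "ennreal (?p (Suc k)) * (\<integral>\<^sup>+\<phi>. point_sum u \<phi> \<partial>iid_law \<nu> (Suc k)) = ennreal r * (ennreal (?p k) * ?J k)"
        by (simp only: point_sum_iid_law[OF u] mult.assoc)
    qed
    also have "\<dots> = ennreal r * (\<integral>\<^sup>+x. (\<Sum>k. ennreal (?p k) * (\<integral>\<^sup>+\<phi>. u x \<phi> \<partial>iid_law \<nu> k)) \<partial>\<nu>)"
      by (simp add: nn_integral_suminf nn_integral_cmult)
    also have "\<dots> = ennreal r * (\<integral>\<^sup>+x. (\<integral>\<^sup>+\<phi>. u x \<phi> \<partial>Q) \<partial>\<nu>)"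
      by (subst int) auto
    also have "\<dots> = (\<integral>\<^sup>+x. (\<integral>\<^sup>+\<phi>. u x \<phi> \<partial>Q) \<partial>scale_measure (ennreal r) \<nu>)"
      by (subst nn_integral_scale_measure) auto
    finally show "(\<integral>\<^sup>+\<phi>. point_sum u \<phi> \<partial>Q) = (\<integral>\<^sup>+x. (\<integral>\<^sup>+\<phi>. u x \<phi> \<partial>Q) \<partial>scale_measure (ennreal r) \<nu>)" .
  qed
  moreover have "emeasure Q {{#}} = ennreal (exp (- r))"
  proof -
    have "emeasure Q {{#}} = (\<integral>\<^sup>+\<phi>. indicator {{#}} \<phi> \<partial>Q)" by simp
    also have "\<dots> = (\<Sum>k. ennreal (r ^ k / fact k * exp (-r)) * (if k = 0 then 1 else 0))"
      by (subst int) (simp_all add: iid_law_empty)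
    also have "\<dots> = (\<Sum>k. if k = 0 then ennreal (exp (- r)) else 0)"
      by (intro suminf_cong) auto
    also have "\<dots> = ennreal (exp (- r))"
      by (subst suminf_finite[of "{0}"]) auto
    finally show ?thesis .
  qed
  moreover have "measure (scale_measure (ennreal r) \<nu>) UNIV = r"
    using nu.emeasure_space_1 r sets_eq_imp_space_eq[OF sets_nu] by (simp add: measure_def)
  ultimately show ?thesis
    using \<open>prob_space Q\<close> \<open>sets Q = _\<close> by (simp add: poisson_law_def)
qed

end

lemma poisson_law_zero:
  fixes M :: "'a::topological_space measure"
  assumes "emeasure M UNIV = 0" "sets M = sets borel"
  shows "poisson_law M (return multiset_space {#})"
proof -
  have "UNIV \<in> sets M" using assms(2) by simp
  then have "AE x in M. False"
    using assms(1) by (intro AE_I[of _ _ UNIV]) auto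
  then have "AE x in M. f x = 0" for f :: "'a \<Rightarrow> ennreal"
    by eventually_elim simp
  then have 0: "(\<integral>\<^sup>+x. f x \<partial>M) = 0" for f
    using nn_integral_cong_AE[of f "\<lambda>_. 0" M] by simp
  have "mecke M (return multiset_space {#})"
    unfolding mecke_def by (auto simp: 0 nn_integral_return measurable_point_sum)
  then show ?thesis
    by (simp add: poisson_law_def prob_space_return measure_def assms)
qed

text \<open>\<open>M\<close> is normalised to a probability measure for the mixture; a null measure
  cannot be normalised and has the empty configuration as its Poisson law.\<close>

lemma poisson_law_exists:
  fixes M :: "'a::topological_space measure"
  assumes "finite_measure M" and [simp]: "sets M = sets borel"
  shows "\<exists>Q. poisson_law M Q"
proof (cases "emeasure M UNIV = 0")
  case True
  then show ?thesis using poisson_law_zero assms(2) by blast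
next
  case False
  interpret finite_measure M by fact
  have space: "space M = UNIV" using sets_eq_imp_space_eq[OF assms(2)] by simp
  define r where "r = measure M UNIV"
  have r: "emeasure M UNIV = ennreal r" "0 < r"
    using False by (auto simp: r_def emeasure_eq_measure zero_less_measure_iff)
  let ?\<nu> = "scale_measure (ennreal (1 / r)) M"
  have "prob_space ?\<nu>"
    by (rule prob_spaceI) (use r in \<open>simp add: space space_scale_measure ennreal_mult[symmetric]\<close>)
  from poisson_law_mixture[OF this _ r(2)]
  have "poisson_law (scale_measure (ennreal r) ?\<nu>) (measure_pmf (poisson_pmf r) \<bind> iid_law ?\<nu>)"
    by simp
  moreover have "scale_measure (ennreal r) ?\<nu> = M"
    using r by (simp add: ennreal_mult[symmetric])
  ultimately show ?thesis by auto
qed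

text \<open>Mecke's equation for the indicator of a point labelled \<open>j\<close> whose removal
  leaves the labels \<open>\<xi>\<close>. If the labels are \<open>add_mset j \<xi>\<close>, there
  are \<open>count \<xi> j + 1\<close> such points, otherwise none. The result is the recursion for
  Poisson probabilities, for all labels at once.\<close>

lemma mecke_label:
  assumes m: "mecke M Q" and [simp, measurable_cong]: "sets M = sets borel" "sets Q = sets multiset_space"
    and f: "labelling f"
  shows "of_nat (Suc (count \<xi> j)) * emeasure Q (image_mset f -` {add_mset j \<xi>}) =
    emeasure M (f -` {j}) * emeasure Q (image_mset f -` {\<xi>})"
proof -
  have [measurable]: "f \<in> borel \<rightarrow>\<^sub>M count_space UNIV" using f by (simp add: labelling_def)
  have [measurable]: "image_mset f -` {\<xi>} \<in> sets multiset_space" for \<xi>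
    using measurable_sets[OF measurable_image_labelling[OF f], of "{\<xi>}"] by simp
  have [measurable]: "f -` {j} \<in> sets borel"
    using measurable_sets[of f borel "count_space UNIV" "{j}"] by simp
  let ?u = "\<lambda>x \<phi>. indicator (f -` {j}) x * indicator (image_mset f -` {\<xi>}) \<phi> :: ennreal"
  have ps: "point_sum ?u \<phi> = of_nat (Suc (count \<xi> j)) * indicator (image_mset f -` {add_mset j \<xi>}) \<phi>" for \<phi>
  proof -
    have "point_sum ?u \<phi> = (\<Sum>x\<in>#\<phi>. indicator (f -` {j}) x * indicator (image_mset f -` {add_mset j \<xi>}) \<phi>)"
      unfolding point_sum_def
    proof (rule sum_mset_cong_ennreal)
      fix x assume "x \<in># \<phi>"
      then obtain \<psi> where "\<phi> = add_mset x \<psi>" by (metis insert_DiffM)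
      then show "?u x (\<phi> - {#x#}) = indicator (f -` {j}) x * indicator (image_mset f -` {add_mset j \<xi>}) \<phi>"
        by (auto simp: indicator_def)
    qed
    also have "\<dots> = (\<Sum>x\<in>#\<phi>. indicator (f -` {j}) x) * indicator (image_mset f -` {add_mset j \<xi>}) \<phi>"
      by (simp add: sum_mset_distrib_right)
    also have "(\<Sum>x\<in>#\<phi>. indicator (f -` {j}) x) = (of_nat (count (image_mset f \<phi>) j) :: ennreal)"
      by (induction \<phi>) auto
    also have "\<dots> * indicator (image_mset f -` {add_mset j \<xi>}) \<phi> =
       of_nat (Suc (count \<xi> j)) * indicator (image_mset f -` {add_mset j \<xi>}) \<phi>"
      by (auto simp: indicator_def)
    finally show ?thesis .
  qed
  have "(\<integral>\<^sup>+\<phi>. point_sum ?u \<phi> \<partial>Q) = (\<integral>\<^sup>+x. (\<integral>\<^sup>+\<phi>. ?u x \<phi> \<partial>Q) \<partial>M)"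
    by (rule meckeD[OF m]) measurable
  then show ?thesis
    unfolding ps by (simp add: nn_integral_cmult nn_integral_multc del: of_nat_Suc)
qed

text \<open>Each label multiset is reached from the empty one by adding labels, and the recursion
  fixes the probability at every step, since its left factor is a nonzero integer. The criterion
  serves both for uniqueness and for recognising the law of a Poisson process.\<close>

lemma poisson_law_eqI:
  assumes Q: "poisson_law M Q" and [simp]: "sets M = sets borel"
    and Q': "prob_space Q'" "sets Q' = sets multiset_space"
    and empty: "emeasure Q' {{#}} = ennreal (exp (- measure M UNIV))"
    and rec: "\<And>f \<xi> j. labelling f \<Longrightarrow> of_nat (Suc (count \<xi> j)) * emeasure Q' (image_mset f -` {add_mset j \<xi>}) =
      emeasure M (f -` {j}) * emeasure Q' (image_mset f -` {\<xi>})"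
  shows "Q' = Q"
proof (rule multiset_space_eqI)
  fix f \<xi> assume f: "labelling (f :: 'a \<Rightarrow> nat)"
  show "emeasure Q' (image_mset f -` {\<xi>}) = emeasure Q (image_mset f -` {\<xi>})"
  proof (induction \<xi>)
    case empty
    have "image_mset f -` {{#}} = {{#}}" by auto
    then show ?case using Q assms by (simp add: poisson_law_def)
  next
    case (add j \<xi>)
    have "of_nat (Suc (count \<xi> j)) * emeasure Q' (image_mset f -` {add_mset j \<xi>}) =
       of_nat (Suc (count \<xi> j)) * emeasure Q (image_mset f -` {add_mset j \<xi>})"
      using rec[OF f, of \<xi> j] mecke_label[of M Q f \<xi> j] Q f add by (simp add: poisson_law_def del: of_nat_Suc)
    then show ?case
      by (simp add: ennreal_mult_cancel_left del: of_nat_Suc)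
  qed
qed (use Q Q' in \<open>auto simp: poisson_law_def\<close>)

lemma poisson_law_unique:
  assumes "poisson_law M Q" "poisson_law M Q'" "sets M = sets borel"
  shows "Q' = Q"
  by (rule poisson_law_eqI[OF assms(1,3)])
     (use assms in \<open>auto simp: poisson_law_def mecke_label simp del: of_nat_Suc\<close>)

lemma measurable_sum_mset_fun:
  fixes G :: "'a \<Rightarrow> 'b \<Rightarrow> ennreal"
  assumes "\<And>x. G x \<in> borel_measurable N"
  shows "(\<lambda>\<psi>. \<Sum>x\<in>#A. G x \<psi>) \<in> borel_measurable N"
  by (induction A) (use assms in auto)

lemma nn_integral_sum_mset_fun:
  fixes G :: "'a \<Rightarrow> 'b \<Rightarrow> ennreal"
  assumes "\<And>x. G x \<in> borel_measurable N"
  shows "(\<integral>\<^sup>+\<psi>. (\<Sum>x\<in>#A. G x \<psi>) \<partial>N) = (\<Sum>x\<in>#A. \<integral>\<^sup>+\<psi>. G x \<psi> \<partial>N)"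
proof (induction A)
  case (add x A)
  then show ?case
    using measurable_sum_mset_fun[of G N A, OF assms] assms[of x] by (simp add: nn_integral_add)
qed simp

section \<open>Sums of independent Poisson multisets\<close>

definition conv_law :: "'a::topological_space multiset measure \<Rightarrow> 'a multiset measure \<Rightarrow> 'a multiset measure" where
  "conv_law Q R = distr (Q \<Otimes>\<^sub>M R) multiset_space (\<lambda>(\<phi>, \<psi>). \<phi> + \<psi>)"

lemma sets_conv_law [simp, measurable_cong]: "sets (conv_law Q R) = sets multiset_space"
  by (simp add: conv_law_def)

lemma prob_space_conv_law:
  assumes "prob_space Q" "prob_space R"
    and [measurable_cong]: "sets Q = sets multiset_space" "sets R = sets multiset_space"
  shows "prob_space (conv_law Q R)"
  unfolding conv_law_def by (rule prob_space.prob_space_distr[OF prob_space_pair[OF assms(1,2)]]) measurable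

lemma nn_integral_conv_law:
  assumes "prob_space R"
    and [measurable_cong]: "sets Q = sets multiset_space" "sets R = sets multiset_space"
    and [measurable]: "F \<in> borel_measurable multiset_space"
  shows "(\<integral>\<^sup>+\<phi>. F \<phi> \<partial>conv_law Q R) = (\<integral>\<^sup>+\<phi>. (\<integral>\<^sup>+\<psi>. F (\<phi> + \<psi>) \<partial>R) \<partial>Q)"
proof -
  interpret prob_space R by fact
  have "(\<integral>\<^sup>+\<phi>. F \<phi> \<partial>conv_law Q R) = (\<integral>\<^sup>+z. F (fst z + snd z) \<partial>(Q \<Otimes>\<^sub>M R))"
    by (simp add: conv_law_def nn_integral_distr split_beta')
  also have "\<dots> = (\<integral>\<^sup>+\<phi>. (\<integral>\<^sup>+\<psi>. F (\<phi> + \<psi>) \<partial>R) \<partial>Q)"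
    by (subst nn_integral_fst[symmetric]) auto
  finally show ?thesis .
qed

text \<open>The Leibniz rule for \<open>point_sum\<close> splits the left side of Mecke's equation.
  In each part the equation of one factor is used with the other one frozen, and both parts give the
  same integral, with weights \<open>a\<close> and \<open>b\<close>.\<close>

lemma poisson_law_conv:
  assumes M: "finite_measure M" "sets M = sets borel" and "0 \<le> a" "0 \<le> b"
    and Q: "poisson_law (scale_measure (ennreal a) M) Q" and R: "poisson_law (scale_measure (ennreal b) M) R"
  shows "poisson_law (scale_measure (ennreal (a + b)) M) (conv_law Q R)"
proof -
  note [measurable_cong, simp] = M(2)
  have [measurable_cong, simp]: "sets Q = sets multiset_space" "sets R = sets multiset_space"
    using Q R by (auto simp: poisson_law_def)
  have pQ: "prob_space Q" and pR: "prob_space R" using Q R by (auto simp: poisson_law_def)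
  interpret Q: prob_space Q by fact
  interpret R: prob_space R by fact
  interpret M: finite_measure M by fact
  interpret QR: pair_sigma_finite Q R ..
  interpret RM: pair_sigma_finite R M ..
  interpret QM: pair_sigma_finite Q M ..
  have "mecke (scale_measure (ennreal (a + b)) M) (conv_law Q R)"
    unfolding mecke_def
  proof (intro allI impI)
    fix u :: "'a \<Rightarrow> 'a multiset \<Rightarrow> ennreal"
    assume u [measurable]: "(\<lambda>(x, \<psi>). u x \<psi>) \<in> borel_measurable (borel \<Otimes>\<^sub>M multiset_space)"
    note [measurable] = measurable_point_sum[OF u]
    let ?J = "\<integral>\<^sup>+x. (\<integral>\<^sup>+\<phi>. (\<integral>\<^sup>+\<psi>. u x (\<phi> + \<psi>) \<partial>R) \<partial>Q) \<partial>M"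
    have 1: "(\<integral>\<^sup>+\<psi>. point_sum (\<lambda>x \<xi>. u x (\<phi> + \<xi>)) \<psi> \<partial>R) = ennreal b * (\<integral>\<^sup>+x. (\<integral>\<^sup>+\<psi>. u x (\<phi> + \<psi>) \<partial>R) \<partial>M)" for \<phi>
    proof -
      have "(\<integral>\<^sup>+\<psi>. point_sum (\<lambda>x \<xi>. u x (\<phi> + \<xi>)) \<psi> \<partial>R) =
        (\<integral>\<^sup>+x. (\<integral>\<^sup>+\<psi>. u x (\<phi> + \<psi>) \<partial>R) \<partial>scale_measure (ennreal b) M)"
        by (rule meckeD) (use R in \<open>auto simp: poisson_law_def\<close>)
      then show ?thesis by (simp add: nn_integral_scale_measure)
    qed
    have "(\<integral>\<^sup>+\<phi>. point_sum u \<phi> \<partial>conv_law Q R) = (\<integral>\<^sup>+\<phi>. (\<integral>\<^sup>+\<psi>. point_sum (\<lambda>x \<xi>. u x (\<xi> + \<psi>)) \<phi> +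
       point_sum (\<lambda>x \<xi>. u x (\<phi> + \<xi>)) \<psi> \<partial>R) \<partial>Q)"
      by (subst nn_integral_conv_law) (simp_all add: pR point_sum_plus)
    also have "\<dots> = (\<integral>\<^sup>+\<phi>. point_sum (\<lambda>x \<xi>. \<integral>\<^sup>+\<psi>. u x (\<xi> + \<psi>) \<partial>R) \<phi> +
       ennreal b * (\<integral>\<^sup>+x. (\<integral>\<^sup>+\<psi>. u x (\<phi> + \<psi>) \<partial>R) \<partial>M) \<partial>Q)"
    proof (rule nn_integral_cong)
      fix \<phi>
      have [measurable]: "point_sum (\<lambda>x \<xi>. u x (\<phi> + \<xi>)) \<in> borel_measurable multiset_space"
        by (rule measurable_point_sum) measurable
      have [measurable]: "(\<lambda>\<psi>. point_sum (\<lambda>x \<xi>. u x (\<xi> + \<psi>)) \<phi>) \<in> borel_measurable multiset_space"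
        unfolding point_sum_def by (rule measurable_sum_mset_fun) measurable
      have "(\<integral>\<^sup>+\<psi>. point_sum (\<lambda>x \<xi>. u x (\<xi> + \<psi>)) \<phi> \<partial>R) = point_sum (\<lambda>x \<xi>. \<integral>\<^sup>+\<psi>. u x (\<xi> + \<psi>) \<partial>R) \<phi>"
        unfolding point_sum_def by (rule nn_integral_sum_mset_fun) measurable
      then show "(\<integral>\<^sup>+\<psi>. point_sum (\<lambda>x \<xi>. u x (\<xi> + \<psi>)) \<phi> + point_sum (\<lambda>x \<xi>. u x (\<phi> + \<xi>)) \<psi> \<partial>R) =
        point_sum (\<lambda>x \<xi>. \<integral>\<^sup>+\<psi>. u x (\<xi> + \<psi>) \<partial>R) \<phi> + ennreal b * (\<integral>\<^sup>+x. (\<integral>\<^sup>+\<psi>. u x (\<phi> + \<psi>) \<partial>R) \<partial>M)"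
        by (subst nn_integral_add) (simp_all add: 1)
    qed
    also have "\<dots> = (\<integral>\<^sup>+\<phi>. point_sum (\<lambda>x \<xi>. \<integral>\<^sup>+\<psi>. u x (\<xi> + \<psi>) \<partial>R) \<phi> \<partial>Q) +
       ennreal b * (\<integral>\<^sup>+\<phi>. (\<integral>\<^sup>+x. (\<integral>\<^sup>+\<psi>. u x (\<phi> + \<psi>) \<partial>R) \<partial>M) \<partial>Q)"
    proof -
      have [measurable]: "point_sum (\<lambda>x \<xi>. \<integral>\<^sup>+\<psi>. u x (\<xi> + \<psi>) \<partial>R) \<in> borel_measurable multiset_space"
        by (rule measurable_point_sum) measurable
      show ?thesis by (subst nn_integral_add) (simp_all add: nn_integral_cmult)
    qed
    also have "(\<integral>\<^sup>+\<phi>. point_sum (\<lambda>x \<xi>. \<integral>\<^sup>+\<psi>. u x (\<xi> + \<psi>) \<partial>R) \<phi> \<partial>Q) = ennreal a * ?J"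
    proof -
      have "(\<integral>\<^sup>+\<phi>. point_sum (\<lambda>x \<xi>. \<integral>\<^sup>+\<psi>. u x (\<xi> + \<psi>) \<partial>R) \<phi> \<partial>Q) =
        (\<integral>\<^sup>+x. (\<integral>\<^sup>+\<phi>. (\<integral>\<^sup>+\<psi>. u x (\<phi> + \<psi>) \<partial>R) \<partial>Q) \<partial>scale_measure (ennreal a) M)"
        by (rule meckeD) (use Q in \<open>auto simp: poisson_law_def\<close>)
      then show ?thesis by (simp add: nn_integral_scale_measure)
    qed
    also have "(\<integral>\<^sup>+\<phi>. (\<integral>\<^sup>+x. (\<integral>\<^sup>+\<psi>. u x (\<phi> + \<psi>) \<partial>R) \<partial>M) \<partial>Q) = ?J"
      by (rule QM.Fubini'[symmetric]) measurable
    also have "ennreal a * ?J + ennreal b * ?J = ennreal (a + b) * ?J"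
      using \<open>0 \<le> a\<close> \<open>0 \<le> b\<close> by (simp add: distrib_right)
    also have "\<dots> = (\<integral>\<^sup>+x. (\<integral>\<^sup>+\<phi>. u x \<phi> \<partial>conv_law Q R) \<partial>scale_measure (ennreal (a + b)) M)"
      by (simp add: nn_integral_scale_measure nn_integral_conv_law pR del: ennreal_plus)
    finally show "(\<integral>\<^sup>+\<phi>. point_sum u \<phi> \<partial>conv_law Q R) =
      (\<integral>\<^sup>+x. (\<integral>\<^sup>+\<phi>. u x \<phi> \<partial>conv_law Q R) \<partial>scale_measure (ennreal (a + b)) M)" .
  qed
  moreover have "emeasure (conv_law Q R) {{#}} = ennreal (exp (- measure (scale_measure (ennreal (a + b)) M) UNIV))"
  proof -
    have "emeasure (conv_law Q R) {{#}} = (\<integral>\<^sup>+\<phi>. indicator {{#}} \<phi> \<partial>conv_law Q R)" by simp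
    also have "\<dots> = (\<integral>\<^sup>+\<phi>. (\<integral>\<^sup>+\<psi>. indicator {{#}} \<phi> * indicator {{#}} \<psi> \<partial>R) \<partial>Q)"
      by (subst nn_integral_conv_law)
         (auto simp: pR indicator_def intro!: nn_integral_cong)
    also have "\<dots> = emeasure Q {{#}} * emeasure R {{#}}"
      by (simp add: nn_integral_cmult nn_integral_multc)
    also have "\<dots> = ennreal (exp (- (a * measure M UNIV)) * exp (- (b * measure M UNIV)))"
      using Q R \<open>0 \<le> a\<close> \<open>0 \<le> b\<close> by (simp add: poisson_law_def ennreal_mult)
    also have "exp (- (a * measure M UNIV)) * exp (- (b * measure M UNIV)) = exp (- ((a + b) * measure M UNIV))"
      by (simp add: mult_exp_exp algebra_simps)
    finally show ?thesis using \<open>0 \<le> a\<close> \<open>0 \<le> b\<close> by (simp del: ennreal_plus)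
  qed
  ultimately show ?thesis
    by (simp add: poisson_law_def prob_space_conv_law pQ pR)
qed

section \<open>Densities with respect to the Poisson law\<close>

text \<open>Truncated subtraction with \<open>\<infinity> - \<infinity> = 0\<close>, whereas HOL's subtraction on \<open>ennreal\<close> has
  \<open>\<infinity> - \<infinity> = \<infinity>\<close>.\<close>

definition tdiff :: "ennreal \<Rightarrow> ennreal \<Rightarrow> ennreal" where
  "tdiff a b = (if a \<le> b then 0 else a - b)"

text \<open>The adjunction that characterises truncated subtraction. It holds for all extended
  values, so the inequalities derived from it below need no finiteness assumption.\<close>

lemma tdiff_le_iff: "tdiff a b \<le> c \<longleftrightarrow> a \<le> b + c"
  by (auto simp: tdiff_def ennreal_minus_le_iff intro: add_increasing2)

lemma le_tdiff_add: "a \<le> tdiff a b + b"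
  using tdiff_le_iff[of a b "tdiff a b"] by (simp add: add.commute)

lemma tdiff_add_cancel: "b \<le> a \<Longrightarrow> tdiff a b + b = a"
  by (auto simp: tdiff_def diff_add_cancel_ennreal)

lemma tdiff_eq_0: "a \<le> b \<Longrightarrow> tdiff a b = 0"
  by (simp add: tdiff_def)

lemma tdiff_le_self: "tdiff a b \<le> a"
  by (simp add: tdiff_le_iff)

lemma tdiff_measurable [measurable (raw)]:
  assumes [measurable]: "f \<in> borel_measurable N" "g \<in> borel_measurable N"
  shows "(\<lambda>x. tdiff (f x) (g x)) \<in> borel_measurable N"
  unfolding tdiff_def by measurable

text \<open>A distance on the extended half-line in which two infinite values are equal. It obeys
  the triangle inequality without exception, so infinite values of a density need no special
  care.\<close>

definition abs_diff :: "ennreal \<Rightarrow> ennreal \<Rightarrow> ennreal" where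
  "abs_diff a b = tdiff a b + tdiff b a"

lemma abs_diff_measurable [measurable (raw)]:
  assumes [measurable]: "f \<in> borel_measurable N" "g \<in> borel_measurable N"
  shows "(\<lambda>x. abs_diff (f x) (g x)) \<in> borel_measurable N"
  unfolding abs_diff_def by measurable

text \<open>The equation \<open>gnz\<close> resembles the one that defines a Papangelou intensity of
  \<open>X\<close>, but \<open>C\<close> may depend on the whole sample and not only on
  \<open>X\<close>. In the application \<open>X\<close> is the superposition and \<open>C\<close>
  the average of the intensities of the unthinned copies.\<close>

locale gnz =
  fixes l :: "'a::topological_space measure" and m :: "'a \<Rightarrow> ennreal"
    and P :: "'w measure" and X :: "'w \<Rightarrow> 'a multiset" and C :: "'a \<Rightarrow> 'w \<Rightarrow> ennreal"
    and \<pi> :: "'a multiset measure"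
  assumes finite_l: "finite_measure l" and sets_l [simp, measurable_cong]: "sets l = sets borel"
    and prob_P: "prob_space P" and X [measurable]: "X \<in> P \<rightarrow>\<^sub>M multiset_space"
    and C [measurable]: "(\<lambda>(x, \<omega>). C x \<omega>) \<in> borel_measurable (borel \<Otimes>\<^sub>M P)"
    and m [measurable]: "m \<in> borel_measurable borel"
    and mean: "AE x in l. (\<integral>\<^sup>+\<omega>. C x \<omega> \<partial>P) = m x"
    and finite_m: "(\<integral>\<^sup>+x. m x \<partial>l) < \<infinity>"
    and gnz: "\<And>B. B \<in> sets (borel \<Otimes>\<^sub>M multiset_space) \<Longrightarrow>
      (\<integral>\<^sup>+\<omega>. point_sum (\<lambda>x \<psi>. indicator B (x, \<psi>)) (X \<omega>) \<partial>P) =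
      (\<integral>\<^sup>+x. (\<integral>\<^sup>+\<omega>. C x \<omega> * indicator B (x, X \<omega>) \<partial>P) \<partial>l)"
    and pois: "poisson_law (density l m) \<pi>"
begin

lemma sets_pi [simp, measurable_cong]: "sets \<pi> = sets multiset_space"
  using pois by (simp add: poisson_law_def)

sublocale l: finite_measure l by (rule finite_l)
sublocale P: prob_space P by (rule prob_P)
sublocale pi: prob_space \<pi> using pois by (simp add: poisson_law_def)
sublocale M: finite_measure "density l m"
  by (rule finite_measureI) (use finite_m sets_eq_imp_space_eq[OF sets_l] in \<open>simp add: emeasure_density\<close>)

text \<open>Induction over the number of points. A configuration of \<open>k + 1\<close> points in
  \<open>A\<close> is a point \<open>x\<close> together with \<open>k\<close> points in the section
  \<open>S x\<close>. Mecke's equation shows that almost all sections are null for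
  \<open>\<pi>\<close>, the induction hypothesis that they are null for the law of \<open>X\<close>,
  and \<open>gnz\<close> assembles them.\<close>

lemma null_size:
  assumes "A \<in> sets multiset_space" "emeasure \<pi> A = 0"
  shows "emeasure (distr P multiset_space X) (A \<inter> {\<phi>. size \<phi> = k}) = 0"
  using assms
proof (induction k arbitrary: A)
  case (0 A)
  \<comment> \<open>\<open>\<pi>\<close> charges the empty configuration, which therefore lies in no
    null set.\<close>
  have "{#} \<notin> A"
  proof
    assume "{#} \<in> A"
    then have "emeasure \<pi> {{#}} \<le> emeasure \<pi> A"
      using 0 by (intro emeasure_mono) auto
    then show False
      using 0 pois by (simp add: poisson_law_def)
  qed
  then have "A \<inter> {\<phi>. size \<phi> = 0} = {}" by auto
  then show ?case by simp
next
  case (Suc k A)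
  note [measurable] = Suc.prems(1)
  define A' where "A' = A \<inter> {\<phi>. size \<phi> = Suc k}"
  have A' [measurable]: "A' \<in> sets multiset_space" unfolding A'_def by measurable
  define B where "B = {z. add_mset (fst z) (snd z) \<in> A'}"
  have "B = (\<lambda>z. add_mset (fst z) (snd z)) -` A' \<inter> space (borel \<Otimes>\<^sub>M multiset_space)"
    by (auto simp: B_def space_pair_measure)
  also have "\<dots> \<in> sets (borel \<Otimes>\<^sub>M multiset_space)"
    by measurable
  finally have B [measurable]: "B \<in> sets (borel \<Otimes>\<^sub>M multiset_space)" .
  have ps: "point_sum (\<lambda>x \<psi>. indicator B (x, \<psi>)) \<phi> = of_nat (Suc k) * indicator A' \<phi>" for \<phi>
  proof -
    have "point_sum (\<lambda>x \<psi>. indicator B (x, \<psi>)) \<phi> = point_sum (\<lambda>x \<psi>. indicator A' (add_mset x \<psi>)) \<phi>"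
      by (simp add: B_def indicator_def)
    also have "\<dots> = of_nat (size \<phi>) * indicator A' \<phi>" by (rule point_sum_total)
    finally show ?thesis by (auto simp: A'_def indicator_def)
  qed
  define S where "S x = {\<psi>. add_mset x \<psi> \<in> A'}" for x
  have S [measurable]: "S x \<in> sets multiset_space" for x
  proof -
    have "S x = (\<lambda>\<psi>. add_mset x \<psi>) -` A' \<inter> space multiset_space" by (auto simp: S_def)
    also have "\<dots> \<in> sets multiset_space" by measurable
    finally show ?thesis .
  qed
  have ind: "indicator B (x, \<psi>) = (indicator (S x) \<psi> :: ennreal)" for x \<psi>
    by (simp add: S_def B_def indicator_def)
  have "(\<integral>\<^sup>+x. (\<integral>\<^sup>+\<phi>. indicator B (x, \<phi>) \<partial>\<pi>) \<partial>density l m) = (\<integral>\<^sup>+\<phi>. point_sum (\<lambda>x \<psi>. indicator B (x, \<psi>)) \<phi> \<partial>\<pi>)"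
    using pois by (intro meckeD[symmetric]) (auto simp: poisson_law_def)
  also have "\<dots> = of_nat (Suc k) * emeasure \<pi> A'"
    unfolding ps by (simp add: nn_integral_cmult del: of_nat_Suc)
  also have "emeasure \<pi> A' = 0"
    using emeasure_mono[of A' A \<pi>] Suc.prems by (simp add: A'_def)
  finally have "AE x in density l m. (\<integral>\<^sup>+\<phi>. indicator B (x, \<phi>) \<partial>\<pi>) = 0"
    using nn_integral_0_iff_AE[of "\<lambda>x. \<integral>\<^sup>+\<phi>. indicator B (x, \<phi>) \<partial>\<pi>" "density l m"] by simp
  then have AE: "AE x in l. 0 < m x \<longrightarrow> emeasure \<pi> (S x) = 0"
    by (subst (asm) AE_density) (auto simp: ind)
  have "(\<integral>\<^sup>+x. (\<integral>\<^sup>+\<omega>. C x \<omega> * indicator B (x, X \<omega>) \<partial>P) \<partial>l) = (\<integral>\<^sup>+x. 0 \<partial>l)"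
  proof (rule nn_integral_cong_AE)
    show "AE x in l. (\<integral>\<^sup>+\<omega>. C x \<omega> * indicator B (x, X \<omega>) \<partial>P) = 0"
      using AE mean
    proof eventually_elim
      case (elim x)
      show ?case
      proof (cases "m x = 0")
        case True
        \<comment> \<open>Mecke's equation says nothing where the density \<open>m\<close> vanishes,
          but there \<open>C x\<close> has mean zero, so its integral over any event is
          zero.\<close>
        have "(\<integral>\<^sup>+\<omega>. C x \<omega> * indicator B (x, X \<omega>) \<partial>P) \<le> (\<integral>\<^sup>+\<omega>. C x \<omega> \<partial>P)"
          by (intro nn_integral_mono) (auto simp: indicator_def)
        then show ?thesis using elim True by simp
      next
        case False
        then have "emeasure \<pi> (S x) = 0" using elim by (simp add: zero_less_iff_neq_zero)
        from Suc.IH[OF S this]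
        have "emeasure (distr P multiset_space X) (S x) = 0"
          by (simp add: S_def A'_def Int_def)
        then have "AE \<omega> in P. X \<omega> \<notin> S x"
          by (subst (asm) emeasure_distr) (auto simp: AE_iff_measurable[OF _ refl] vimage_def Int_def conj_commute)
        then have "(\<integral>\<^sup>+\<omega>. C x \<omega> * indicator B (x, X \<omega>) \<partial>P) = (\<integral>\<^sup>+\<omega>. 0 \<partial>P)"
          by (intro nn_integral_cong_AE) (auto simp: ind)
        then show ?thesis by simp
      qed
    qed
  qed
  then have "(\<integral>\<^sup>+\<omega>. point_sum (\<lambda>x \<psi>. indicator B (x, \<psi>)) (X \<omega>) \<partial>P) = 0"
    by (simp add: gnz[OF B])
  then have "(\<integral>\<^sup>+\<omega>. indicator A' (X \<omega>) \<partial>P) = 0"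
    unfolding ps by (simp add: nn_integral_cmult del: of_nat_Suc)
  then have "emeasure (distr P multiset_space X) A' = 0"
    by (subst nn_integral_indicator[symmetric], simp, subst nn_integral_distr) simp_all
  then show ?case by (simp add: A'_def)
qed

lemma abs_continuous: "absolutely_continuous \<pi> (distr P multiset_space X)"
  unfolding absolutely_continuous_def
proof
  fix A assume "A \<in> null_sets \<pi>"
  then have A [measurable]: "A \<in> sets multiset_space" and 0: "emeasure \<pi> A = 0" by auto
  have "(\<Union>k. A \<inter> {\<phi>. size \<phi> = k}) \<in> null_sets (distr P multiset_space X)"
    using null_size[OF A 0] by (intro null_sets_UN) (auto simp: null_sets_def)
  also have "(\<Union>k. A \<inter> {\<phi>. size \<phi> = k}) = A" by auto
  finally show "A \<in> null_sets (distr P multiset_space X)" .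
qed

text \<open>By \<open>I1\<close> and \<open>I2\<close> below, the measures with densities
  \<open>h (add_mset x \<phi>)\<close> and \<open>h \<phi>\<close> with respect to
  \<open>density l m \<Otimes>\<^sub>M \<pi>\<close> are the images of those with densities
  \<open>C\<close> and \<open>m\<close> with respect to \<open>l \<Otimes>\<^sub>M P\<close> under
  the map that applies \<open>X\<close> to the second coordinate. The total variation of the
  difference does not grow under this map.\<close>

lemma density_exists:
  "\<exists>h \<in> borel_measurable multiset_space. distr P multiset_space X = density \<pi> h \<and>
    (\<integral>\<^sup>+x. (\<integral>\<^sup>+\<phi>. abs_diff (h (add_mset x \<phi>)) (h \<phi>) \<partial>\<pi>) \<partial>density l m) \<le>
    (\<integral>\<^sup>+x. (\<integral>\<^sup>+\<omega>. abs_diff (C x \<omega>) (m x) \<partial>P) \<partial>l)"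
proof -
  obtain h where h [measurable]: "h \<in> borel_measurable multiset_space"
    and dens: "density \<pi> h = distr P multiset_space X"
    using pi.Radon_Nikodym[OF abs_continuous] by (auto cong: measurable_cong_sets)
  let ?N1 = "density l m \<Otimes>\<^sub>M \<pi>" and ?N2 = "l \<Otimes>\<^sub>M P"
  let ?h' = "\<lambda>z. h (add_mset (fst z) (snd z))" and ?h = "\<lambda>z. h (snd z)"
  let ?C = "\<lambda>z. C (fst z) (snd z)" and ?m = "\<lambda>z. m (fst z)"
  let ?I = "\<lambda>B z. indicator B (fst z, X (snd z)) :: ennreal"
  \<comment> \<open>The law of \<open>X\<close> is \<open>density \<pi> h\<close>. Moving
    \<open>h\<close> inside the sum over points and applying Mecke's equation evaluates
    \<open>h\<close> at the configuration with the point put back.\<close>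
  have I1: "(\<integral>\<^sup>+z. ?h' z * indicator B z \<partial>?N1) = (\<integral>\<^sup>+z. ?C z * ?I B z \<partial>?N2)"
    if B [measurable]: "B \<in> sets (borel \<Otimes>\<^sub>M multiset_space)" for B
  proof -
    have "(\<integral>\<^sup>+z. ?C z * ?I B z \<partial>?N2) = (\<integral>\<^sup>+\<omega>. point_sum (\<lambda>x \<psi>. indicator B (x, \<psi>)) (X \<omega>) \<partial>P)"
      by (subst gnz[OF B], subst P.nn_integral_fst[symmetric]) auto
    also have "\<dots> = (\<integral>\<^sup>+\<phi>. point_sum (\<lambda>x \<psi>. indicator B (x, \<psi>)) \<phi> \<partial>density \<pi> h)"
      unfolding dens by (subst nn_integral_distr) (auto intro!: measurable_point_sum_indicator B)
    also have "\<dots> = (\<integral>\<^sup>+\<phi>. h \<phi> * point_sum (\<lambda>x \<psi>. indicator B (x, \<psi>)) \<phi> \<partial>\<pi>)"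
      using measurable_point_sum_indicator[OF B] by (subst nn_integral_density) auto
    also have "\<dots> = (\<integral>\<^sup>+\<phi>. point_sum (\<lambda>x \<psi>. h (add_mset x \<psi>) * indicator B (x, \<psi>)) \<phi> \<partial>\<pi>)"
    proof (rule nn_integral_cong)
      fix \<phi>
      show "h \<phi> * point_sum (\<lambda>x \<psi>. indicator B (x, \<psi>)) \<phi> =
        point_sum (\<lambda>x \<psi>. h (add_mset x \<psi>) * indicator B (x, \<psi>)) \<phi>"
        unfolding point_sum_def sum_mset_distrib_left
        by (rule sum_mset_cong_ennreal) simp
    qed
    also have "\<dots> = (\<integral>\<^sup>+x. (\<integral>\<^sup>+\<phi>. h (add_mset x \<phi>) * indicator B (x, \<phi>) \<partial>\<pi>) \<partial>density l m)"
      using pois by (intro meckeD) (auto simp: poisson_law_def)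
    also have "\<dots> = (\<integral>\<^sup>+z. ?h' z * indicator B z \<partial>?N1)"
      by (subst pi.nn_integral_fst[symmetric]) auto
    finally show ?thesis ..
  qed
  have I2: "(\<integral>\<^sup>+z. ?h z * indicator B z \<partial>?N1) = (\<integral>\<^sup>+z. ?m z * ?I B z \<partial>?N2)"
    if B [measurable]: "B \<in> sets (borel \<Otimes>\<^sub>M multiset_space)" for B
  proof -
    have [measurable]: "(\<lambda>\<phi>. indicator B (x, \<phi>)::ennreal) \<in> borel_measurable multiset_space" for x by measurable
    have "(\<integral>\<^sup>+\<phi>. h \<phi> * indicator B (x, \<phi>) \<partial>\<pi>) = (\<integral>\<^sup>+\<omega>. indicator B (x, X \<omega>) \<partial>P)" for x
      by (subst nn_integral_density[symmetric]) (auto simp: dens nn_integral_distr)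
    then have "(\<integral>\<^sup>+z. ?h z * indicator B z \<partial>?N1) = (\<integral>\<^sup>+x. (\<integral>\<^sup>+\<omega>. indicator B (x, X \<omega>) \<partial>P) \<partial>density l m)"
      by (subst pi.nn_integral_fst[symmetric]) auto
    also have "\<dots> = (\<integral>\<^sup>+x. (\<integral>\<^sup>+\<omega>. m x * indicator B (x, X \<omega>) \<partial>P) \<partial>l)"
      by (subst nn_integral_density) (auto simp: nn_integral_cmult)
    also have "\<dots> = (\<integral>\<^sup>+z. ?m z * ?I B z \<partial>?N2)"
      by (subst P.nn_integral_fst[symmetric]) auto
    finally show ?thesis .
  qed
  \<comment> \<open>Finiteness of both masses permits cancelling the common term in
    \<open>up\<close> and \<open>down\<close>.\<close>
  have fin_m: "(\<integral>\<^sup>+z. ?m z * ?I B z \<partial>?N2) \<noteq> \<infinity>" and fin_C: "(\<integral>\<^sup>+z. ?C z * ?I B z \<partial>?N2) \<noteq> \<infinity>"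
    if B [measurable]: "B \<in> sets (borel \<Otimes>\<^sub>M multiset_space)" for B
  proof -
    have "(\<integral>\<^sup>+z. ?m z * ?I B z \<partial>?N2) \<le> (\<integral>\<^sup>+z. ?m z \<partial>?N2)"
      by (intro nn_integral_mono) (auto simp: indicator_def)
    also have "\<dots> = (\<integral>\<^sup>+x. m x \<partial>l)"
      by (subst P.nn_integral_fst[symmetric]) (auto simp: P.emeasure_space_1)
    finally show "(\<integral>\<^sup>+z. ?m z * ?I B z \<partial>?N2) \<noteq> \<infinity>" using finite_m by auto
    have "(\<integral>\<^sup>+z. ?C z * ?I B z \<partial>?N2) \<le> (\<integral>\<^sup>+z. ?C z \<partial>?N2)"
      by (intro nn_integral_mono) (auto simp: indicator_def)
    also have "\<dots> = (\<integral>\<^sup>+x. m x \<partial>l)"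
      using mean by (subst P.nn_integral_fst[symmetric]) (auto intro!: nn_integral_cong_AE)
    finally show "(\<integral>\<^sup>+z. ?C z * ?I B z \<partial>?N2) \<noteq> \<infinity>" using finite_m by auto
  qed
  \<comment> \<open>A Hahn set of the difference: the positive part is tested on \<open>B\<close>,
    the negative part on its complement.\<close>
  define B where "B = {z \<in> space (borel \<Otimes>\<^sub>M multiset_space). ?h z < ?h' z}"
  have B [measurable]: "B \<in> sets (borel \<Otimes>\<^sub>M multiset_space)" unfolding B_def by measurable
  have B_iff: "z \<in> B \<longleftrightarrow> ?h z < ?h' z" for z by (simp add: B_def space_pair_measure)
  have Bc [measurable]: "- B \<in> sets (borel \<Otimes>\<^sub>M multiset_space)"
    using sets.compl_sets[OF B] by (simp add: space_pair_measure Compl_eq_Diff_UNIV)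
  have up: "(\<integral>\<^sup>+z. tdiff (?h' z) (?h z) * indicator B z \<partial>?N1) \<le> (\<integral>\<^sup>+z. tdiff (?C z) (?m z) * ?I B z \<partial>?N2)"
  proof -
    have "(\<integral>\<^sup>+z. tdiff (?h' z) (?h z) * indicator B z \<partial>?N1) + (\<integral>\<^sup>+z. ?h z * indicator B z \<partial>?N1) =
        (\<integral>\<^sup>+z. ?h' z * indicator B z \<partial>?N1)"
      by (subst nn_integral_add[symmetric])
         (auto intro!: nn_integral_cong simp: B_iff indicator_def tdiff_add_cancel less_imp_le)
    also have "\<dots> \<le> (\<integral>\<^sup>+z. tdiff (?C z) (?m z) * ?I B z + ?m z * ?I B z \<partial>?N2)"
      unfolding I1[OF B] by (intro nn_integral_mono) (auto simp: indicator_def le_tdiff_add)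
    also have "\<dots> = (\<integral>\<^sup>+z. tdiff (?C z) (?m z) * ?I B z \<partial>?N2) + (\<integral>\<^sup>+z. ?h z * indicator B z \<partial>?N1)"
      unfolding I2[OF B] by (rule nn_integral_add) measurable
    finally show ?thesis
      using fin_m[OF B] unfolding I2[OF B] by (simp add: ennreal_add_left_cancel_le add.commute)
  qed
  have down: "(\<integral>\<^sup>+z. tdiff (?h z) (?h' z) * indicator (- B) z \<partial>?N1) \<le> (\<integral>\<^sup>+z. tdiff (?m z) (?C z) * ?I (- B) z \<partial>?N2)"
  proof -
    have "(\<integral>\<^sup>+z. tdiff (?h z) (?h' z) * indicator (- B) z \<partial>?N1) + (\<integral>\<^sup>+z. ?h' z * indicator (- B) z \<partial>?N1) =
        (\<integral>\<^sup>+z. ?h z * indicator (- B) z \<partial>?N1)"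
      by (subst nn_integral_add[symmetric])
         (auto intro!: nn_integral_cong simp: B_iff indicator_def tdiff_add_cancel not_less)
    also have "\<dots> \<le> (\<integral>\<^sup>+z. tdiff (?m z) (?C z) * ?I (- B) z + ?C z * ?I (- B) z \<partial>?N2)"
      unfolding I2[OF Bc] by (intro nn_integral_mono) (auto simp: indicator_def le_tdiff_add)
    also have "\<dots> = (\<integral>\<^sup>+z. tdiff (?m z) (?C z) * ?I (- B) z \<partial>?N2) + (\<integral>\<^sup>+z. ?h' z * indicator (- B) z \<partial>?N1)"
      unfolding I1[OF Bc] by (rule nn_integral_add) measurable
    finally show ?thesis
      using fin_C[OF Bc] unfolding I1[OF Bc] by (simp add: ennreal_add_left_cancel_le add.commute)
  qed
  have "(\<integral>\<^sup>+x. (\<integral>\<^sup>+\<phi>. abs_diff (h (add_mset x \<phi>)) (h \<phi>) \<partial>\<pi>) \<partial>density l m) = (\<integral>\<^sup>+z. abs_diff (?h' z) (?h z) \<partial>?N1)"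
    by (subst pi.nn_integral_fst[symmetric]) auto
  also have "\<dots> = (\<integral>\<^sup>+z. tdiff (?h' z) (?h z) * indicator B z + tdiff (?h z) (?h' z) * indicator (- B) z \<partial>?N1)"
    by (intro nn_integral_cong) (auto simp: abs_diff_def indicator_def B_iff tdiff_eq_0 not_less less_imp_le)
  also have "\<dots> = (\<integral>\<^sup>+z. tdiff (?h' z) (?h z) * indicator B z \<partial>?N1) + (\<integral>\<^sup>+z. tdiff (?h z) (?h' z) * indicator (- B) z \<partial>?N1)"
    by (rule nn_integral_add) measurable
  also have "\<dots> \<le> (\<integral>\<^sup>+z. tdiff (?C z) (?m z) * ?I B z \<partial>?N2) + (\<integral>\<^sup>+z. tdiff (?m z) (?C z) * ?I (- B) z \<partial>?N2)"
    by (intro add_mono up down)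
  also have "\<dots> = (\<integral>\<^sup>+z. tdiff (?C z) (?m z) * ?I B z + tdiff (?m z) (?C z) * ?I (- B) z \<partial>?N2)"
    by (rule nn_integral_add[symmetric]) measurable
  also have "\<dots> \<le> (\<integral>\<^sup>+z. abs_diff (?C z) (?m z) \<partial>?N2)"
    by (intro nn_integral_mono) (auto simp: abs_diff_def indicator_def)
  also have "\<dots> = (\<integral>\<^sup>+x. (\<integral>\<^sup>+\<omega>. abs_diff (C x \<omega>) (m x) \<partial>P) \<partial>l)"
    by (subst P.nn_integral_fst[symmetric]) auto
  finally show ?thesis using h dens by (intro bexI[of _ h]) simp_all
qed

end

section \<open>Lower integrals and the maximal coupling\<close>

text \<open>\<open>nn_integral\<close> of an arbitrary function is a lower integral, the supremum
  over the simple functions below it; so an upper bound has to be checked only for measurable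
  minorants. This is how the cost \<open>TV_dist\<close>, a supremum over Borel sets, is integrated
  without showing that it is measurable.\<close>

lemma nn_integral_le_simple:
  assumes "\<And>g. g \<in> borel_measurable M \<Longrightarrow> g \<le> f \<Longrightarrow> (\<integral>\<^sup>+x. g x \<partial>M) \<le> c"
  shows "(\<integral>\<^sup>+x. f x \<partial>M) \<le> c"
  unfolding nn_integral_def
proof (rule SUP_least)
  fix g assume "g \<in> {g. simple_function M g \<and> g \<le> f}"
  then have g: "simple_function M g" "g \<le> f" by auto
  then show "integral\<^sup>S M g \<le> c"
    using assms[OF borel_measurable_simple_function[OF g(1)] g(2)]
    by (simp add: nn_integral_eq_simple_integral)
qed

text \<open>Without measurability of \<open>f\<close> only this direction is available: minorants of
  \<open>f\<close> pull back along \<open>T\<close>, but a minorant of the composition need not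
  factor through \<open>T\<close>.\<close>

lemma nn_integral_distr_le:
  assumes "T \<in> M \<rightarrow>\<^sub>M N"
  shows "(\<integral>\<^sup>+x. f x \<partial>distr M N T) \<le> (\<integral>\<^sup>+x. f (T x) \<partial>M)"
proof (rule nn_integral_le_simple)
  fix g assume "g \<in> borel_measurable (distr M N T)" "g \<le> f"
  then show "(\<integral>\<^sup>+x. g x \<partial>distr M N T) \<le> (\<integral>\<^sup>+x. f (T x) \<partial>M)"
    using assms by (subst nn_integral_distr) (auto simp: le_fun_def intro!: nn_integral_mono)
qed

lemma nn_integral_bind_le:
  assumes K: "K \<in> N \<rightarrow>\<^sub>M subprob_algebra B" and "space N \<noteq> {}"
  shows "(\<integral>\<^sup>+x. f x \<partial>(N \<bind> K)) \<le> (\<integral>\<^sup>+x. (\<integral>\<^sup>+y. f y \<partial>K x) \<partial>N)"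
proof (rule nn_integral_le_simple)
  fix g assume g: "g \<in> borel_measurable (N \<bind> K)" "g \<le> f"
  have "sets (N \<bind> K) = sets B"
    using subprob_measurableD(2)[OF K] \<open>space N \<noteq> {}\<close> by (intro sets_bind) auto
  then have "g \<in> borel_measurable B"
    using g by (simp cong: measurable_cong_sets)
  then show "(\<integral>\<^sup>+x. g x \<partial>(N \<bind> K)) \<le> (\<integral>\<^sup>+x. (\<integral>\<^sup>+y. f y \<partial>K x) \<partial>N)"
    using g by (subst nn_integral_bind[OF _ K]) (auto simp: le_fun_def intro!: nn_integral_mono)
qed

text \<open>Lower integrals are not additive in general. For a constant, however, a measurable
  minorant \<open>g\<close> of the sum yields the measurable minorant \<open>tdiff (g x) c\<close>
  of \<open>f\<close>.\<close>

lemma nn_integral_const_add_le: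
  assumes "prob_space M"
  shows "(\<integral>\<^sup>+x. c + f x \<partial>M) \<le> c + (\<integral>\<^sup>+x. f x \<partial>M)"
proof (cases "c = \<infinity>")
  case False
  interpret prob_space M by fact
  show ?thesis
  proof (rule nn_integral_le_simple)
    fix g assume [measurable]: "g \<in> borel_measurable M" and g: "g \<le> (\<lambda>x. c + f x)"
    have "(\<integral>\<^sup>+x. g x \<partial>M) \<le> (\<integral>\<^sup>+x. c + tdiff (g x) c \<partial>M)"
      by (intro nn_integral_mono) (metis add.commute le_tdiff_add)
    also have "\<dots> = c + (\<integral>\<^sup>+x. tdiff (g x) c \<partial>M)"
      by (subst nn_integral_add) (auto simp: emeasure_space_1)
    also have "(\<integral>\<^sup>+x. tdiff (g x) c \<partial>M) \<le> (\<integral>\<^sup>+x. f x \<partial>M)"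
      using g by (intro nn_integral_mono) (simp add: tdiff_le_iff le_fun_def)
    finally show "(\<integral>\<^sup>+x. g x \<partial>M) \<le> c + (\<integral>\<^sup>+x. f x \<partial>M)" by simp
  qed
qed simp

lemma abs_diff_commute: "abs_diff a b = abs_diff b a"
  by (simp add: abs_diff_def add.commute)

lemma tdiff_triangle: "tdiff a c \<le> tdiff a b + tdiff b c"
proof -
  have "a \<le> tdiff a b + b" by (rule le_tdiff_add)
  also have "\<dots> \<le> tdiff a b + (tdiff b c + c)" by (intro add_mono le_tdiff_add order_refl)
  finally show ?thesis by (simp add: tdiff_le_iff add_ac)
qed

lemma abs_diff_triangle: "abs_diff a c \<le> abs_diff a b + abs_diff b c"
  unfolding abs_diff_def
  using add_mono[OF tdiff_triangle[of a c b] tdiff_triangle[of c a b]] by (simp add: add_ac)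

lemma abs_diff_le_add: "abs_diff a b \<le> a + b"
  unfolding abs_diff_def by (intro add_mono tdiff_le_self)

lemma abs_diff_same [simp]: "abs_diff a a = 0"
  by (simp add: abs_diff_def tdiff_def)

lemma le_abs_diff_add: "a \<le> abs_diff a b + b"
  unfolding abs_diff_def using le_tdiff_add[of a b] by (meson add_increasing2 add_mono order_trans order_refl zero_le)

lemma tdiff_nn_integral_le:
  assumes [measurable]: "f \<in> borel_measurable M" "g \<in> borel_measurable M"
  shows "tdiff (\<integral>\<^sup>+x. f x \<partial>M) (\<integral>\<^sup>+x. g x \<partial>M) \<le> (\<integral>\<^sup>+x. tdiff (f x) (g x) \<partial>M)"
proof -
  have "(\<integral>\<^sup>+x. f x \<partial>M) \<le> (\<integral>\<^sup>+x. g x + tdiff (f x) (g x) \<partial>M)"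
    by (intro nn_integral_mono) (metis add.commute le_tdiff_add)
  also have "\<dots> = (\<integral>\<^sup>+x. g x \<partial>M) + (\<integral>\<^sup>+x. tdiff (f x) (g x) \<partial>M)"
    by (rule nn_integral_add) measurable
  finally show ?thesis by (simp add: tdiff_le_iff)
qed

lemma abs_diff_nn_integral_le:
  assumes [measurable]: "f \<in> borel_measurable M" "g \<in> borel_measurable M"
  shows "abs_diff (\<integral>\<^sup>+x. f x \<partial>M) (\<integral>\<^sup>+x. g x \<partial>M) \<le> (\<integral>\<^sup>+x. abs_diff (f x) (g x) \<partial>M)"
proof -
  have "(\<integral>\<^sup>+x. abs_diff (f x) (g x) \<partial>M) = (\<integral>\<^sup>+x. tdiff (f x) (g x) \<partial>M) + (\<integral>\<^sup>+x. tdiff (g x) (f x) \<partial>M)"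
    unfolding abs_diff_def by (rule nn_integral_add) measurable
  then show ?thesis
    unfolding abs_diff_def by (simp add: add_mono tdiff_nn_integral_le)
qed

section \<open>Maximal coupling of a probability density with its reference law\<close>

lemma min_add_excess: "min (a :: ennreal) 1 + (a - 1) = a"
proof (cases "a \<le> 1")
  case True
  then have "a \<noteq> top" by (auto simp: top_unique)
  then show ?thesis using True by (simp add: min_def diff_eq_0_ennreal top.not_eq_extremum)
next
  case False
  then have "1 \<le> a" "min a 1 = 1" by (auto simp: min_def)
  then show ?thesis by (simp add: add.commute diff_add_cancel_ennreal)
qed

lemma min_add_deficit: "min (a :: ennreal) 1 + (1 - a) = 1"
proof (cases "a \<le> 1")
  case True
  then show ?thesis by (simp add: min_def add.commute diff_add_cancel_ennreal)
next
  case False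
  then show ?thesis by (simp add: min_def diff_eq_0_ennreal not_le less_imp_le)
qed

text \<open>The maximal coupling of \<open>density \<pi> f\<close> and \<open>\<pi>\<close>. A
  triple \<open>(b, e, p)\<close> stands for the pair \<open>(e, e)\<close> if \<open>b\<close>
  holds, with \<open>p\<close> as a dummy, and for \<open>(e, p)\<close> otherwise. The common part
  has density \<open>min (f e) 1\<close>; the rest is the product of excess and deficit, divided by
  their common mass. The flag makes success an event even where the diagonal is not
  measurable.\<close>

definition max_coupling_weight :: "'b measure \<Rightarrow> ('b \<Rightarrow> ennreal) \<Rightarrow> bool \<times> 'b \<times> 'b \<Rightarrow> ennreal" where
  "max_coupling_weight \<pi> f = (\<lambda>(b, e, p). if b then min (f e) 1
     else (f e - 1) * (1 - f p) * inverse (\<integral>\<^sup>+q. (1 - f q) \<partial>\<pi>))"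

definition max_coupling :: "'b measure \<Rightarrow> ('b \<Rightarrow> ennreal) \<Rightarrow> (bool \<times> 'b \<times> 'b) measure" where
  "max_coupling \<pi> f = density (count_space UNIV \<Otimes>\<^sub>M (\<pi> \<Otimes>\<^sub>M \<pi>)) (max_coupling_weight \<pi> f)"

lemma sets_max_coupling [simp, measurable_cong]:
  "sets (max_coupling \<pi> f) = sets (count_space UNIV \<Otimes>\<^sub>M (\<pi> \<Otimes>\<^sub>M \<pi>))"
  by (simp add: max_coupling_def)

context
  fixes \<pi> :: "'b measure" and f :: "'b \<Rightarrow> ennreal"
  assumes prob_pi: "prob_space \<pi>" and f [measurable]: "f \<in> borel_measurable \<pi>"
    and int_f: "(\<integral>\<^sup>+e. f e \<partial>\<pi>) = 1"
begin

interpretation pi: prob_space \<pi> by (rule prob_pi)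
interpretation pp: pair_prob_space \<pi> \<pi> ..

text \<open>\<open>f\<close> and the constant 1 have the same integral, so what each has beyond the
  common part \<open>min (f e) 1\<close> has the same mass; one normalisation serves for
  both.\<close>

lemma max_coupling_excess:
  "(\<integral>\<^sup>+e. (f e - 1) \<partial>\<pi>) = (\<integral>\<^sup>+e. (1 - f e) \<partial>\<pi>)" "(\<integral>\<^sup>+e. (1 - f e) \<partial>\<pi>) \<le> 1"
proof -
  let ?m = "\<integral>\<^sup>+e. min (f e) 1 \<partial>\<pi>"
  have "(\<integral>\<^sup>+e. (f e - 1) \<partial>\<pi>) + ?m = (\<integral>\<^sup>+e. (f e - 1) + min (f e) 1 \<partial>\<pi>)"
    by (rule nn_integral_add[symmetric]) measurable
  also have "\<dots> = (\<integral>\<^sup>+e. f e \<partial>\<pi>)"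
    by (intro nn_integral_cong) (metis add.commute min_add_excess)
  finally have 1: "(\<integral>\<^sup>+e. (f e - 1) \<partial>\<pi>) + ?m = 1" by (simp add: int_f)
  have "(\<integral>\<^sup>+e. (1 - f e) \<partial>\<pi>) + ?m = (\<integral>\<^sup>+e. (1 - f e) + min (f e) 1 \<partial>\<pi>)"
    by (rule nn_integral_add[symmetric]) measurable
  also have "\<dots> = (\<integral>\<^sup>+e. 1 \<partial>\<pi>)"
    by (intro nn_integral_cong) (metis add.commute min_add_deficit)
  finally have 2: "(\<integral>\<^sup>+e. (1 - f e) \<partial>\<pi>) + ?m = 1" by (simp add: pi.emeasure_space_1)
  have "?m \<noteq> \<infinity>" using 1 by (metis ennreal_add_eq_top ennreal_one_neq_top infinity_ennreal_def)
  with 1 2 show "(\<integral>\<^sup>+e. (f e - 1) \<partial>\<pi>) = (\<integral>\<^sup>+e. (1 - f e) \<partial>\<pi>)"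
    by (metis ennreal_add_diff_cancel_right infinity_ennreal_def)
  show "(\<integral>\<^sup>+e. (1 - f e) \<partial>\<pi>) \<le> 1" using 2 by (metis add.commute le_iff_add)
qed

lemma max_coupling_weight_measurable [measurable]:
  "max_coupling_weight \<pi> f \<in> borel_measurable (count_space UNIV \<Otimes>\<^sub>M (\<pi> \<Otimes>\<^sub>M \<pi>))"
  unfolding max_coupling_weight_def split_beta' by measurable

lemma nn_integral_max_coupling:
  assumes F [measurable]: "F \<in> borel_measurable (count_space UNIV \<Otimes>\<^sub>M (\<pi> \<Otimes>\<^sub>M \<pi>))"
  shows "(\<integral>\<^sup>+y. F y \<partial>max_coupling \<pi> f) =
    (\<integral>\<^sup>+e. min (f e) 1 * (\<integral>\<^sup>+p. F (True, e, p) \<partial>\<pi>) \<partial>\<pi>) +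
    (\<integral>\<^sup>+e. (f e - 1) * inverse (\<integral>\<^sup>+q. (1 - f q) \<partial>\<pi>) * (\<integral>\<^sup>+p. (1 - f p) * F (False, e, p) \<partial>\<pi>) \<partial>\<pi>)"
proof -
  have "(\<integral>\<^sup>+y. F y \<partial>max_coupling \<pi> f) =
    (\<integral>\<^sup>+y. max_coupling_weight \<pi> f y * F y \<partial>(count_space UNIV \<Otimes>\<^sub>M (\<pi> \<Otimes>\<^sub>M \<pi>)))"
    unfolding max_coupling_def by (rule nn_integral_density) measurable
  also have "\<dots> = (\<integral>\<^sup>+b. (\<integral>\<^sup>+z. max_coupling_weight \<pi> f (b, z) * F (b, z) \<partial>(\<pi> \<Otimes>\<^sub>M \<pi>)) \<partial>count_space UNIV)"
    by (rule pp.P.nn_integral_fst[symmetric]) measurable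
  also have "\<dots> = (\<integral>\<^sup>+z. max_coupling_weight \<pi> f (True, z) * F (True, z) \<partial>(\<pi> \<Otimes>\<^sub>M \<pi>)) +
     (\<integral>\<^sup>+z. max_coupling_weight \<pi> f (False, z) * F (False, z) \<partial>(\<pi> \<Otimes>\<^sub>M \<pi>))"
    by (subst nn_integral_count_space_finite) (auto simp: UNIV_bool add.commute)
  also have "(\<integral>\<^sup>+z. max_coupling_weight \<pi> f (True, z) * F (True, z) \<partial>(\<pi> \<Otimes>\<^sub>M \<pi>)) =
     (\<integral>\<^sup>+e. min (f e) 1 * (\<integral>\<^sup>+p. F (True, e, p) \<partial>\<pi>) \<partial>\<pi>)"
  proof -
    have "(\<integral>\<^sup>+z. max_coupling_weight \<pi> f (True, z) * F (True, z) \<partial>(\<pi> \<Otimes>\<^sub>M \<pi>)) =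
      (\<integral>\<^sup>+e. (\<integral>\<^sup>+p. max_coupling_weight \<pi> f (True, e, p) * F (True, e, p) \<partial>\<pi>) \<partial>\<pi>)"
      by (rule pi.nn_integral_fst[symmetric]) measurable
    also have "\<dots> = (\<integral>\<^sup>+e. (\<integral>\<^sup>+p. min (f e) 1 * F (True, e, p) \<partial>\<pi>) \<partial>\<pi>)"
      by (simp add: max_coupling_weight_def)
    also have "\<dots> = (\<integral>\<^sup>+e. min (f e) 1 * (\<integral>\<^sup>+p. F (True, e, p) \<partial>\<pi>) \<partial>\<pi>)"
      by (intro nn_integral_cong nn_integral_cmult) measurable
    finally show ?thesis .
  qed
  also have "(\<integral>\<^sup>+z. max_coupling_weight \<pi> f (False, z) * F (False, z) \<partial>(\<pi> \<Otimes>\<^sub>M \<pi>)) =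
     (\<integral>\<^sup>+e. (f e - 1) * inverse (\<integral>\<^sup>+q. (1 - f q) \<partial>\<pi>) * (\<integral>\<^sup>+p. (1 - f p) * F (False, e, p) \<partial>\<pi>) \<partial>\<pi>)"
  proof -
    have "(\<integral>\<^sup>+z. max_coupling_weight \<pi> f (False, z) * F (False, z) \<partial>(\<pi> \<Otimes>\<^sub>M \<pi>)) =
      (\<integral>\<^sup>+e. (\<integral>\<^sup>+p. max_coupling_weight \<pi> f (False, e, p) * F (False, e, p) \<partial>\<pi>) \<partial>\<pi>)"
      by (rule pi.nn_integral_fst[symmetric]) measurable
    also have "\<dots> = (\<integral>\<^sup>+e. (\<integral>\<^sup>+p. ((f e - 1) * inverse (\<integral>\<^sup>+q. (1 - f q) \<partial>\<pi>)) * ((1 - f p) * F (False, e, p)) \<partial>\<pi>) \<partial>\<pi>)"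
      by (simp add: max_coupling_weight_def mult_ac)
    also have "\<dots> = (\<integral>\<^sup>+e. (f e - 1) * inverse (\<integral>\<^sup>+q. (1 - f q) \<partial>\<pi>) * (\<integral>\<^sup>+p. (1 - f p) * F (False, e, p) \<partial>\<pi>) \<partial>\<pi>)"
      by (intro nn_integral_cong nn_integral_cmult) measurable
    finally show ?thesis .
  qed
  finally show ?thesis .
qed

text \<open>If the deficit has mass zero, the inverse is infinite; but then excess and deficit
  vanish almost everywhere, and zero times infinity is zero.\<close>

lemma max_coupling_cancel:
  assumes g [measurable]: "g \<in> borel_measurable \<pi>" and v: "v = (\<lambda>e. f e - 1) \<or> v = (\<lambda>e. 1 - f e)"
  shows "(\<integral>\<^sup>+e. v e * g e \<partial>\<pi>) * inverse (\<integral>\<^sup>+q. (1 - f q) \<partial>\<pi>) * (\<integral>\<^sup>+q. (1 - f q) \<partial>\<pi>) = (\<integral>\<^sup>+e. v e * g e \<partial>\<pi>)"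
proof (cases "(\<integral>\<^sup>+q. (1 - f q) \<partial>\<pi>) = 0")
  case True
  have [measurable]: "v \<in> borel_measurable \<pi>" using v by auto
  have "(\<integral>\<^sup>+e. v e \<partial>\<pi>) = 0"
    using v max_coupling_excess True by auto
  then have "AE e in \<pi>. v e = 0" by (subst (asm) nn_integral_0_iff_AE) auto
  then have "(\<integral>\<^sup>+e. v e * g e \<partial>\<pi>) = (\<integral>\<^sup>+e. 0 \<partial>\<pi>)"
    by (intro nn_integral_cong_AE) auto
  then show ?thesis by simp
next
  case False
  moreover have "(\<integral>\<^sup>+q. (1 - f q) \<partial>\<pi>) \<noteq> top"
    using max_coupling_excess(2) by (metis ennreal_one_neq_top top.extremum_uniqueI)
  ultimately have "inverse (\<integral>\<^sup>+q. (1 - f q) \<partial>\<pi>) * (\<integral>\<^sup>+q. (1 - f q) \<partial>\<pi>) = 1"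
    using ennreal_divide_self by (simp add: divide_ennreal_def mult.commute less_top)
  then show ?thesis by (simp add: mult.assoc)
qed

lemma max_coupling_fst:
  assumes g [measurable]: "g \<in> borel_measurable \<pi>"
  shows "(\<integral>\<^sup>+y. g (fst (snd y)) \<partial>max_coupling \<pi> f) = (\<integral>\<^sup>+e. f e * g e \<partial>\<pi>)"
proof -
  let ?r = "\<integral>\<^sup>+q. (1 - f q) \<partial>\<pi>"
  have "(\<integral>\<^sup>+y. g (fst (snd y)) \<partial>max_coupling \<pi> f) =
    (\<integral>\<^sup>+e. min (f e) 1 * g e \<partial>\<pi>) + (\<integral>\<^sup>+e. (f e - 1) * inverse ?r * (?r * g e) \<partial>\<pi>)"
    by (subst nn_integral_max_coupling) (auto simp: pi.emeasure_space_1 nn_integral_multc)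
  also have "(\<integral>\<^sup>+e. (f e - 1) * inverse ?r * (?r * g e) \<partial>\<pi>) = (\<integral>\<^sup>+e. (f e - 1) * g e * (inverse ?r * ?r) \<partial>\<pi>)"
    by (simp add: mult_ac)
  also have "\<dots> = (\<integral>\<^sup>+e. (f e - 1) * g e \<partial>\<pi>)"
    using max_coupling_cancel[OF g, of "\<lambda>e. f e - 1"] by (subst nn_integral_multc) (auto simp: mult.assoc)
  also have "(\<integral>\<^sup>+e. min (f e) 1 * g e \<partial>\<pi>) + \<dots> = (\<integral>\<^sup>+e. min (f e) 1 * g e + (f e - 1) * g e \<partial>\<pi>)"
    by (rule nn_integral_add[symmetric]) measurable
  also have "\<dots> = (\<integral>\<^sup>+e. f e * g e \<partial>\<pi>)"
    unfolding distrib_right[symmetric]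
    by (intro nn_integral_cong arg_cong2[where f = times] refl)
       (rule min_add_excess)
  finally show ?thesis .
qed

lemma max_coupling_snd:
  assumes g [measurable]: "g \<in> borel_measurable \<pi>"
  shows "(\<integral>\<^sup>+y. g (if fst y then fst (snd y) else snd (snd y)) \<partial>max_coupling \<pi> f) = (\<integral>\<^sup>+e. g e \<partial>\<pi>)"
proof -
  let ?r = "\<integral>\<^sup>+q. (1 - f q) \<partial>\<pi>"
  have "(\<integral>\<^sup>+y. g (if fst y then fst (snd y) else snd (snd y)) \<partial>max_coupling \<pi> f) =
    (\<integral>\<^sup>+e. min (f e) 1 * g e \<partial>\<pi>) + (\<integral>\<^sup>+e. (f e - 1) * inverse ?r * (\<integral>\<^sup>+p. (1 - f p) * g p \<partial>\<pi>) \<partial>\<pi>)"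
    by (subst nn_integral_max_coupling) (auto simp: pi.emeasure_space_1)
  also have "(\<integral>\<^sup>+e. (f e - 1) * inverse ?r * (\<integral>\<^sup>+p. (1 - f p) * g p \<partial>\<pi>) \<partial>\<pi>) =
     (\<integral>\<^sup>+e. (f e - 1) * (inverse ?r * (\<integral>\<^sup>+p. (1 - f p) * g p \<partial>\<pi>)) \<partial>\<pi>)"
    by (simp add: mult_ac)
  also have "\<dots> = (\<integral>\<^sup>+p. (1 - f p) * g p \<partial>\<pi>) * inverse ?r * ?r"
    by (subst nn_integral_multc) (auto simp: max_coupling_excess(1) mult_ac)
  also have "\<dots> = (\<integral>\<^sup>+p. (1 - f p) * g p \<partial>\<pi>)"
    by (rule max_coupling_cancel[OF g]) simp
  also have "(\<integral>\<^sup>+e. min (f e) 1 * g e \<partial>\<pi>) + \<dots> = (\<integral>\<^sup>+e. min (f e) 1 * g e + (1 - f e) * g e \<partial>\<pi>)"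
    by (rule nn_integral_add[symmetric]) measurable
  also have "\<dots> = (\<integral>\<^sup>+e. 1 * g e \<partial>\<pi>)"
    unfolding distrib_right[symmetric]
    by (intro nn_integral_cong arg_cong2[where f = times] refl)
       (rule min_add_deficit)
  finally show ?thesis by simp
qed

lemma prob_space_max_coupling: "prob_space (max_coupling \<pi> f)"
proof (rule prob_spaceI)
  have "emeasure (max_coupling \<pi> f) (space (max_coupling \<pi> f)) = (\<integral>\<^sup>+y. 1 \<partial>max_coupling \<pi> f)"
    by simp
  also have "\<dots> = 1"
    using max_coupling_fst[of "\<lambda>_. 1"] int_f by simp
  finally show "emeasure (max_coupling \<pi> f) (space (max_coupling \<pi> f)) = 1" .
qed

text \<open>On failure both coordinates are charged. In the product part the coordinate that is not
  charged integrates out and cancels the normalisation. What remains is the excess of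
  \<open>f\<close> weighted by \<open>g\<close> for the first coordinate and the deficit weighted by
  \<open>g\<close> for the second.\<close>

lemma max_coupling_cost:
  assumes g [measurable]: "g \<in> borel_measurable \<pi>"
  shows "(\<integral>\<^sup>+y. (if fst y then 0 else g (fst (snd y)) + g (snd (snd y))) \<partial>max_coupling \<pi> f) =
    (\<integral>\<^sup>+e. ((f e - 1) + (1 - f e)) * g e \<partial>\<pi>)"
proof -
  let ?r = "\<integral>\<^sup>+q. (1 - f q) \<partial>\<pi>"
  let ?F = "\<lambda>y :: bool \<times> 'b \<times> 'b. if fst y then 0 else g (fst (snd y)) + g (snd (snd y))"
  let ?G = "\<integral>\<^sup>+p. (1 - f p) * g p \<partial>\<pi>"
  have "(\<integral>\<^sup>+y. ?F y \<partial>max_coupling \<pi> f) =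
     (\<integral>\<^sup>+e. (f e - 1) * inverse ?r * (\<integral>\<^sup>+p. (1 - f p) * (g e + g p) \<partial>\<pi>) \<partial>\<pi>)"
    by (subst nn_integral_max_coupling) auto
  also have "\<dots> = (\<integral>\<^sup>+e. (f e - 1) * g e * (inverse ?r * ?r) + (f e - 1) * (inverse ?r * ?G) \<partial>\<pi>)"
  proof (rule nn_integral_cong)
    fix e
    have "(\<integral>\<^sup>+p. (1 - f p) * (g e + g p) \<partial>\<pi>) = ?r * g e + ?G"
      by (simp add: distrib_left nn_integral_add nn_integral_multc)
    then show "(f e - 1) * inverse ?r * (\<integral>\<^sup>+p. (1 - f p) * (g e + g p) \<partial>\<pi>) =
      (f e - 1) * g e * (inverse ?r * ?r) + (f e - 1) * (inverse ?r * ?G)"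
      by (simp add: distrib_left mult_ac)
  qed
  also have "\<dots> = (\<integral>\<^sup>+e. (f e - 1) * g e \<partial>\<pi>) * (inverse ?r * ?r) + ?r * (inverse ?r * ?G)"
    by (simp add: nn_integral_add nn_integral_multc max_coupling_excess(1))
  also have "(\<integral>\<^sup>+e. (f e - 1) * g e \<partial>\<pi>) * (inverse ?r * ?r) = (\<integral>\<^sup>+e. (f e - 1) * g e \<partial>\<pi>)"
    using max_coupling_cancel[OF g, of "\<lambda>e. f e - 1"] by (simp add: mult.assoc)
  also have "?r * (inverse ?r * ?G) = ?G"
    using max_coupling_cancel[OF g, of "\<lambda>e. 1 - f e"] by (simp add: mult_ac)
  also have "(\<integral>\<^sup>+e. (f e - 1) * g e \<partial>\<pi>) + ?G = (\<integral>\<^sup>+e. ((f e - 1) + (1 - f e)) * g e \<partial>\<pi>)"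
    by (simp add: distrib_right nn_integral_add)
  finally show ?thesis .
qed

end

section \<open>Sequential coupling\<close>

lemma mult_divide_cancel_ennreal: "b \<noteq> 0 \<Longrightarrow> b < \<infinity> \<Longrightarrow> b * (x / b) = (x :: ennreal)"
  using mult_divide_eq_ennreal[of b x] by (simp add: ennreal_times_divide mult.commute less_top[symmetric])

text \<open>\<open>\<pi>\<close> is the law of a single increment; \<open>h\<close> weights the sum
  of all increments.\<close>

locale coupling_scheme =
  fixes \<pi> :: "'a::topological_space multiset measure" and h :: "'a multiset \<Rightarrow> ennreal"
  assumes prob_pi: "prob_space \<pi>" and sets_pi [simp, measurable_cong]: "sets \<pi> = sets multiset_space"
    and h [measurable]: "h \<in> borel_measurable multiset_space"
begin

sublocale pi: prob_space \<pi> by (rule prob_pi)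

text \<open>The mean of \<open>h\<close> at the final sum, given that the increments so far add up
  to \<open>z\<close> and \<open>s\<close> more are to come: a nonnegative martingale along
  independent increments of law \<open>\<pi>\<close>, from which the conditional densities are
  formed.\<close>

primrec H :: "nat \<Rightarrow> 'a multiset \<Rightarrow> ennreal" where
  "H 0 z = h z"
| "H (Suc s) z = (\<integral>\<^sup>+e. H s (z + e) \<partial>\<pi>)"

lemma H_measurable [measurable]: "H s \<in> borel_measurable multiset_space"
proof (induction s)
  case (Suc s)
  note [measurable] = Suc
  show ?case by simp
qed simp

primrec pw :: "nat \<Rightarrow> 'a multiset measure" where
  "pw 0 = return multiset_space {#}"
| "pw (Suc s) = conv_law \<pi> (pw s)"

lemma sets_pw [simp, measurable_cong]: "sets (pw s) = sets multiset_space"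
  by (cases s) simp_all

lemma prob_space_pw: "prob_space (pw s)"
  by (induction s) (simp_all add: prob_space_return prob_space_conv_law prob_pi)

sublocale pw: prob_space "pw s" for s by (rule prob_space_pw)

lemma nn_integral_pw_Suc:
  "F \<in> borel_measurable multiset_space \<Longrightarrow>
    (\<integral>\<^sup>+\<phi>. F \<phi> \<partial>pw (Suc s)) = (\<integral>\<^sup>+e. (\<integral>\<^sup>+w. F (e + w) \<partial>pw s) \<partial>\<pi>)"
  by (simp add: nn_integral_conv_law prob_space_pw)

lemma H_eq_pw: "H s z = (\<integral>\<^sup>+w. h (z + w) \<partial>pw s)"
proof (induction s arbitrary: z)
  case 0
  show ?case by (simp add: nn_integral_return)
next
  case (Suc s)
  show ?case
    by (simp del: pw.simps add: Suc nn_integral_pw_Suc add.assoc)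
qed

text \<open>If \<open>z\<close> collects the increments so far and \<open>s + 1\<close> increments are still to come, then
  \<open>ratio s z\<close> is the conditional density, relative to \<open>\<pi>\<close>, of the next increment under \<open>h \<pi>\<^sup>N\<close>; the
  value \<open>1\<close> on the exceptional set keeps it a probability density.\<close>

definition ratio :: "nat \<Rightarrow> 'a multiset \<Rightarrow> 'a multiset \<Rightarrow> ennreal" where
  "ratio s z e = (if 0 < H (Suc s) z \<and> H (Suc s) z < \<infinity> then H s (z + e) / H (Suc s) z else 1)"

lemma ratio_measurable [measurable]:
  "(\<lambda>(z, e). ratio s z e) \<in> borel_measurable (multiset_space \<Otimes>\<^sub>M multiset_space)"
  unfolding ratio_def by measurable

lemma ratio_int: "(\<integral>\<^sup>+e. ratio s z e \<partial>\<pi>) = 1"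
proof (cases "0 < H (Suc s) z \<and> H (Suc s) z < \<infinity>")
  case True
  then have "(\<integral>\<^sup>+e. ratio s z e \<partial>\<pi>) = (\<integral>\<^sup>+e. H s (z + e) / H (Suc s) z \<partial>\<pi>)"
    by (simp add: ratio_def del: H.simps)
  also have "\<dots> = (\<integral>\<^sup>+e. H s (z + e) \<partial>\<pi>) / H (Suc s) z"
    by (rule nn_integral_divide) measurable
  also have "\<dots> = 1" using True ennreal_divide_self[of "H (Suc s) z"] by (simp add: zero_less_iff_neq_zero)
  finally show ?thesis .
next
  case False
  then have "ratio s z = (\<lambda>_. 1)" by (auto simp: ratio_def simp del: H.simps)
  then show ?thesis by (simp add: pi.emeasure_space_1)
qed

abbreviation step :: "nat \<Rightarrow> 'a multiset \<Rightarrow> (bool \<times> 'a multiset \<times> 'a multiset) measure" where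
  "step s z \<equiv> max_coupling \<pi> (ratio s z)"

abbreviation step_space :: "(bool \<times> 'a multiset \<times> 'a multiset) measure" where
  "step_space \<equiv> count_space UNIV \<Otimes>\<^sub>M (multiset_space \<Otimes>\<^sub>M multiset_space)"

lemma sets_step [simp, measurable_cong]: "sets (step s z) = sets step_space"
proof -
  have "sets (\<pi> \<Otimes>\<^sub>M \<pi>) = sets (multiset_space \<Otimes>\<^sub>M multiset_space)"
    by (intro sets_pair_measure_cong) simp_all
  then show ?thesis
    unfolding sets_max_coupling by (intro sets_pair_measure_cong) simp_all
qed

lemma space_step_space [simp]: "space step_space = UNIV"
  by (simp add: space_pair_measure)

lemma space_step [simp]: "space (step s z) = UNIV"
  using sets_eq_imp_space_eq[OF sets_step] by simp

lemma prob_space_step: "prob_space (step s z)"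
  by (rule prob_space_max_coupling[OF prob_pi _ ratio_int]) measurable

lemma step_measurable [measurable]: "step s \<in> multiset_space \<rightarrow>\<^sub>M prob_algebra step_space"
proof (rule measurable_prob_algebraI)
  show "step s \<in> multiset_space \<rightarrow>\<^sub>M subprob_algebra step_space"
  proof (rule measurable_subprob_algebra)
    interpret pp: pair_prob_space \<pi> \<pi> ..
    interpret sf: sigma_finite_measure "count_space (UNIV :: bool set)"
      by (rule sigma_finite_measure_count_space_countable) simp
    interpret bpp: pair_sigma_finite "count_space (UNIV :: bool set)" "\<pi> \<Otimes>\<^sub>M \<pi>" ..
    fix A :: "(bool \<times> 'a multiset \<times> 'a multiset) set" assume A: "A \<in> sets step_space"
    let ?N = "count_space UNIV \<Otimes>\<^sub>M (\<pi> \<Otimes>\<^sub>M \<pi>)"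
    have sets_N [measurable_cong]: "sets ?N = sets step_space"
      using sets_step[of s "{#}"] unfolding sets_max_coupling .
    have [measurable]: "A \<in> sets ?N" using A by (simp add: sets_N)
    have "emeasure (step s z) A = (\<integral>\<^sup>+y. max_coupling_weight \<pi> (ratio s z) y * indicator A y \<partial>?N)" for z
      unfolding max_coupling_def
      by (rule emeasure_density) (auto intro!: max_coupling_weight_measurable[OF prob_pi _ ratio_int])
    moreover have "(\<lambda>z. \<integral>\<^sup>+y. max_coupling_weight \<pi> (ratio s z) y * indicator A y \<partial>?N) \<in> borel_measurable multiset_space"
      unfolding max_coupling_weight_def split_beta' by measurable
    ultimately show "(\<lambda>z. emeasure (step s z) A) \<in> borel_measurable multiset_space"
      by simp
  qed (rule prob_space_imp_subprob_space prob_space_step sets_step)+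
qed (rule prob_space_step)

abbreviation pair_space :: "('a multiset \<times> 'a multiset) measure" where
  "pair_space \<equiv> multiset_space \<Otimes>\<^sub>M multiset_space"

text \<open>Adds the current increment to the sums of the later ones; the flag decides whether the
  second side repeats the increment of the first.\<close>

definition glue :: "bool \<times> 'a multiset \<times> 'a multiset \<Rightarrow> 'a multiset \<times> 'a multiset \<Rightarrow> 'a multiset \<times> 'a multiset" where
  "glue y w = (fst (snd y) + fst w, (if fst y then fst (snd y) else snd (snd y)) + snd w)"

lemma glue_measurable [measurable]: "(\<lambda>(y, w). glue y w) \<in> step_space \<Otimes>\<^sub>M pair_space \<rightarrow>\<^sub>M pair_space"
  unfolding glue_def split_beta' by measurable

text \<open>The joint law of the remaining sums on both sides. Only the past \<open>z\<close> of the
  weighted side enters, because the increments of the other side have to be independent of their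
  past.\<close>

primrec G :: "nat \<Rightarrow> 'a multiset \<Rightarrow> ('a multiset \<times> 'a multiset) measure" where
  "G 0 z = return pair_space ({#}, {#})"
| "G (Suc s) z = step s z \<bind> (\<lambda>y. distr (G s (z + fst (snd y))) pair_space (glue y))"

lemma G_measurable [measurable]: "G s \<in> multiset_space \<rightarrow>\<^sub>M prob_algebra pair_space"
proof (induction s)
  case 0
  have "G 0 = (\<lambda>z. return pair_space ({#}, {#}))" by (simp add: fun_eq_iff)
  then show ?case
    by (simp add: space_prob_algebra prob_space_return space_pair_measure)
next
  case (Suc s)
  note [measurable] = Suc
  have "(\<lambda>(z, y). distr (G s (z + fst (snd y))) pair_space (glue y))
    \<in> multiset_space \<Otimes>\<^sub>M step_space \<rightarrow>\<^sub>M prob_algebra pair_space"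
    unfolding split_beta'
    by (rule measurable_distr_prob_space2[where M = pair_space]) measurable
  then have "(\<lambda>z. step s z \<bind> (\<lambda>y. distr (G s (z + fst (snd y))) pair_space (glue y)))
    \<in> multiset_space \<rightarrow>\<^sub>M prob_algebra pair_space"
    by (intro measurable_bind_prob_space2[OF step_measurable]) simp
  then show ?case by (simp add: fun_eq_iff[symmetric] cong: measurable_cong)
qed

lemma prob_space_G: "prob_space (G s z)" and sets_G [simp, measurable_cong]: "sets (G s z) = sets pair_space"
  using measurable_space[OF G_measurable, of z s] by (auto simp: space_prob_algebra)

lemma G_Suc_kernel:
  "(\<lambda>y. distr (G s (z + fst (snd y))) pair_space (glue y)) \<in> step s z \<rightarrow>\<^sub>M subprob_algebra pair_space"
proof -
  have "(\<lambda>y. distr (G s (z + fst (snd y))) pair_space (glue y)) \<in> step_space \<rightarrow>\<^sub>M prob_algebra pair_space"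
    by (rule measurable_distr_prob_space2[where M = pair_space]) measurable
  then show ?thesis
    by (intro measurable_prob_algebraD) (simp cong: measurable_cong_sets)
qed

lemma nn_integral_G_Suc:
  assumes F [measurable]: "F \<in> borel_measurable pair_space"
  shows "(\<integral>\<^sup>+w. F w \<partial>G (Suc s) z) = (\<integral>\<^sup>+y. (\<integral>\<^sup>+w. F (glue y w) \<partial>G s (z + fst (snd y))) \<partial>step s z)"
proof -
  have [measurable]: "glue y \<in> pair_space \<rightarrow>\<^sub>M pair_space" for y
    unfolding glue_def by measurable
  show ?thesis
    by (simp add: nn_integral_bind[OF F G_Suc_kernel] nn_integral_distr)
qed

lemma nn_integral_G_Suc_le:
  "(\<integral>\<^sup>+w. F w \<partial>G (Suc s) z) \<le> (\<integral>\<^sup>+y. (\<integral>\<^sup>+w. F (glue y w) \<partial>G s (z + fst (snd y))) \<partial>step s z)"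
proof -
  have "glue y \<in> pair_space \<rightarrow>\<^sub>M pair_space" for y
    unfolding glue_def by measurable
  then have "glue y \<in> G s x \<rightarrow>\<^sub>M pair_space" for x y
    by (simp cong: measurable_cong_sets)
  then have "(\<integral>\<^sup>+y. (\<integral>\<^sup>+w. F w \<partial>distr (G s (z + fst (snd y))) pair_space (glue y)) \<partial>step s z) \<le>
     (\<integral>\<^sup>+y. (\<integral>\<^sup>+w. F (glue y w) \<partial>G s (z + fst (snd y))) \<partial>step s z)"
    by (intro nn_integral_mono nn_integral_distr_le)
  then show ?thesis
    using nn_integral_bind_le[OF G_Suc_kernel, of s z F] by simp
qed

text \<open>The second coordinate of a step has law \<open>\<pi>\<close> whatever \<open>z\<close>
  is, so the later steps may depend on the first side without disturbing the law of the sum on the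
  second.\<close>

lemma G_snd:
  assumes F [measurable]: "F \<in> borel_measurable multiset_space"
  shows "(\<integral>\<^sup>+w. F (snd w) \<partial>G s z) = (\<integral>\<^sup>+w. F w \<partial>pw s)"
  using F
proof (induction s arbitrary: z F)
  case 0
  note [measurable] = 0
  show ?case by (simp add: nn_integral_return space_pair_measure)
next
  case (Suc s z F)
  note [measurable] = Suc.prems
  have "(\<integral>\<^sup>+w. F (snd w) \<partial>G (Suc s) z) =
    (\<integral>\<^sup>+y. (\<integral>\<^sup>+w. F ((if fst y then fst (snd y) else snd (snd y)) + snd w) \<partial>G s (z + fst (snd y))) \<partial>step s z)"
    by (subst nn_integral_G_Suc) (simp_all add: glue_def)
  also have "\<dots> = (\<integral>\<^sup>+y. (\<integral>\<^sup>+w. F ((if fst y then fst (snd y) else snd (snd y)) + w) \<partial>pw s) \<partial>step s z)"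
    by (intro nn_integral_cong Suc.IH) measurable
  also have "\<dots> = (\<integral>\<^sup>+e. (\<integral>\<^sup>+w. F (e + w) \<partial>pw s) \<partial>\<pi>)"
    by (rule max_coupling_snd[OF prob_pi _ ratio_int, where g = "\<lambda>e. \<integral>\<^sup>+w. F (e + w) \<partial>pw s"]) measurable
  also have "\<dots> = (\<integral>\<^sup>+w. F w \<partial>pw (Suc s))"
    by (rule nn_integral_pw_Suc[symmetric]) measurable
  finally show ?case .
qed

lemma H_finite_AE:
  assumes "H (Suc s) z < \<infinity>"
  shows "AE e in \<pi>. H s (z + e) < \<infinity>"
proof -
  have "AE e in \<pi>. H s (z + e) \<noteq> \<infinity>"
    by (rule nn_integral_noteq_infinite) (use assms in auto)
  then show ?thesis by (simp add: less_top)
qed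

lemma ratio_mult:
  assumes "H (Suc s) z < \<infinity>" "H (Suc s) z \<noteq> 0"
  shows "H (Suc s) z * ratio s z e = H s (z + e)"
proof -
  have "H (Suc s) z * (H s (z + e) / H (Suc s) z) = H s (z + e)"
    using assms by (intro mult_divide_cancel_ennreal)
  then show ?thesis using assms by (simp add: ratio_def zero_less_iff_neq_zero del: H.simps)
qed

text \<open>A chain rule: the conditional densities telescope, since
  \<open>H (Suc s) z * ratio s z e = H s (z + e)\<close>, and end at \<open>h\<close>. Multiplying
  by \<open>H s z\<close> instead of dividing keeps the statement meaningful where this weight
  vanishes.\<close>

lemma G_fst:
  assumes F [measurable]: "F \<in> borel_measurable multiset_space" and fin: "H s z < \<infinity>"
  shows "H s z * (\<integral>\<^sup>+w. F (fst w) \<partial>G s z) = (\<integral>\<^sup>+w. F w * h (z + w) \<partial>pw s)"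
  using F fin
proof (induction s arbitrary: z F)
  case 0
  note [measurable] = 0(1)
  show ?case by (simp add: nn_integral_return space_pair_measure mult.commute)
next
  case (Suc s z F)
  note [measurable] = Suc.prems(1)
  let ?I = "\<lambda>e. \<integral>\<^sup>+w. F (e + fst w) \<partial>G s (z + e)"
  have [measurable]: "?I \<in> borel_measurable multiset_space"
    by (rule nn_integral_measurable_subprob_algebra2[where N = pair_space])
       (measurable, rule measurable_prob_algebraD, measurable)
  have *: "(\<integral>\<^sup>+w. F (fst w) \<partial>G (Suc s) z) = (\<integral>\<^sup>+e. ratio s z e * ?I e \<partial>\<pi>)"
  proof -
    have "(\<integral>\<^sup>+w. F (fst w) \<partial>G (Suc s) z) = (\<integral>\<^sup>+y. ?I (fst (snd y)) \<partial>step s z)"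
      by (subst nn_integral_G_Suc) (simp_all add: glue_def)
    also have "\<dots> = (\<integral>\<^sup>+e. ratio s z e * ?I e \<partial>\<pi>)"
      by (rule max_coupling_fst[OF prob_pi _ ratio_int]) measurable
    finally show ?thesis .
  qed
  have "H (Suc s) z * (\<integral>\<^sup>+w. F (fst w) \<partial>G (Suc s) z) = (\<integral>\<^sup>+e. H s (z + e) * ?I e \<partial>\<pi>)"
  proof (cases "H (Suc s) z = 0")
    case True
    \<comment> \<open>Almost every successor weight \<open>H s (z + e)\<close> is zero as well, so
      the default value of \<open>ratio\<close> does not matter.\<close>
    have "AE e in \<pi>. H s (z + e) = 0"
      using True by (simp add: nn_integral_0_iff_AE)
    then have "(\<integral>\<^sup>+e. H s (z + e) * ?I e \<partial>\<pi>) = (\<integral>\<^sup>+e. 0 \<partial>\<pi>)"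
      by (intro nn_integral_cong_AE) auto
    then show ?thesis using True by (simp del: H.simps)
  next
    case False
    have "H (Suc s) z * (\<integral>\<^sup>+e. ratio s z e * ?I e \<partial>\<pi>) = (\<integral>\<^sup>+e. H (Suc s) z * (ratio s z e * ?I e) \<partial>\<pi>)"
      by (rule nn_integral_cmult[symmetric]) measurable
    also have "\<dots> = (\<integral>\<^sup>+e. H s (z + e) * ?I e \<partial>\<pi>)"
      using ratio_mult[OF Suc.prems(2) False] by (simp add: mult.assoc[symmetric] del: H.simps)
    finally show ?thesis using * by simp
  qed
  also have "\<dots> = (\<integral>\<^sup>+e. (\<integral>\<^sup>+w. F (e + w) * h (z + e + w) \<partial>pw s) \<partial>\<pi>)"
  proof (rule nn_integral_cong_AE)
    show "AE e in \<pi>. H s (z + e) * ?I e = (\<integral>\<^sup>+w. F (e + w) * h (z + e + w) \<partial>pw s)"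
      using H_finite_AE[OF Suc.prems(2)]
      by eventually_elim (rule Suc.IH; measurable)
  qed
  also have "\<dots> = (\<integral>\<^sup>+w. F w * h (z + w) \<partial>pw (Suc s))"
    by (subst nn_integral_pw_Suc) (simp_all add: add.assoc)
  finally show ?case .
qed

text \<open>An upper estimate of the expected number of mismatched points: whenever a step fails,
  all points of both increments are charged.\<close>

primrec cost :: "nat \<Rightarrow> 'a multiset \<Rightarrow> ennreal" where
  "cost 0 z = 0"
| "cost (Suc s) z = (\<integral>\<^sup>+y. (if fst y then 0 else of_nat (size (fst (snd y))) + of_nat (size (snd (snd y)))) +
     cost s (z + fst (snd y)) \<partial>step s z)"

lemma cost_measurable [measurable]: "cost s \<in> borel_measurable multiset_space"
proof (induction s)
  case 0
  have "cost 0 = (\<lambda>_. 0)" by (simp add: fun_eq_iff)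
  then show ?case by simp
next
  case (Suc s)
  note [measurable] = Suc
  have "(\<lambda>z. \<integral>\<^sup>+y. (if fst y then 0 else of_nat (size (fst (snd y))) + of_nat (size (snd (snd y)))) +
     cost s (z + fst (snd y)) \<partial>step s z) \<in> borel_measurable multiset_space"
    by (rule nn_integral_measurable_subprob_algebra2[where N = step_space])
       (measurable, rule measurable_prob_algebraD, measurable)
  then show ?case by (simp add: fun_eq_iff[symmetric] cong: measurable_cong)
qed

text \<open>The function \<open>T\<close> need not be measurable; the integral on the left is a lower integral.\<close>

lemma G_le_cost:
  assumes T: "T {#} {#} = 0" "\<And>e w w'. T (e + w) (e + w') \<le> T w w'"
    "\<And>e p w w'. T (e + w) (p + w') \<le> (of_nat (size e) + of_nat (size p)) + T w w'"
  shows "(\<integral>\<^sup>+w. T (fst w) (snd w) \<partial>G s z) \<le> cost s z"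
proof (induction s arbitrary: z)
  case 0
  have "(\<integral>\<^sup>+w. T (fst w) (snd w) \<partial>G 0 z) \<le> 0"
  proof (rule nn_integral_le_simple)
    fix g assume "g \<in> borel_measurable (G 0 z)" "g \<le> (\<lambda>w. T (fst w) (snd w))"
    then show "(\<integral>\<^sup>+w. g w \<partial>G 0 z) \<le> 0"
      using T(1) by (simp add: nn_integral_return space_pair_measure le_fun_def)
         (metis fst_conv snd_conv le_zero_eq)
  qed
  then show ?case by simp
next
  case (Suc s z)
  let ?c = "\<lambda>y :: bool \<times> 'a multiset \<times> 'a multiset. if fst y then 0 else of_nat (size (fst (snd y))) + of_nat (size (snd (snd y))) :: ennreal"
  have "(\<integral>\<^sup>+w. T (fst w) (snd w) \<partial>G (Suc s) z) \<le>
     (\<integral>\<^sup>+y. (\<integral>\<^sup>+w. T (fst (glue y w)) (snd (glue y w)) \<partial>G s (z + fst (snd y))) \<partial>step s z)"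
    by (rule nn_integral_G_Suc_le)
  \<comment> \<open>On success both sides receive the same increment, which does not increase
    \<open>T\<close>; on failure the two sizes are paid. These are the two rules for
    \<open>T\<close>.\<close>
  also have "\<dots> \<le> (\<integral>\<^sup>+y. (\<integral>\<^sup>+w. ?c y + T (fst w) (snd w) \<partial>G s (z + fst (snd y))) \<partial>step s z)"
    by (intro nn_integral_mono) (simp add: glue_def T)
  also have "\<dots> \<le> (\<integral>\<^sup>+y. ?c y + cost s (z + fst (snd y)) \<partial>step s z)"
    by (intro nn_integral_mono order_trans[OF nn_integral_const_add_le[OF prob_space_G]] add_mono Suc order_refl)
  finally show ?case by simp
qed

text \<open>A bound for the cost of one step multiplied by its weight \<open>H (Suc s) z\<close>,
  which removes the denominator of \<open>ratio\<close>. In \<open>V\<close> the weighted cost thus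
  becomes a sum of integrals with respect to \<open>\<pi>\<close> alone.\<close>

definition U :: "nat \<Rightarrow> 'a multiset \<Rightarrow> ennreal" where
  "U s z = (\<integral>\<^sup>+e. of_nat (size e) * abs_diff (H s (z + e)) (H (Suc s) z) \<partial>\<pi>)"

primrec V :: "nat \<Rightarrow> 'a multiset \<Rightarrow> ennreal" where
  "V 0 z = 0"
| "V (Suc s) z = U s z + (\<integral>\<^sup>+e. V s (z + e) \<partial>\<pi>)"

lemma U_measurable [measurable]: "U s \<in> borel_measurable multiset_space"
  unfolding U_def by (simp del: H.simps)

lemma V_measurable [measurable]: "V s \<in> borel_measurable multiset_space"
proof (induction s)
  case 0
  have "V 0 = (\<lambda>_. 0)" by (simp add: fun_eq_iff)
  then show ?case by simp
next
  case (Suc s)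
  note [measurable] = Suc
  show ?case by simp
qed

lemma excess_le_abs_diff:
  assumes "0 < b" "b < (\<infinity> :: ennreal)"
  shows "b * ((a / b - 1) + (1 - a / b)) \<le> abs_diff a b"
proof -
  have b: "b / b = 1" using assms by (simp add: ennreal_divide_self)
  have *: "b * (x / b) = x" for x
    using assms by (intro mult_divide_cancel_ennreal) auto
  have "a / b \<le> (b + tdiff a b) / b"
    by (rule divide_right_mono_ennreal) (simp add: tdiff_le_iff[symmetric])
  then have 1: "a / b - 1 \<le> tdiff a b / b"
    using b by (simp add: ennreal_minus_le_iff add_divide_distrib_ennreal)
  have "b / b \<le> (a + tdiff b a) / b"
    by (rule divide_right_mono_ennreal) (simp add: tdiff_le_iff[symmetric])
  then have 2: "1 - a / b \<le> tdiff b a / b"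
    using b by (simp add: ennreal_minus_le_iff add_divide_distrib_ennreal)
  have "b * ((a / b - 1) + (1 - a / b)) \<le> b * (tdiff a b / b + tdiff b a / b)"
    by (intro mult_left_mono add_mono 1 2) simp
  also have "\<dots> = abs_diff a b"
    by (simp add: distrib_left * abs_diff_def)
  finally show ?thesis .
qed

text \<open>A change of measure: the weight \<open>H (Suc s) z\<close> times the conditional density
  is the next weight \<open>H s (z + e)\<close>, so expectations along the weighted path turn into
  expectations over independent increments of law \<open>\<pi>\<close>.\<close>

lemma cost_le_V: "H s z < \<infinity> \<Longrightarrow> H s z * cost s z \<le> V s z"
proof (induction s arbitrary: z)
  case (Suc s z)
  show ?case
  proof (cases "H (Suc s) z = 0")
    case False
    let ?H = "H (Suc s) z" and ?f = "ratio s z"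
    have f: "?f e = H s (z + e) / ?H" for e
      using False Suc.prems by (simp add: ratio_def zero_less_iff_neq_zero del: H.simps)
    have "cost (Suc s) z = (\<integral>\<^sup>+y. (if fst y then 0 else of_nat (size (fst (snd y))) + of_nat (size (snd (snd y)))) \<partial>step s z) +
      (\<integral>\<^sup>+y. cost s (z + fst (snd y)) \<partial>step s z)"
      unfolding cost.simps by (rule nn_integral_add) measurable
    also have "(\<integral>\<^sup>+y. cost s (z + fst (snd y)) \<partial>step s z) = (\<integral>\<^sup>+e. ?f e * cost s (z + e) \<partial>\<pi>)"
      by (rule max_coupling_fst[OF prob_pi _ ratio_int, where g = "\<lambda>e. cost s (z + e)"]) measurable
    also have "(\<integral>\<^sup>+y. (if fst y then 0 else of_nat (size (fst (snd y))) + of_nat (size (snd (snd y)))) \<partial>step s z) =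
      (\<integral>\<^sup>+e. ((?f e - 1) + (1 - ?f e)) * of_nat (size e) \<partial>\<pi>)"
      by (rule max_coupling_cost[OF prob_pi _ ratio_int]) measurable
    finally have "?H * cost (Suc s) z = (\<integral>\<^sup>+e. ?H * (((?f e - 1) + (1 - ?f e)) * of_nat (size e)) \<partial>\<pi>) +
      (\<integral>\<^sup>+e. ?H * (?f e * cost s (z + e)) \<partial>\<pi>)"
      by (simp add: distrib_left nn_integral_cmult del: cost.simps H.simps)
    also have "\<dots> \<le> U s z + (\<integral>\<^sup>+e. V s (z + e) \<partial>\<pi>)"
    proof (rule add_mono)
      show "(\<integral>\<^sup>+e. ?H * (((?f e - 1) + (1 - ?f e)) * of_nat (size e)) \<partial>\<pi>) \<le> U s z"
        unfolding U_def f
      proof (rule nn_integral_mono)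
        fix e
        have "?H * ((H s (z + e) / ?H - 1) + (1 - H s (z + e) / ?H)) \<le> abs_diff (H s (z + e)) ?H"
          by (rule excess_le_abs_diff) (use False Suc.prems in \<open>auto simp: zero_less_iff_neq_zero simp del: H.simps\<close>)
        from mult_right_mono[OF this, of "of_nat (size e)"]
        show "?H * (((H s (z + e) / ?H - 1) + (1 - H s (z + e) / ?H)) * of_nat (size e)) \<le>
          of_nat (size e) * abs_diff (H s (z + e)) ?H"
          by (simp add: mult_ac del: H.simps)
      qed
      show "(\<integral>\<^sup>+e. ?H * (?f e * cost s (z + e)) \<partial>\<pi>) \<le> (\<integral>\<^sup>+e. V s (z + e) \<partial>\<pi>)"
      proof (rule nn_integral_mono_AE)
        show "AE e in \<pi>. ?H * (?f e * cost s (z + e)) \<le> V s (z + e)"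
          using H_finite_AE[OF Suc.prems]
        proof eventually_elim
          case (elim e)
          then show ?case
            using Suc.IH[OF elim] ratio_mult[OF Suc.prems False, of e]
            by (simp add: mult.assoc[symmetric] del: H.simps)
        qed
      qed
    qed
    finally show ?thesis by simp
  qed (simp del: H.simps)
qed simp

end

section \<open>The cost of the sequential coupling\<close>

text \<open>Here \<open>\<pi>\<close> and \<open>M\<close> belong to a single increment. In
  \<open>coupling_exists\<close> they are instantiated with the intensity divided by the number of
  steps and its Poisson law.\<close>

locale poisson_coupling = coupling_scheme \<pi> h
  for \<pi> :: "'a::topological_space multiset measure" and h +
  fixes M :: "'a measure"
  assumes M_pois: "poisson_law M \<pi>" and finite_M: "finite_measure M"
    and sets_M [simp, measurable_cong]: "sets M = sets borel"
begin

sublocale M: finite_measure M by (rule finite_M)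

definition \<alpha> :: "'a multiset \<Rightarrow> ennreal" where
  "\<alpha> \<phi> = (\<integral>\<^sup>+x. abs_diff (h (add_mset x \<phi>)) (h \<phi>) \<partial>M)"

text \<open>The effect on \<open>h\<close> of a whole increment, whereas \<open>\<alpha>\<close> is
  that of one added point. It is small because an increment is mostly empty, and \<open>U\<close>
  receives it with a further factor \<open>mass\<close>.\<close>

definition \<beta> :: "'a multiset \<Rightarrow> ennreal" where
  "\<beta> \<phi> = (\<integral>\<^sup>+e. abs_diff (h (\<phi> + e)) (h \<phi>) \<partial>\<pi>)"

definition mass :: ennreal where
  "mass = emeasure M UNIV"

lemma emeasure_M_space: "emeasure M (space M) = mass"
  using sets_eq_imp_space_eq[OF sets_M] by (simp add: mass_def)

lemma \<alpha>_measurable [measurable]: "\<alpha> \<in> borel_measurable multiset_space"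
  unfolding \<alpha>_def by measurable

lemma \<beta>_measurable [measurable]: "\<beta> \<in> borel_measurable multiset_space"
  unfolding \<beta>_def by measurable

lemma mecke_pi:
  "(\<lambda>(x, \<psi>). u x \<psi>) \<in> borel_measurable (borel \<Otimes>\<^sub>M multiset_space) \<Longrightarrow>
     (\<integral>\<^sup>+\<phi>. point_sum u \<phi> \<partial>\<pi>) = (\<integral>\<^sup>+x. (\<integral>\<^sup>+\<phi>. u x \<phi> \<partial>\<pi>) \<partial>M)"
  using M_pois by (intro meckeD) (auto simp: poisson_law_def)

text \<open>Size biasing: weighting a Poisson configuration with its number of points amounts to
  adding a point distributed according to \<open>M\<close>.\<close>

lemma nn_integral_size_mult:
  assumes [measurable]: "F \<in> borel_measurable multiset_space"
  shows "(\<integral>\<^sup>+e. of_nat (size e) * F e \<partial>\<pi>) = (\<integral>\<^sup>+x. (\<integral>\<^sup>+e. F (add_mset x e) \<partial>\<pi>) \<partial>M)"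
  unfolding point_sum_total[symmetric] by (rule mecke_pi) measurable

lemma abs_diff_H_le:
  "abs_diff (H s z) (H s z') \<le> (\<integral>\<^sup>+w. abs_diff (h (z + w)) (h (z' + w)) \<partial>pw s)"
  unfolding H_eq_pw by (rule abs_diff_nn_integral_le) measurable

lemma abs_diff_H_Suc_le:
  "abs_diff a (H (Suc s) z) \<le> (\<integral>\<^sup>+e. abs_diff a (H s (z + e)) \<partial>\<pi>)"
proof -
  have "abs_diff (\<integral>\<^sup>+e. a \<partial>\<pi>) (\<integral>\<^sup>+e. H s (z + e) \<partial>\<pi>) \<le> (\<integral>\<^sup>+e. abs_diff a (H s (z + e)) \<partial>\<pi>)"
    by (rule abs_diff_nn_integral_le) measurable
  then show ?thesis by (simp add: pi.emeasure_space_1)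
qed

text \<open>Size biasing puts an extra point \<open>x\<close> into the increment. The comparison
  with and without \<open>x\<close> gives the main term. The comparison of the increment without
  \<open>x\<close> and the mean over all increments does not involve \<open>x\<close>, so
  integrating over \<open>x\<close> yields a factor \<open>mass\<close> in front of the small
  quantity \<open>\<beta>\<close>.\<close>

lemma U_le:
  "U s z \<le> (\<integral>\<^sup>+w. \<alpha> (z + w) \<partial>pw (Suc s)) + 2 * mass * (\<integral>\<^sup>+w. \<beta> (z + w) \<partial>pw s)"
proof -
  interpret Mpi: pair_sigma_finite M \<pi> ..
  interpret pp: pair_sigma_finite \<pi> "pw s" ..
  interpret Mpw: pair_sigma_finite M "pw s" ..
  let ?d = "\<lambda>e. abs_diff (H s (z + e)) (H s z)"
  let ?B = "\<integral>\<^sup>+w. \<beta> (z + w) \<partial>pw s"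
  have d: "(\<integral>\<^sup>+e. ?d e \<partial>\<pi>) \<le> ?B"
  proof -
    have "(\<integral>\<^sup>+e. ?d e \<partial>\<pi>) \<le> (\<integral>\<^sup>+e. (\<integral>\<^sup>+w. abs_diff (h (z + w + e)) (h (z + w)) \<partial>pw s) \<partial>\<pi>)"
      using abs_diff_H_le[of s "z + _" z] by (intro nn_integral_mono) (simp add: ac_simps)
    also have "\<dots> = ?B"
      unfolding \<beta>_def by (rule pp.Fubini'[symmetric]) measurable
    finally show ?thesis .
  qed
  \<comment> \<open>The factor 2 arises from passing through \<open>H s z\<close>: once for the
    increment \<open>e\<close>, once for the average over increments.\<close>
  have osc: "(\<integral>\<^sup>+e. abs_diff (H s (z + e)) (H (Suc s) z) \<partial>\<pi>) \<le> 2 * ?B"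
  proof -
    have "(\<integral>\<^sup>+e. abs_diff (H s (z + e)) (H (Suc s) z) \<partial>\<pi>) \<le> (\<integral>\<^sup>+e. ?d e + abs_diff (H s z) (H (Suc s) z) \<partial>\<pi>)"
      by (intro nn_integral_mono abs_diff_triangle)
    also have "\<dots> = (\<integral>\<^sup>+e. ?d e \<partial>\<pi>) + abs_diff (H s z) (H (Suc s) z)"
      by (subst nn_integral_add) (auto simp: pi.emeasure_space_1 simp del: H.simps)
    also have "\<dots> \<le> ?B + ?B"
      using abs_diff_H_Suc_le[of "H s z" s z] d
      by (intro add_mono) (auto simp: abs_diff_commute simp del: H.simps)
    finally show ?thesis by (simp add: mult_2)
  qed
  have first: "(\<integral>\<^sup>+x. (\<integral>\<^sup>+e. abs_diff (H s (z + add_mset x e)) (H s (z + e)) \<partial>\<pi>) \<partial>M) \<le> (\<integral>\<^sup>+w. \<alpha> (z + w) \<partial>pw (Suc s))"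
  proof -
    let ?a = "\<lambda>x \<phi>. abs_diff (h (add_mset x \<phi>)) (h \<phi>)"
    have "(\<integral>\<^sup>+x. (\<integral>\<^sup>+e. abs_diff (H s (z + add_mset x e)) (H s (z + e)) \<partial>\<pi>) \<partial>M) \<le>
       (\<integral>\<^sup>+x. (\<integral>\<^sup>+e. (\<integral>\<^sup>+w. ?a x (z + (e + w)) \<partial>pw s) \<partial>\<pi>) \<partial>M)"
      using abs_diff_H_le[of s "z + add_mset _ _" "z + _"]
      by (intro nn_integral_mono) (simp add: ac_simps)
    also have "\<dots> = (\<integral>\<^sup>+e. (\<integral>\<^sup>+x. (\<integral>\<^sup>+w. ?a x (z + (e + w)) \<partial>pw s) \<partial>M) \<partial>\<pi>)"
      by (rule Mpi.Fubini'[symmetric]) measurable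
    also have "\<dots> = (\<integral>\<^sup>+e. (\<integral>\<^sup>+w. \<alpha> (z + (e + w)) \<partial>pw s) \<partial>\<pi>)"
      unfolding \<alpha>_def by (intro nn_integral_cong Mpw.Fubini'[symmetric]) measurable
    also have "\<dots> = (\<integral>\<^sup>+w. \<alpha> (z + w) \<partial>pw (Suc s))"
      by (rule nn_integral_pw_Suc[symmetric]) measurable
    finally show ?thesis .
  qed
  have "U s z = (\<integral>\<^sup>+x. (\<integral>\<^sup>+e. abs_diff (H s (z + add_mset x e)) (H (Suc s) z) \<partial>\<pi>) \<partial>M)"
    unfolding U_def by (rule nn_integral_size_mult) measurable
  also have "\<dots> \<le> (\<integral>\<^sup>+x. (\<integral>\<^sup>+e. abs_diff (H s (z + add_mset x e)) (H s (z + e)) +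
      abs_diff (H s (z + e)) (H (Suc s) z) \<partial>\<pi>) \<partial>M)"
    by (intro nn_integral_mono abs_diff_triangle)
  also have "\<dots> = (\<integral>\<^sup>+x. (\<integral>\<^sup>+e. abs_diff (H s (z + add_mset x e)) (H s (z + e)) \<partial>\<pi>) \<partial>M) +
      (\<integral>\<^sup>+e. abs_diff (H s (z + e)) (H (Suc s) z) \<partial>\<pi>) * mass"
    by (simp add: nn_integral_add emeasure_M_space del: H.simps)
  also have "\<dots> \<le> (\<integral>\<^sup>+w. \<alpha> (z + w) \<partial>pw (Suc s)) + 2 * ?B * mass"
    by (intro add_mono first mult_right_mono osc) simp
  finally show ?thesis by (simp add: mult_ac)
qed

text \<open>The increments averaged over so far and those still to come combine to the same
  convolution power, so each of the \<open>s\<close> steps contributes the same bound.\<close>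

lemma V_le:
  "V s z \<le> of_nat s * (\<integral>\<^sup>+w. \<alpha> (z + w) \<partial>pw s) + of_nat (2 * s) * mass * (\<integral>\<^sup>+w. \<beta> (z + w) \<partial>pw (s - 1))"
proof (induction s arbitrary: z)
  case (Suc s z)
  let ?A = "\<lambda>s z. \<integral>\<^sup>+w. \<alpha> (z + w) \<partial>pw s" and ?B = "\<lambda>s z. \<integral>\<^sup>+w. \<beta> (z + w) \<partial>pw s"
  have A: "(\<integral>\<^sup>+e. ?A s (z + e) \<partial>\<pi>) = ?A (Suc s) z"
    by (subst nn_integral_pw_Suc) (simp_all add: add.assoc)
  \<comment> \<open>For \<open>s = 0\<close> the truncated index \<open>s - 1\<close> has no
    meaning, but then the factor \<open>2 * s\<close> is zero.\<close>
  have B: "of_nat (2 * s) * mass * (\<integral>\<^sup>+e. ?B (s - 1) (z + e) \<partial>\<pi>) = of_nat (2 * s) * mass * ?B s z"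
  proof (cases s)
    case (Suc j)
    have "(\<integral>\<^sup>+e. ?B j (z + e) \<partial>\<pi>) = ?B (Suc j) z"
      by (subst nn_integral_pw_Suc) (simp_all add: add.assoc)
    then show ?thesis by (simp add: Suc del: pw.simps)
  qed simp
  have "V (Suc s) z \<le> (?A (Suc s) z + 2 * mass * ?B s z) +
     (\<integral>\<^sup>+e. of_nat s * ?A s (z + e) + of_nat (2 * s) * mass * ?B (s - 1) (z + e) \<partial>\<pi>)"
    unfolding V.simps by (intro add_mono U_le nn_integral_mono Suc.IH)
  also have "(\<integral>\<^sup>+e. of_nat s * ?A s (z + e) + of_nat (2 * s) * mass * ?B (s - 1) (z + e) \<partial>\<pi>) =
     of_nat s * (\<integral>\<^sup>+e. ?A s (z + e) \<partial>\<pi>) + of_nat (2 * s) * mass * (\<integral>\<^sup>+e. ?B (s - 1) (z + e) \<partial>\<pi>)"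
    by (simp add: nn_integral_add nn_integral_cmult)
  also have "(?A (Suc s) z + 2 * mass * ?B s z) + \<dots> =
     of_nat (Suc s) * ?A (Suc s) z + of_nat (2 * Suc s) * mass * ?B s z"
  proof -
    have "(a + 2 * m * b) + (t * a + 2 * t * m * b) = (1 + t) * a + 2 * (1 + t) * m * b"
      for a b m t :: ennreal by (simp only: mult_2 distrib_left distrib_right mult_1_left ac_simps)
    then show ?thesis
      unfolding A B by (simp only: of_nat_mult of_nat_Suc of_nat_numeral)
  qed
  finally show ?case by simp
qed simp

text \<open>\<open>\<beta>\<close> is itself of first order, which makes its contribution to
  \<open>U\<close> quadratic: the integrand vanishes for an empty increment, hence it may be
  multiplied by \<open>size e\<close>, and size biasing supplies an integral over
  \<open>M\<close>.\<close>

lemma \<beta>_integral_le: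
  assumes h1: "(\<integral>\<^sup>+\<phi>. h \<phi> \<partial>pw (Suc s)) = 1"
  shows "(\<integral>\<^sup>+w. \<beta> w \<partial>pw s) \<le> (\<integral>\<^sup>+w. \<alpha> w \<partial>pw (Suc s)) + mass + mass * ennreal (exp (measure M UNIV))"
proof -
  interpret Mpi: pair_sigma_finite M \<pi> ..
  interpret Mpw: pair_sigma_finite M "pw s" ..
  interpret Mpw': pair_sigma_finite M "pw (Suc s)" ..
  let ?c = "\<integral>\<^sup>+\<phi>. h \<phi> \<partial>pw s"
  \<comment> \<open>There is one increment fewer here than in \<open>h1\<close>. A further increment
    is empty with probability \<open>exp (- measure M UNIV)\<close>, so the mean of \<open>h\<close>
    over \<open>s\<close> increments is at most the reciprocal.\<close>
  have c: "?c \<le> ennreal (exp (measure M UNIV))"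
  proof -
    have "ennreal (exp (- measure M UNIV)) * ?c = (\<integral>\<^sup>+e. indicator {{#}} e * ?c \<partial>\<pi>)"
      using M_pois by (simp add: nn_integral_multc poisson_law_def)
    also have "\<dots> \<le> (\<integral>\<^sup>+e. (\<integral>\<^sup>+w. h (e + w) \<partial>pw s) \<partial>\<pi>)"
      by (intro nn_integral_mono) (auto simp: indicator_def)
    also have "\<dots> = 1"
      using h1 by (subst (asm) nn_integral_pw_Suc) auto
    finally have "ennreal (exp (measure M UNIV)) * (ennreal (exp (- measure M UNIV)) * ?c) \<le> ennreal (exp (measure M UNIV)) * 1"
      by (rule mult_left_mono) simp
    also have "ennreal (exp (measure M UNIV)) * (ennreal (exp (- measure M UNIV)) * ?c) = ?c"
      unfolding mult.assoc[symmetric] by (simp add: ennreal_mult[symmetric] mult_exp_exp)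
    finally show ?thesis by simp
  qed
  have size: "(\<integral>\<^sup>+e. of_nat (size e) \<partial>\<pi>) = mass"
    using nn_integral_size_mult[of "\<lambda>_. 1"] by (simp add: pi.emeasure_space_1 emeasure_M_space)
  have "(\<integral>\<^sup>+w. \<beta> w \<partial>pw s) \<le> (\<integral>\<^sup>+w. (\<integral>\<^sup>+e. of_nat (size e) * h (w + e) + of_nat (size e) * h w \<partial>\<pi>) \<partial>pw s)"
    unfolding \<beta>_def
  proof (intro nn_integral_mono)
    fix w e :: "'a multiset"
    show "abs_diff (h (w + e)) (h w) \<le> of_nat (size e) * h (w + e) + of_nat (size e) * h w"
    proof (cases "e = {#}")
      case False
      then have "(1::ennreal) \<le> of_nat (size e)"
        by (metis One_nat_def Suc_leI gr0I of_nat_1 of_nat_mono size_eq_0_iff_empty)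
      then have "1 * (h (w + e) + h w) \<le> of_nat (size e) * (h (w + e) + h w)"
        by (rule mult_right_mono) simp
      then show ?thesis
        using abs_diff_le_add[of "h (w + e)" "h w"] by (simp add: distrib_left)
    qed simp
  qed
  also have "\<dots> = (\<integral>\<^sup>+w. (\<integral>\<^sup>+e. of_nat (size e) * h (w + e) \<partial>\<pi>) \<partial>pw s) + mass * ?c"
    by (simp add: nn_integral_add nn_integral_multc nn_integral_cmult size)
  also have "(\<integral>\<^sup>+w. (\<integral>\<^sup>+e. of_nat (size e) * h (w + e) \<partial>\<pi>) \<partial>pw s) =
     (\<integral>\<^sup>+w. (\<integral>\<^sup>+x. (\<integral>\<^sup>+e. h (w + add_mset x e) \<partial>\<pi>) \<partial>M) \<partial>pw s)"
    by (intro nn_integral_cong nn_integral_size_mult) measurable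
  also have "\<dots> = (\<integral>\<^sup>+x. (\<integral>\<^sup>+w. (\<integral>\<^sup>+e. h (w + add_mset x e) \<partial>\<pi>) \<partial>pw s) \<partial>M)"
    by (rule Mpw.Fubini') measurable
  also have "\<dots> = (\<integral>\<^sup>+x. (\<integral>\<^sup>+w. h (add_mset x w) \<partial>pw (Suc s)) \<partial>M)"
  proof (rule nn_integral_cong)
    interpret pp: pair_sigma_finite \<pi> "pw s" ..
    fix x
    have "(\<integral>\<^sup>+w. (\<integral>\<^sup>+e. h (w + add_mset x e) \<partial>\<pi>) \<partial>pw s) = (\<integral>\<^sup>+e. (\<integral>\<^sup>+w. h (w + add_mset x e) \<partial>pw s) \<partial>\<pi>)"
      by (rule pp.Fubini') measurable
    then show "(\<integral>\<^sup>+w. (\<integral>\<^sup>+e. h (w + add_mset x e) \<partial>\<pi>) \<partial>pw s) = (\<integral>\<^sup>+w. h (add_mset x w) \<partial>pw (Suc s))"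
      by (subst nn_integral_pw_Suc) (simp_all add: ac_simps)
  qed
  \<comment> \<open>The added point is dropped again at the price of the one-point difference, that
    is, of \<open>\<alpha>\<close>.\<close>
  also have "\<dots> \<le> (\<integral>\<^sup>+x. (\<integral>\<^sup>+w. abs_diff (h (add_mset x w)) (h w) + h w \<partial>pw (Suc s)) \<partial>M)"
    by (intro nn_integral_mono le_abs_diff_add)
  also have "\<dots> = (\<integral>\<^sup>+x. (\<integral>\<^sup>+w. abs_diff (h (add_mset x w)) (h w) \<partial>pw (Suc s)) \<partial>M) + mass"
    by (simp add: nn_integral_add h1 emeasure_M_space del: pw.simps)
  also have "(\<integral>\<^sup>+x. (\<integral>\<^sup>+w. abs_diff (h (add_mset x w)) (h w) \<partial>pw (Suc s)) \<partial>M) = (\<integral>\<^sup>+w. \<alpha> w \<partial>pw (Suc s))"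
    unfolding \<alpha>_def by (rule Mpw'.Fubini'[symmetric]) measurable
  finally have "(\<integral>\<^sup>+w. \<beta> w \<partial>pw s) \<le> (\<integral>\<^sup>+w. \<alpha> w \<partial>pw (Suc s)) + mass + mass * ?c"
    by (simp add: add_right_mono)
  also have "\<dots> \<le> (\<integral>\<^sup>+w. \<alpha> w \<partial>pw (Suc s)) + mass + mass * ennreal (exp (measure M UNIV))"
    by (intro add_left_mono mult_left_mono c) simp
  finally show ?thesis .
qed

lemma V_final:
  assumes h1: "(\<integral>\<^sup>+\<phi>. h \<phi> \<partial>pw (Suc s)) = 1"
  shows "V (Suc s) {#} \<le> of_nat (Suc s) * (\<integral>\<^sup>+w. \<alpha> w \<partial>pw (Suc s)) +
    2 * (of_nat (Suc s) * mass) * ((\<integral>\<^sup>+w. \<alpha> w \<partial>pw (Suc s)) + mass + mass * ennreal (exp (measure M UNIV)))"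
proof -
  have "V (Suc s) {#} \<le> of_nat (Suc s) * (\<integral>\<^sup>+w. \<alpha> w \<partial>pw (Suc s)) +
    of_nat (2 * Suc s) * mass * (\<integral>\<^sup>+w. \<beta> w \<partial>pw s)"
    using V_le[of "Suc s" "{#}"] by (simp del: pw.simps V.simps of_nat_Suc mult_Suc_right)
  also have "of_nat (2 * Suc s) * mass = 2 * (of_nat (Suc s) * mass)"
    by (simp only: of_nat_mult of_nat_numeral mult.assoc)
  finally show ?thesis
    by (rule order_trans) (intro add_left_mono mult_left_mono \<beta>_integral_le[OF h1]; simp)
qed

end

lemma measure_eqI_nn_integral:
  assumes "sets A = sets B"
    and "\<And>F. F \<in> borel_measurable B \<Longrightarrow> (\<integral>\<^sup>+x. F x \<partial>A) = (\<integral>\<^sup>+x. F x \<partial>B)"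
  shows "A = B"
proof (rule measure_eqI)
  fix X assume "X \<in> sets A"
  then show "emeasure A X = emeasure B X"
    using assms(2)[of "indicator X"] assms(1) by simp
qed (rule assms(1))

text \<open>There are \<open>Suc s\<close> increments, each with intensity \<open>\<delta>\<close>
  times \<open>M\<close>. The main terms of the steps add up to at most \<open>D\<close>, the
  quadratic ones to \<open>K * \<delta>\<close>. The cost \<open>T\<close> enters only through three
  rules, so its measurability is never asked for.\<close>

lemma coupling_exists:
  fixes M :: "'a::topological_space measure" and T :: "'a multiset \<Rightarrow> 'a multiset \<Rightarrow> ennreal"
  assumes M: "finite_measure M" "sets M = sets borel" and \<pi>: "poisson_law M \<pi>"
    and h [measurable]: "h \<in> borel_measurable multiset_space" and h1: "(\<integral>\<^sup>+\<phi>. h \<phi> \<partial>\<pi>) = 1"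
    and D: "(\<integral>\<^sup>+x. (\<integral>\<^sup>+\<phi>. abs_diff (h (add_mset x \<phi>)) (h \<phi>) \<partial>\<pi>) \<partial>M) \<le> ennreal D" "0 \<le> D"
    and T: "T {#} {#} = 0" "\<And>e w w'. T (e + w) (e + w') \<le> T w w'"
    "\<And>e p w w'. T (e + w) (p + w') \<le> (of_nat (size e) + of_nat (size p)) + T w w'"
    and "0 < \<epsilon>"
  shows "\<exists>C. prob_space C \<and> sets C = sets (multiset_space \<Otimes>\<^sub>M multiset_space) \<and>
    distr C multiset_space fst = density \<pi> h \<and> distr C multiset_space snd = \<pi> \<and>
    (\<integral>\<^sup>+w. T (fst w) (snd w) \<partial>C) \<le> ennreal (D + \<epsilon>)"
proof -
  define r where "r = measure M UNIV"
  have space_M: "space M = UNIV" using sets_eq_imp_space_eq[OF M(2)] by simp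
  have r: "emeasure M UNIV = ennreal r" "0 \<le> r"
    by (simp_all add: r_def finite_measure.emeasure_eq_measure[OF M(1)])
  \<comment> \<open>\<open>K\<close> collects the second-order terms of \<open>V_final\<close>,
    summed over all steps and divided by \<open>\<delta>\<close>, with
    \<open>exp (\<delta> * r)\<close> bounded by \<open>exp r\<close>.\<close>
  define K where "K = 2 * r * (D + r + r * exp r)"
  have "0 \<le> K" unfolding K_def using r D by simp
  obtain s :: nat where s: "K / \<epsilon> \<le> real s" using real_arch_simple by blast
  define \<delta> where "\<delta> = 1 / real (Suc s)"
  have \<delta>: "0 \<le> \<delta>" "\<delta> \<le> 1" "real (Suc s) * \<delta> = 1" "K * \<delta> \<le> \<epsilon>"
  proof -
    have "K \<le> \<epsilon> * real (Suc s)"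
      using s \<open>0 < \<epsilon>\<close> by (simp add: divide_le_eq algebra_simps)
    then show "K * \<delta> \<le> \<epsilon>" by (simp add: \<delta>_def divide_le_eq)
  qed (auto simp: \<delta>_def)
  let ?M = "scale_measure (ennreal \<delta>) M"
  have fin: "finite_measure ?M"
    by (rule finite_measureI) (simp add: space_scale_measure space_M r ennreal_mult[symmetric] \<delta>)
  have sets: "sets ?M = sets borel" using M by simp
  obtain \<pi>' where \<pi>': "poisson_law ?M \<pi>'" using poisson_law_exists[OF fin sets] by blast
  interpret poisson_coupling \<pi>' h ?M
    by (intro poisson_coupling.intro coupling_scheme.intro poisson_coupling_axioms.intro)
       (use \<pi>' fin sets h in \<open>simp_all add: poisson_law_def\<close>)
  \<comment> \<open>Sums of increments stay Poisson, and after \<open>Suc s\<close> of them the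
    intensity is \<open>M\<close> itself; by uniqueness their total then has the law
    \<open>\<pi>\<close>.\<close>
  have mult: "poisson_law (scale_measure (ennreal (real j * \<delta>)) M) (pw j)" for j
  proof (induction j)
    case 0
    have "poisson_law (scale_measure 0 M) (return multiset_space {#})"
      by (rule poisson_law_zero) (use M in simp_all)
    then show ?case by simp
  next
    case (Suc j)
    have "poisson_law (scale_measure (ennreal (\<delta> + real j * \<delta>)) M) (pw (Suc j))"
      unfolding pw.simps by (rule poisson_law_conv[OF M _ _ \<pi>' Suc]) (use \<delta> in auto)
    then show ?case by (simp add: algebra_simps)
  qed
  have pw_eq: "pw (Suc s) = \<pi>"
    using mult[of "Suc s"] poisson_law_unique[OF \<pi> _ M(2), of "pw (Suc s)"] \<delta>(3) by (simp del: pw.simps of_nat_Suc)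
  interpret \<pi>: prob_space \<pi> using \<pi> by (simp add: poisson_law_def)
  have sets_\<pi> [simp, measurable_cong]: "sets \<pi> = sets multiset_space" using \<pi> by (simp add: poisson_law_def)
  interpret M': finite_measure M by fact
  note [measurable_cong] = M(2)
  interpret Mpi: pair_sigma_finite M \<pi> ..
  have mass: "mass = ennreal (\<delta> * r)"
    by (simp add: mass_def r ennreal_mult \<delta>)
  \<comment> \<open>As the initial weight is 1, the factor \<open>H\<close> disappears from
    \<open>G_fst\<close> and \<open>cost_le_V\<close>.\<close>
  have H1: "H (Suc s) {#} = 1"
    unfolding H_eq_pw pw_eq by (simp add: h1)
  have \<alpha>: "(\<integral>\<^sup>+w. \<alpha> w \<partial>\<pi>) \<le> ennreal (\<delta> * D)"
  proof -
    have "(\<integral>\<^sup>+w. \<alpha> w \<partial>\<pi>) = ennreal \<delta> * (\<integral>\<^sup>+w. (\<integral>\<^sup>+x. abs_diff (h (add_mset x w)) (h w) \<partial>M) \<partial>\<pi>)"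
      unfolding \<alpha>_def by (subst nn_integral_scale_measure) (auto simp: nn_integral_cmult)
    also have "(\<integral>\<^sup>+w. (\<integral>\<^sup>+x. abs_diff (h (add_mset x w)) (h w) \<partial>M) \<partial>\<pi>) =
      (\<integral>\<^sup>+x. (\<integral>\<^sup>+\<phi>. abs_diff (h (add_mset x \<phi>)) (h \<phi>) \<partial>\<pi>) \<partial>M)"
      by (rule Mpi.Fubini') measurable
    finally show ?thesis
      using D \<delta> by (simp add: ennreal_mult mult_left_mono)
  qed
  have V: "V (Suc s) {#} \<le> ennreal (D + \<epsilon>)"
  proof -
    let ?S = "of_nat (Suc s) :: ennreal"
    have "exp (\<delta> * r) \<le> exp r" using \<delta> r by (simp add: mult_left_le_one_le)
    have "V (Suc s) {#} \<le> ?S * (\<integral>\<^sup>+w. \<alpha> w \<partial>\<pi>) +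
      2 * (?S * mass) * ((\<integral>\<^sup>+w. \<alpha> w \<partial>\<pi>) + mass + mass * ennreal (exp (measure ?M UNIV)))"
      using V_final[of s] h1 unfolding pw_eq by simp
    also have "measure ?M UNIV = \<delta> * r" using \<delta> by (simp add: r_def)
    also have "?S * (\<integral>\<^sup>+w. \<alpha> w \<partial>\<pi>) + 2 * (?S * mass) * ((\<integral>\<^sup>+w. \<alpha> w \<partial>\<pi>) + mass + mass * ennreal (exp (\<delta> * r))) \<le>
      ?S * ennreal (\<delta> * D) + 2 * (?S * ennreal (\<delta> * r)) * (ennreal (\<delta> * D) + ennreal (\<delta> * r) + ennreal (\<delta> * r) * ennreal (exp r))"
      unfolding mass using \<open>exp (\<delta> * r) \<le> exp r\<close>
      by (intro add_mono mult_left_mono \<alpha> order_refl) (auto intro: ennreal_leI)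
    also have "\<dots> = ennreal (real (Suc s) * (\<delta> * D) + 2 * (real (Suc s) * (\<delta> * r)) * (\<delta> * D + \<delta> * r + \<delta> * r * exp r))"
    proof -
      have S: "?S = ennreal (real (Suc s))" by (simp only: ennreal_of_nat_eq_real_of_nat)
      have 2: "(2::ennreal) = ennreal 2" by simp
      show ?thesis
        unfolding S 2 using \<delta>(1) r D
        by (simp add: ennreal_mult[symmetric] ennreal_plus[symmetric] del: ennreal_plus of_nat_Suc ennreal_numeral)
    qed
    also have "real (Suc s) * (\<delta> * D) + 2 * (real (Suc s) * (\<delta> * r)) * (\<delta> * D + \<delta> * r + \<delta> * r * exp r) =
      (real (Suc s) * \<delta>) * D + (real (Suc s) * \<delta>) * (K * \<delta>)"
      by (simp add: K_def algebra_simps del: of_nat_Suc)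
    also have "\<dots> = D + K * \<delta>" unfolding \<delta>(3) by simp
    also have "ennreal \<dots> \<le> ennreal (D + \<epsilon>)" using \<delta>(4) by (intro ennreal_leI) simp
    finally show ?thesis .
  qed
  let ?C = "G (Suc s) {#}"
  have "(\<integral>\<^sup>+w. T (fst w) (snd w) \<partial>?C) \<le> cost (Suc s) {#}"
    by (rule G_le_cost[OF T])
  also have "\<dots> \<le> V (Suc s) {#}"
    using cost_le_V[of "Suc s" "{#}"] H1 by simp
  finally have "(\<integral>\<^sup>+w. T (fst w) (snd w) \<partial>?C) \<le> ennreal (D + \<epsilon>)"
    using V by simp
  moreover have "distr ?C multiset_space fst = density \<pi> h"
  proof (rule measure_eqI_nn_integral)
    fix F :: "'a multiset \<Rightarrow> ennreal" assume "F \<in> borel_measurable (density \<pi> h)"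
    then have [measurable]: "F \<in> borel_measurable multiset_space" by simp
    have "(\<integral>\<^sup>+x. F x \<partial>distr ?C multiset_space fst) = (\<integral>\<^sup>+w. F (fst w) \<partial>?C)"
      by (subst nn_integral_distr) auto
    also have "\<dots> = (\<integral>\<^sup>+w. F w * h w \<partial>\<pi>)"
      using G_fst[of F "Suc s" "{#}"] H1 by (simp add: pw_eq del: pw.simps H.simps G.simps)
    also have "\<dots> = (\<integral>\<^sup>+x. F x \<partial>density \<pi> h)"
      by (subst nn_integral_density) (auto simp: mult.commute)
    finally show "(\<integral>\<^sup>+x. F x \<partial>distr ?C multiset_space fst) = (\<integral>\<^sup>+x. F x \<partial>density \<pi> h)" .
  qed simp
  moreover have "distr ?C multiset_space snd = \<pi>"
  proof (rule measure_eqI_nn_integral)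
    fix F :: "'a multiset \<Rightarrow> ennreal" assume "F \<in> borel_measurable \<pi>"
    then have [measurable]: "F \<in> borel_measurable multiset_space" by simp
    have "(\<integral>\<^sup>+x. F x \<partial>distr ?C multiset_space snd) = (\<integral>\<^sup>+w. F (snd w) \<partial>?C)"
      by (subst nn_integral_distr) auto
    also have "\<dots> = (\<integral>\<^sup>+w. F w \<partial>\<pi>)"
      using G_snd[of F "Suc s" "{#}"] by (simp add: pw_eq del: pw.simps G.simps)
    finally show "(\<integral>\<^sup>+x. F x \<partial>distr ?C multiset_space snd) = (\<integral>\<^sup>+x. F x \<partial>\<pi>)" .
  qed simp
  ultimately show ?thesis
    using prob_space_G[of "Suc s" "{#}"] sets_G[of "Suc s" "{#}"] by blast
qed

section \<open>Configurations and multisets\<close>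

lemma space_config_space [simp]: "space config_space = configs"
  unfolding config_space_def by (rule space_measure_of) auto

lemma sets_config_space: "sets config_space = sigma_sets configs
     {(\<lambda>\<phi>. emeasure \<phi> A) -` B \<inter> configs | A B. A \<in> rel_compact_borel \<and> B \<in> sets borel}"
  unfolding config_space_def by (rule sets_measure_of) auto

lemma measurable_config_eval [measurable (raw)]:
  assumes "A \<in> rel_compact_borel"
  shows "(\<lambda>\<phi>. emeasure \<phi> A) \<in> borel_measurable config_space"
proof (rule measurableI)
  fix B :: "ennreal set" assume "B \<in> sets borel"
  with assms have "(\<lambda>\<phi>. emeasure \<phi> A) -` B \<inter> configs \<in>
    {(\<lambda>\<phi>. emeasure \<phi> A) -` B \<inter> configs | A B. A \<in> rel_compact_borel \<and> B \<in> sets borel}"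
    by blast
  then show "(\<lambda>\<phi>. emeasure \<phi> A) -` B \<inter> space config_space \<in> sets config_space"
    by (simp add: sets_config_space sigma_sets.Basic)
qed simp

lemma measurable_config_spaceI:
  assumes "\<And>\<omega>. \<omega> \<in> space N \<Longrightarrow> T \<omega> \<in> configs"
    and "\<And>A. A \<in> rel_compact_borel \<Longrightarrow> (\<lambda>\<omega>. emeasure (T \<omega>) A) \<in> borel_measurable N"
  shows "T \<in> N \<rightarrow>\<^sub>M config_space"
  unfolding config_space_def
proof (rule measurable_measure_of)
  fix X :: "'b measure set"
  assume "X \<in> {(\<lambda>\<phi>. emeasure \<phi> A) -` B \<inter> configs | A B. A \<in> rel_compact_borel \<and> B \<in> sets borel}"
  then obtain A and B :: "ennreal set" where X: "X = (\<lambda>\<phi>. emeasure \<phi> A) -` B \<inter> configs"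
    "A \<in> rel_compact_borel" "B \<in> sets borel" by blast
  have "T -` X \<inter> space N = (\<lambda>\<omega>. emeasure (T \<omega>) A) -` B \<inter> space N"
    using assms(1) by (auto simp: X)
  then show "T -` X \<inter> space N \<in> sets N"
    using measurable_sets[OF assms(2)[OF X(2)] X(3)] by simp
qed (use assms(1) in auto)

text \<open>The copies of \<open>\<Phi>\<close> and the process \<open>\<zeta>\<close> are given only in law; on a non-separable space they
  may charge the complement of \<open>\<Lambda>\<close> although they almost surely vanish on every relatively compact
  set outside \<open>\<Lambda>\<close>. Their laws do not see this.\<close>

lemma distr_config_eqI:
  assumes \<xi>: "\<xi> \<in> P \<rightarrow>\<^sub>M config_space" and \<eta>: "\<eta> \<in> P \<rightarrow>\<^sub>M config_space"
    and eq: "\<And>A. A \<in> rel_compact_borel \<Longrightarrow> AE \<omega> in P. emeasure (\<xi> \<omega>) A = emeasure (\<eta> \<omega>) A"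
  shows "distr P config_space \<xi> = distr P config_space \<eta>"
proof (rule measure_eqI)
  fix B assume "B \<in> sets (distr P config_space \<xi>)"
  then have B: "B \<in> sets config_space" by simp
  \<comment> \<open>Complements are relative to \<open>configs\<close>, so membership there has to
    be known for both values.\<close>
  have AE_cong: "AE \<omega> in P. \<xi> \<omega> \<in> configs \<and> \<eta> \<omega> \<in> configs"
    using measurable_space[OF \<xi>] measurable_space[OF \<eta>] by auto
  have "AE \<omega> in P. \<xi> \<omega> \<in> B \<longleftrightarrow> \<eta> \<omega> \<in> B"
    using B unfolding sets_config_space
  proof induction
    case (Basic a)
    then obtain A and C :: "ennreal set" where a: "a = (\<lambda>\<phi>. emeasure \<phi> A) -` C \<inter> configs" "A \<in> rel_compact_borel"
      by blast
    show ?case using eq[OF a(2)] AE_cong by eventually_elim (simp add: a)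
  next
    case (Compl a)
    then have "AE \<omega> in P. \<xi> \<omega> \<in> a \<longleftrightarrow> \<eta> \<omega> \<in> a" by simp
    then show ?case using AE_cong by eventually_elim auto
  next
    case (Union a)
    then have "AE \<omega> in P. \<forall>i. \<xi> \<omega> \<in> a i \<longleftrightarrow> \<eta> \<omega> \<in> a i" by (simp add: AE_all_countable)
    then show ?case by eventually_elim auto
  qed auto
  then have "emeasure P (\<xi> -` B \<inter> space P) = emeasure P (\<eta> -` B \<inter> space P)"
    using measurable_sets[OF \<xi> B] measurable_sets[OF \<eta> B]
    by (intro emeasure_eq_AE) auto
  then show "emeasure (distr P config_space \<xi>) B = emeasure (distr P config_space \<eta>) B"
    using \<xi> \<eta> B by (simp add: emeasure_distr)
qed simp

lemma compact_rel_compact_borel: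
  fixes L :: "'a::metric_space set"
  assumes "compact L" "A \<in> sets borel" "A \<subseteq> L"
  shows "A \<in> rel_compact_borel"
proof -
  have "closure A \<subseteq> L" using assms by (intro closure_minimal compact_imp_closed)
  then have "compact (L \<inter> closure A)" "L \<inter> closure A = closure A"
    using assms by (auto intro: compact_Int_closed)
  then show ?thesis using assms by (simp add: rel_compact_borel_def)
qed

lemma rel_compact_borel_Int:
  "A \<in> rel_compact_borel \<Longrightarrow> B \<in> sets borel \<Longrightarrow> A \<inter> B \<in> rel_compact_borel"
  by (rule compact_rel_compact_borel[of "closure A"])
     (use closure_subset[of A] in \<open>auto simp: rel_compact_borel_def\<close>)

section \<open>Finite multisets as configurations\<close>

lemma sum_mset_sum_count:
  "(\<Sum>x\<in>#\<psi>. g x) = (\<Sum>x\<in>set_mset \<psi>. of_nat (count \<psi> x) * (g x :: ennreal))"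
proof (induction \<psi>)
  case (add y \<psi>)
  let ?s = "\<lambda>\<psi> A. \<Sum>x\<in>A. of_nat (count \<psi> x) * g x"
  have "?s (add_mset y \<psi>) (insert y (set_mset \<psi>)) =
      (\<Sum>x\<in>insert y (set_mset \<psi>). of_nat (count \<psi> x) * g x + (if x = y then g y else 0))"
    by (intro sum.cong refl) (auto simp: distrib_right add.commute)
  also have "\<dots> = ?s \<psi> (insert y (set_mset \<psi>)) + g y"
    by (simp add: sum.distrib)
  also have "?s \<psi> (insert y (set_mset \<psi>)) = ?s \<psi> (set_mset \<psi>)"
    by (rule sum.mono_neutral_right) (auto simp: not_in_iff)
  finally show ?case using add by (simp add: add.commute)
qed simp

definition conf :: "'a::metric_space multiset \<Rightarrow> 'a measure" where
  "conf \<psi> = measure_of UNIV (sets borel) (\<lambda>A. of_nat (npoints A \<psi>))"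

lemma npoints_sum_mset: "(of_nat (npoints A \<psi>) :: ennreal) = (\<Sum>x\<in>#\<psi>. indicator A x)"
  by (induction \<psi>) auto

lemma sets_conf [simp, measurable_cong]: "sets (conf \<psi>) = sets borel"
  unfolding conf_def using sets.sigma_sets_eq[of borel] by (simp add: sets_measure_of_conv)

lemma emeasure_conf: "A \<in> sets borel \<Longrightarrow> emeasure (conf \<psi>) A = of_nat (npoints A \<psi>)"
proof (rule emeasure_measure_of[OF conf_def])
  show "countably_additive (sets (conf \<psi>)) (\<lambda>A. of_nat (npoints A \<psi>))"
  proof (rule countably_additiveI)
    fix A :: "nat \<Rightarrow> 'a set" assume "disjoint_family A"
    then show "(\<Sum>i. of_nat (npoints (A i) \<psi>)) = (of_nat (npoints (\<Union>(range A)) \<psi>) :: ennreal)"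
      unfolding npoints_sum_mset by (simp add: sum_mset_suminf[symmetric] suminf_indicator)
  qed
  show "positive (sets (conf \<psi>)) (\<lambda>A. of_nat (npoints A \<psi>))"
    by (simp add: positive_def npoints_def)
qed auto

lemma measure_conf: "A \<in> sets borel \<Longrightarrow> measure (conf \<psi>) A = real (npoints A \<psi>)"
  by (simp add: measure_def emeasure_conf)

lemma conf_in_configs [simp]: "conf \<psi> \<in> configs"
  by (auto simp: configs_def emeasure_conf rel_compact_borel_def of_nat_less_top)

lemma measurable_conf [measurable]: "conf \<in> multiset_space \<rightarrow>\<^sub>M config_space"
proof (rule measurable_config_spaceI)
  fix A :: "'a set" assume "A \<in> rel_compact_borel"
  then have [measurable]: "A \<in> sets borel" by (simp add: rel_compact_borel_def)
  show "(\<lambda>\<psi>. emeasure (conf \<psi>) A) \<in> borel_measurable multiset_space"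
    by (simp add: emeasure_conf measurable_compose[OF measurable_npoints])
qed simp

text \<open>\<open>g\<close> is arbitrary: \<open>conf \<psi>\<close> is carried by finitely many
  closed points, so only the values there count. This evaluates the left side of the defining
  equation of the Papangelou intensity without any measurability of
  \<open>remove_point\<close>.\<close>

lemma nn_integral_conf: "(\<integral>\<^sup>+x. g x \<partial>conf \<psi>) = (\<Sum>x\<in>#\<psi>. g x)"
proof -
  have F: "set_mset \<psi> \<in> sets borel"
    by (intro borel_closed finite_imp_closed) simp
  have "npoints (- set_mset \<psi>) \<psi> = 0"
    by (auto simp: npoints_def)
  then have "emeasure (conf \<psi>) (- set_mset \<psi>) = 0"
    using F by (simp add: emeasure_conf)
  then have "AE x in conf \<psi>. x \<in> set_mset \<psi>"
    using F by (intro AE_I[of _ _ "- set_mset \<psi>"]) auto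
  then have "(\<integral>\<^sup>+x. g x \<partial>conf \<psi>) = (\<integral>\<^sup>+x. (\<Sum>y\<in>set_mset \<psi>. g y * indicator {y} x) \<partial>conf \<psi>)"
    by (intro nn_integral_cong_AE) (auto simp: indicator_def sum.If_cases if_distrib cong: if_cong)
  also have "\<dots> = (\<Sum>y\<in>set_mset \<psi>. g y * of_nat (count \<psi> y))"
  proof -
    have "npoints {y} \<psi> = count \<psi> y" for y
      using count_image_mset_eq_npoints[of "\<lambda>x. x" \<psi> y] by (simp add: vimage_def)
    then show ?thesis
      by (subst nn_integral_sum) (auto simp: nn_integral_cmult emeasure_conf)
  qed
  also have "\<dots> = (\<Sum>x\<in>#\<psi>. g x)"
    by (simp add: sum_mset_sum_count mult.commute)
  finally show ?thesis .
qed

lemma conf_remove_point: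
  assumes "x \<in># \<psi>"
  shows "remove_point (conf \<psi>) x = conf (\<psi> - {#x#})"
proof -
  obtain \<xi> where \<psi>: "\<psi> = add_mset x \<xi>" using assms by (metis insert_DiffM)
  show ?thesis
    unfolding remove_point_def conf_def[of "\<psi> - {#x#}"]
  proof (rule measure_of_eq)
    fix A :: "'a set" assume "A \<in> sigma_sets UNIV (sets borel)"
    then have "A \<in> sets borel" using sets.sigma_sets_eq[of "borel :: 'a measure"] by simp
    then show "emeasure (conf \<psi>) A - indicator A x = of_nat (npoints A (\<psi> - {#x#}))"
      by (simp add: emeasure_conf \<psi>)
  qed auto
qed

lemma TV_dist_conf:
  "TV_dist (conf w) (conf w') = (SUP A\<in>sets borel. ennreal \<bar>real (npoints A w) - real (npoints A w')\<bar>)"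
proof -
  have "{A \<in> sets borel. emeasure (conf w) A < \<infinity> \<and> emeasure (conf w') A < \<infinity>} = sets borel"
    by (auto simp: emeasure_conf of_nat_less_top)
  then show ?thesis
    unfolding TV_dist_def by (simp add: measure_conf cong: SUP_cong)
qed

text \<open>The rules for the cost that \<open>coupling_exists\<close> asks for: common points
  cancel in every count, and other points change a count by at most their number.\<close>

lemma TV_dist_conf_props:
  fixes e p w w' :: "'a::metric_space multiset"
  shows "TV_dist (conf ({#} :: 'a multiset)) (conf {#}) = 0"
  and "TV_dist (conf (e + w)) (conf (e + w')) \<le> TV_dist (conf w) (conf w')"
  and "TV_dist (conf (e + w)) (conf (p + w')) \<le> (of_nat (size e) + of_nat (size p)) + TV_dist (conf w) (conf w')"
proof -
  show "TV_dist (conf ({#} :: 'a multiset)) (conf {#}) = 0"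
    by (simp add: TV_dist_conf SUP_constant bot_ennreal)
  show "TV_dist (conf (e + w)) (conf (e + w')) \<le> TV_dist (conf w) (conf w')"
    by (simp add: TV_dist_conf)
  show "TV_dist (conf (e + w)) (conf (p + w')) \<le> (of_nat (size e) + of_nat (size p)) + TV_dist (conf w) (conf w')"
    unfolding TV_dist_conf[of "e + w"]
  proof (rule SUP_least)
    fix A :: "'a set" assume "A \<in> sets borel"
    then have "ennreal \<bar>real (npoints A w) - real (npoints A w')\<bar> \<le> TV_dist (conf w) (conf w')"
      unfolding TV_dist_conf by (rule SUP_upper)
    moreover have "\<bar>real (npoints A (e + w)) - real (npoints A (p + w'))\<bar> \<le>
      (real (size e) + real (size p)) + \<bar>real (npoints A w) - real (npoints A w')\<bar>"
      using npoints_le_size[of A e] npoints_le_size[of A p] by simp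
    then have "ennreal \<bar>real (npoints A (e + w)) - real (npoints A (p + w'))\<bar> \<le>
      ennreal ((real (size e) + real (size p)) + \<bar>real (npoints A w) - real (npoints A w')\<bar>)"
      by (rule ennreal_leI)
    then have "ennreal \<bar>real (npoints A (e + w)) - real (npoints A (p + w'))\<bar> \<le>
      (of_nat (size e) + of_nat (size p)) + ennreal \<bar>real (npoints A w) - real (npoints A w')\<bar>"
      by (simp add: ennreal_of_nat_eq_real_of_nat)
    ultimately show "ennreal \<bar>real (npoints A (e + w)) - real (npoints A (p + w'))\<bar> \<le>
      (of_nat (size e) + of_nat (size p)) + TV_dist (conf w) (conf w')"
      by (meson add_left_mono order_trans)
  qed
qed

text \<open>A labelling has finitely many cells, so the event that the label multiset equals
  \<open>\<xi>\<close> is a finite intersection of events about counts.\<close>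

lemma measurable_multiset_npointsI:
  fixes T :: "'w \<Rightarrow> 'a::topological_space multiset"
  assumes "\<And>A. A \<in> sets borel \<Longrightarrow> (\<lambda>\<omega>. npoints A (T \<omega>)) \<in> N \<rightarrow>\<^sub>M count_space UNIV"
  shows "T \<in> N \<rightarrow>\<^sub>M multiset_space"
proof (rule measurable_multiset_spaceI)
  fix f :: "'a \<Rightarrow> nat" assume f: "labelling f"
  show "(\<lambda>\<omega>. image_mset f (T \<omega>)) \<in> N \<rightarrow>\<^sub>M count_space UNIV"
  proof (subst measurable_count_space_eq2_countable, intro conjI ballI)
    fix \<xi> :: "nat multiset"
    let ?J = "range f \<union> set_mset \<xi>"
    have J: "finite ?J" using f by (simp add: labelling_def)
    have "image_mset f \<psi> = \<xi> \<longleftrightarrow> (\<forall>j\<in>?J. npoints (f -` {j}) \<psi> = count \<xi> j)" for \<psi>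
      by (rule image_mset_eq_iff_npoints) simp
    then have "(\<lambda>\<omega>. image_mset f (T \<omega>)) -` {\<xi>} \<inter> space N =
      {\<omega> \<in> space N. \<forall>j\<in>?J. npoints (f -` {j}) (T \<omega>) = count \<xi> j}"
      by auto
    also have "\<dots> \<in> sets N"
    proof (rule sets.sets_Collect_finite_All[OF _ J])
      fix j
      have "f -` {j} \<in> sets borel"
        using measurable_sets[of f borel "count_space UNIV" "{j}"] f by (simp add: labelling_def)
      from measurable_sets[OF assms[OF this], of "{count \<xi> j}"]
      show "{\<omega> \<in> space N. npoints (f -` {j}) (T \<omega>) = count \<xi> j} \<in> sets N"
        by (simp add: vimage_def Int_def conj_commute)
    qed
    finally show "(\<lambda>\<omega>. image_mset f (T \<omega>)) -` {\<xi>} \<inter> space N \<in> sets N" .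
  qed auto
qed

text \<open>Only the atoms in \<open>L\<close> are read; for compact \<open>L\<close> and a
  configuration they are finitely many and carry the whole mass on \<open>L\<close>.\<close>

definition points_in :: "'a set \<Rightarrow> 'a::metric_space measure \<Rightarrow> 'a multiset" where
  "points_in L \<phi> = Abs_multiset (\<lambda>x. if x \<in> L then nat \<lfloor>measure \<phi> {x}\<rfloor> else 0)"

lemma configs_nat:
  assumes "\<phi> \<in> configs" "A \<in> rel_compact_borel"
  obtains k :: nat where "emeasure \<phi> A = of_nat k"
  using assms by (force simp: configs_def rel_compact_borel_def)

lemma singleton_rel_compact [simp]: "{x} \<in> rel_compact_borel"
  by (simp add: rel_compact_borel_def)

context
  fixes L :: "'a::metric_space set" and \<phi> :: "'a measure"
  assumes L: "compact L" and \<phi>: "\<phi> \<in> configs"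
begin

lemma sets_phi: "sets \<phi> = sets borel" using \<phi> by (simp add: configs_def)

lemma L_borel: "L \<in> sets borel" using L by (simp add: borel_closed compact_imp_closed)

text \<open>Each atom has an integer mass of at least 1, and together they cannot exceed the finite
  mass of \<open>L\<close>.\<close>

lemma finite_atoms: "finite {x \<in> L. emeasure \<phi> {x} \<noteq> 0}"
proof -
  obtain K :: nat where K: "emeasure \<phi> L = of_nat K"
    using configs_nat[OF \<phi>] compact_rel_compact_borel[OF L L_borel] by blast
  show ?thesis
  proof (rule finite_if_finite_subsets_card_bdd[of _ K, THEN conjunct1])
    show "card G \<le> K" if G: "G \<subseteq> {x \<in> L. emeasure \<phi> {x} \<noteq> 0}" "finite G" for G
    proof -
      have "1 \<le> emeasure \<phi> {x}" if "x \<in> G" for x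
      proof -
        obtain k :: nat where "emeasure \<phi> {x} = of_nat k" using configs_nat[OF \<phi>] singleton_rel_compact by blast
        moreover then have "k \<noteq> 0" using that G by auto
        ultimately show ?thesis by (metis One_nat_def Suc_leI gr0I of_nat_1 of_nat_mono)
      qed
      then have "of_nat (card G) \<le> (\<Sum>x\<in>G. emeasure \<phi> {x})"
        using sum_mono[of G "\<lambda>_. 1 :: ennreal" "\<lambda>x. emeasure \<phi> {x}"] by simp
      also have "\<dots> = emeasure \<phi> G"
        by (rule emeasure_eq_sum_singleton[symmetric]) (use G sets_phi in auto)
      also have "\<dots> \<le> emeasure \<phi> L"
        using G L_borel by (intro emeasure_mono) (auto simp: sets_phi)
      finally show "card G \<le> K" by (simp add: K)
    qed
  qed
qed

text \<open>An integer-valued measure has no diffuse part on a compact set. Around each point of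
  \<open>L\<close> the balls, with the atoms removed, shrink to a null set; being integers, their
  masses are zero from some radius on, and finitely many such balls cover \<open>L\<close>.
  Compactness does the work of separability.\<close>

lemma emeasure_non_atoms: "emeasure \<phi> (L - {x. emeasure \<phi> {x} \<noteq> 0}) = 0"
proof -
  let ?F = "{x \<in> L. emeasure \<phi> {x} \<noteq> 0}"
  define N where "N = L - ?F"
  have F: "?F \<in> sets borel" using finite_atoms by (intro borel_closed finite_imp_closed)
  have N: "N \<in> sets borel" unfolding N_def using F L_borel by (rule sets.Diff[rotated])
  have sub: "A \<inter> N \<in> rel_compact_borel" if "A \<in> sets borel" for A
    using that N by (intro compact_rel_compact_borel[OF L]) (auto simp: N_def)
  have "\<exists>r>0. emeasure \<phi> (ball x r \<inter> N) = 0" if "x \<in> L" for x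
  proof -
    let ?A = "\<lambda>i::nat. ball x (1 / real (Suc i)) \<inter> N"
    have "(\<lambda>i. emeasure \<phi> (?A i)) \<longlonglongrightarrow> emeasure \<phi> (\<Inter>i. ?A i)"
    proof (rule Lim_emeasure_decseq)
      show "range ?A \<subseteq> sets \<phi>" using N by (auto simp: sets_phi)
      show "decseq ?A"
      proof (rule decseq_SucI)
        fix i
        have "ball x (1 / real (Suc (Suc i))) \<subseteq> ball x (1 / real (Suc i))"
          by (rule subset_ball) (simp add: frac_le)
        then show "?A (Suc i) \<subseteq> ?A i" by blast
      qed
      fix i
      obtain k :: nat where "emeasure \<phi> (?A i) = of_nat k"
        using configs_nat[OF \<phi> sub[of "ball x (1 / real (Suc i))"]] by auto
      then show "emeasure \<phi> (?A i) \<noteq> \<infinity>" by simp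
    qed
    moreover have "emeasure \<phi> (\<Inter>i. ?A i) = 0"
    proof -
      have "(\<Inter>i. ?A i) \<subseteq> {x} \<inter> N"
      proof
        fix y assume y: "y \<in> (\<Inter>i. ?A i)"
        then have "dist x y < 1 / real (Suc i)" for i by auto
        then have "\<not> inverse (real (Suc i)) < dist x y" for i
          by (metis inverse_eq_divide not_less_iff_gr_or_eq)
        then have "dist x y \<le> 0"
          using reals_Archimedean[of "dist x y"] by (meson not_le)
        then show "y \<in> {x} \<inter> N" using y by auto
      qed
      then have "emeasure \<phi> (\<Inter>i. ?A i) \<le> emeasure \<phi> ({x} \<inter> N)"
        using N by (intro emeasure_mono) (auto simp: sets_phi)
      \<comment> \<open>Either \<open>x\<close> is an atom and was removed, or it has mass
        zero.\<close>
      also have "\<dots> = 0"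
        using that by (cases "emeasure \<phi> {x} = 0") (auto simp: N_def)
      finally show ?thesis by simp
    qed
    ultimately have "(\<lambda>i. emeasure \<phi> (?A i)) \<longlonglongrightarrow> 0" by simp
    then have "eventually (\<lambda>i. emeasure \<phi> (?A i) < 1) sequentially"
      by (rule order_tendstoD) simp
    then obtain i where i: "emeasure \<phi> (?A i) < 1"
      by (auto simp: eventually_sequentially)
    obtain k :: nat where "emeasure \<phi> (?A i) = of_nat k"
      using configs_nat[OF \<phi> sub[of "ball x (1 / real (Suc i))"]] by auto
    with i have "emeasure \<phi> (?A i) = 0" by simp
    then show ?thesis by (intro exI[of _ "1 / real (Suc i)"]) simp
  qed
  then obtain r where r: "\<And>x. x \<in> L \<Longrightarrow> 0 < r x" "\<And>x. x \<in> L \<Longrightarrow> emeasure \<phi> (ball x (r x) \<inter> N) = 0"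
    by metis
  have "L \<subseteq> (\<Union>x\<in>L. ball x (r x))" using r(1) by auto
  then obtain C where C: "C \<subseteq> L" "finite C" "L \<subseteq> (\<Union>x\<in>C. ball x (r x))"
    using compactE_image[OF L, of L "\<lambda>x. ball x (r x)"] by auto
  have "(\<Union>x\<in>C. ball x (r x) \<inter> N) \<in> null_sets \<phi>"
    using C r(2) N by (intro null_sets.finite_UN) (auto simp: null_sets_def sets_phi)
  then have "emeasure \<phi> N = 0"
    using C(3) by (intro emeasure_eq_0[of _ \<phi> N]) (auto simp: null_sets_def N_def)
  also have "N = L - {x. emeasure \<phi> {x} \<noteq> 0}" by (auto simp: N_def)
  finally show ?thesis .
qed

lemma count_points_in: "count (points_in L \<phi>) x = (if x \<in> L then nat \<lfloor>measure \<phi> {x}\<rfloor> else 0)"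
proof -
  have "finite {x. 0 < (if x \<in> L then nat \<lfloor>measure \<phi> {x}\<rfloor> else 0)}"
    by (rule finite_subset[OF _ finite_atoms]) (auto simp: measure_def split: if_splits)
  then show ?thesis
    unfolding points_in_def by (subst count_Abs_multiset) auto
qed

lemma of_nat_count_points_in: "of_nat (count (points_in L \<phi>) x) = emeasure \<phi> ({x} \<inter> L)"
proof -
  obtain k :: nat where k: "emeasure \<phi> {x} = of_nat k" using configs_nat[OF \<phi>] singleton_rel_compact by blast
  then show ?thesis by (auto simp: count_points_in measure_def)
qed

lemma npoints_points_in:
  assumes A: "A \<in> sets borel"
  shows "of_nat (npoints A (points_in L \<phi>)) = emeasure \<phi> (A \<inter> L)"
proof -
  let ?F = "{x \<in> L. emeasure \<phi> {x} \<noteq> 0}" and ?N = "L - {x. emeasure \<phi> {x} \<noteq> 0}"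
  have F: "?F \<in> sets borel" using finite_atoms by (intro borel_closed finite_imp_closed)
  have N: "?N \<in> sets borel"
  proof -
    have *: "?N = L - ?F" by auto
    show ?thesis unfolding * by (rule sets.Diff[OF L_borel F])
  qed
  have set: "set_mset (points_in L \<phi>) = ?F"
  proof -
    have *: "x \<in># points_in L \<phi> \<longleftrightarrow> emeasure \<phi> ({x} \<inter> L) \<noteq> 0" for x
      by (simp add: of_nat_count_points_in[symmetric] not_in_iff[symmetric])
    show ?thesis
    proof (rule set_eqI)
      fix x show "x \<in># points_in L \<phi> \<longleftrightarrow> x \<in> ?F"
        unfolding * by (cases "x \<in> L") simp_all
    qed
  qed
  have "of_nat (npoints A (points_in L \<phi>)) = (\<Sum>x\<in>?F. of_nat (count (points_in L \<phi>) x) * indicator A x :: ennreal)"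
    unfolding npoints_sum_mset sum_mset_sum_count set ..
  also have "\<dots> = (\<Sum>x\<in>?F \<inter> A. emeasure \<phi> {x})"
    unfolding sum.inter_restrict[OF finite_atoms]
    by (intro sum.cong refl) (simp add: of_nat_count_points_in indicator_def)
  also have "\<dots> = emeasure \<phi> (?F \<inter> A)"
    using finite_atoms by (intro emeasure_eq_sum_singleton[symmetric]) (auto simp: sets_phi)
  also have "\<dots> = emeasure \<phi> (A \<inter> L)"
  proof (rule antisym)
    show "emeasure \<phi> (?F \<inter> A) \<le> emeasure \<phi> (A \<inter> L)"
      using A L_borel by (intro emeasure_mono) (auto simp: sets_phi)
    have "emeasure \<phi> (A \<inter> L) \<le> emeasure \<phi> ((?F \<inter> A) \<union> ?N)"
      using A F N by (intro emeasure_mono) (auto simp: sets_phi)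
    also have "\<dots> \<le> emeasure \<phi> (?F \<inter> A) + emeasure \<phi> ?N"
      using A F N by (intro emeasure_subadditive) (auto simp: sets_phi)
    finally show "emeasure \<phi> (A \<inter> L) \<le> emeasure \<phi> (?F \<inter> A)" by (simp add: emeasure_non_atoms)
  qed
  finally show ?thesis .
qed

lemma conf_points_in:
  assumes "emeasure \<phi> (- L) = 0"
  shows "conf (points_in L \<phi>) = \<phi>"
proof (rule measure_eqI)
  fix A assume "A \<in> sets (conf (points_in L \<phi>))"
  then have A: "A \<in> sets borel" by simp
  have "emeasure \<phi> (A \<inter> L) = emeasure \<phi> A"
    using assms A L_borel by (intro emeasure_eq_AE) (auto simp: sets_phi intro!: AE_I[of _ _ "- L"])
  then show "emeasure (conf (points_in L \<phi>)) A = emeasure \<phi> A"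
    using A by (simp add: emeasure_conf npoints_points_in)
qed (simp add: sets_phi)

end

lemma measurable_points_in [measurable]:
  assumes "compact L"
  shows "points_in L \<in> config_space \<rightarrow>\<^sub>M multiset_space"
proof (rule measurable_multiset_npointsI)
  fix A :: "'a set" assume A: "A \<in> sets borel"
  have L: "L \<in> sets borel" using assms by (simp add: borel_closed compact_imp_closed)
  have m: "(\<lambda>\<phi>. emeasure \<phi> (A \<inter> L)) \<in> borel_measurable config_space"
    using assms A L by (intro measurable_config_eval compact_rel_compact_borel[of L]) auto
  show "(\<lambda>\<phi>. npoints A (points_in L \<phi>)) \<in> config_space \<rightarrow>\<^sub>M count_space UNIV"
  proof (subst measurable_count_space_eq2_countable, intro conjI ballI)
    fix k :: nat
    have "(\<lambda>\<phi>. npoints A (points_in L \<phi>)) -` {k} \<inter> space config_space =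
      (\<lambda>\<phi>. emeasure \<phi> (A \<inter> L)) -` {of_nat k} \<inter> space config_space"
      using npoints_points_in[OF assms _ A] by (auto simp: of_nat_eq_iff[where 'a = ennreal, symmetric] simp del: of_nat_eq_iff)
    also have "\<dots> \<in> sets config_space" by (rule measurable_sets[OF m]) simp
    finally show "(\<lambda>\<phi>. npoints A (points_in L \<phi>)) -` {k} \<inter> space config_space \<in> sets config_space" .
  qed auto
qed

section \<open>Thinned configurations\<close>

text \<open>The version with a parameter: in a superposition the sum of the other copies is random
  too, and joint measurability is needed to integrate with respect to the product law.\<close>

lemma measurable_point_sum_param:
  fixes v :: "('a::topological_space \<times> 'a multiset) \<times> 'b \<Rightarrow> ennreal"
  assumes "v \<in> borel_measurable ((borel \<Otimes>\<^sub>M multiset_space) \<Otimes>\<^sub>M N)"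
  shows "(\<lambda>(\<phi>, r). point_sum (\<lambda>x \<psi>. v ((x, \<psi>), r)) \<phi>) \<in> borel_measurable (multiset_space \<Otimes>\<^sub>M N)"
proof -
  let ?B = "borel \<Otimes>\<^sub>M (multiset_space :: 'a multiset measure)"
  let ?\<Omega> = "space ?B \<times> space N"
  let ?S = "\<lambda>v. (\<lambda>(\<phi>, r). point_sum (\<lambda>x \<psi>. v ((x, \<psi>), r)) \<phi>) :: 'a multiset \<times> 'b \<Rightarrow> ennreal"
  have spB [simp]: "space ?B = UNIV" by (simp add: space_pair_measure)
  have ind: "?S (indicator A) \<in> borel_measurable (multiset_space \<Otimes>\<^sub>M N)" if "A \<in> sets (?B \<Otimes>\<^sub>M N)" for A
  proof -
    have "{a \<times> b | a b. a \<in> sets ?B \<and> b \<in> sets N} \<subseteq> Pow ?\<Omega>"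
      using sets.sets_into_space by fastforce
    from Int_stable_pair_measure_generator this that[unfolded sets_pair_measure[of ?B N]] show ?thesis
    proof (induction rule: sigma_sets_induct_disjoint)
      case (basic A)
      then obtain a b where A: "A = a \<times> b" and [measurable]: "a \<in> sets ?B" "b \<in> sets N" by blast
      note [measurable] = measurable_point_sum_indicator[of a]
      have "?S (indicator A) = (\<lambda>(\<phi>, r). point_sum (\<lambda>x \<psi>. indicator a (x, \<psi>)) \<phi> * indicator b r)"
        by (auto simp: fun_eq_iff A point_sum_def indicator_times sum_mset_distrib_right)
      also have "\<dots> \<in> borel_measurable (multiset_space \<Otimes>\<^sub>M N)"
        by measurable
      finally show ?case .
    next
      case empty
      then show ?case by (simp add: point_sum_const)
    next
      case (compl A)
      note [measurable] = compl(2)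
      have "(\<lambda>z. of_nat (size (fst z)) - ?S (indicator A) z) \<in> borel_measurable (multiset_space \<Otimes>\<^sub>M N)"
        by measurable
      moreover have "?S (indicator (?\<Omega> - A)) z = of_nat (size (fst z)) - ?S (indicator A) z"
        if "z \<in> space (multiset_space \<Otimes>\<^sub>M N)" for z
      proof (cases z)
        case (Pair \<phi> r)
        then have r: "r \<in> space N" using that by (simp add: space_pair_measure)
        have "?S (indicator (?\<Omega> - A)) z + ?S (indicator A) z = point_sum (\<lambda>_ _. 1) \<phi>"
          unfolding point_sum_def Pair prod.case sum_mset.distrib[symmetric]
          by (rule sum_mset_cong_ennreal) (use r in \<open>auto simp: indicator_def\<close>)
        moreover then have "?S (indicator A) z \<noteq> \<infinity>"
          by (auto simp: point_sum_const)
        ultimately show ?thesis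
          unfolding point_sum_const Pair
          by (metis ennreal_add_diff_cancel_right fst_conv infinity_ennreal_def mult.right_neutral)
      qed
      ultimately show ?case
        by (subst measurable_cong) auto
    next
      case (union A)
      have "?S (indicator (\<Union>(range A))) = (\<lambda>z. \<Sum>i. ?S (indicator (A i)) z)"
        unfolding point_sum_def by (auto simp: fun_eq_iff sum_mset_suminf[symmetric] suminf_indicator[OF union(1)])
      moreover have "\<dots> \<in> borel_measurable (multiset_space \<Otimes>\<^sub>M N)"
        using union(3) by measurable
      ultimately show ?case by simp
    qed
  qed
  show ?thesis
    using assms
  proof (induction rule: borel_measurable_induct)
    case (cong f g)
    then show ?case
      by (subst measurable_cong[where g = "?S g"]) (auto simp: space_pair_measure point_sum_def)
  next
    case (set A)
    then show ?case by (rule ind)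
  next
    case (mult u c)
    have "?S (\<lambda>z. c * u z) = (\<lambda>z. c * ?S u z)"
      by (auto simp: fun_eq_iff point_sum_def sum_mset_distrib_left)
    then show ?case using mult by simp
  next
    case (add u v)
    have "?S (\<lambda>z. v z + u z) = (\<lambda>z. ?S v z + ?S u z)"
      by (auto simp: fun_eq_iff point_sum_def sum_mset.distrib)
    then show ?case using add by simp
  next
    case (seq U)
    have "?S (\<lambda>z. (SUP i. U i) z) = (\<lambda>z. SUP i. ?S (U i) z)"
      unfolding point_sum_def using seq(3)
      by (auto simp: fun_eq_iff SUP_apply incseq_def le_fun_def image_comp intro!: sum_mset_SUP)
    with seq show ?case by simp
  qed
qed

section \<open>Points of a configuration and their marks\<close>

lemma emeasure_config_of_points:
  assumes "A \<in> sets borel"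
  shows "emeasure (config_of_points S) A = emeasure (count_space S) {q \<in> S. fst q \<in> A}"
  unfolding config_of_points_def using assms
  by (subst emeasure_distr) (auto intro!: arg_cong2[where f = emeasure])

context
  fixes \<phi> :: "'a::metric_space measure"
  assumes \<phi>: "\<phi> \<in> configs"
begin

lemma config_points_fibre:
  obtains k :: nat where "emeasure \<phi> {x} = of_nat k" "{q \<in> config_points \<phi>. fst q = x} = Pair x ` {..<k}"
proof -
  obtain k :: nat where k: "emeasure \<phi> {x} = of_nat k"
    using configs_nat[OF \<phi> singleton_rel_compact] by blast
  then have "{q \<in> config_points \<phi>. fst q = x} = Pair x ` {..<k}"
    by (auto simp: config_points_def)
  then show thesis using k that by blast
qed

lemma finite_config_points_in:
  assumes "compact L"
  shows "finite {q \<in> config_points \<phi>. fst q \<in> L}"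
proof -
  have fin: "finite {q \<in> config_points \<phi>. fst q = x}" for x
    by (rule config_points_fibre[of x]) simp
  have sub: "{q \<in> config_points \<phi>. fst q \<in> L} \<subseteq> (\<Union>x\<in>{x \<in> L. emeasure \<phi> {x} \<noteq> 0}. {q \<in> config_points \<phi>. fst q = x})"
    by (auto simp: config_points_def)
  show ?thesis
    by (rule finite_subset[OF sub finite_UN_I[OF finite_atoms[OF assms \<phi>] fin]])
qed

lemma finite_config_points_rel_compact:
  assumes "A \<in> rel_compact_borel"
  shows "finite {q \<in> config_points \<phi>. fst q \<in> A}"
proof (rule finite_subset)
  show "{q \<in> config_points \<phi>. fst q \<in> A} \<subseteq> {q \<in> config_points \<phi>. fst q \<in> closure A}"
    using closure_subset by auto
  show "finite {q \<in> config_points \<phi>. fst q \<in> closure A}"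
    using assms by (intro finite_config_points_in) (simp add: rel_compact_borel_def)
qed

lemma emeasure_config_of_points_rel_compact:
  assumes "A \<in> rel_compact_borel" "S \<subseteq> config_points \<phi>"
  shows "emeasure (config_of_points S) A = of_nat (card {q \<in> S. fst q \<in> A})"
proof -
  have "finite {q \<in> S. fst q \<in> A}"
    using assms(2) by (intro finite_subset[OF _ finite_config_points_rel_compact[OF assms(1)]]) auto
  then show ?thesis
    using assms(1) by (subst emeasure_config_of_points)
      (auto simp: rel_compact_borel_def emeasure_count_space_finite)
qed

lemma config_of_points_in_configs:
  assumes "S \<subseteq> config_points \<phi>"
  shows "config_of_points S \<in> configs"
proof -
  have "emeasure (config_of_points S) A = \<infinity> \<or> (\<exists>k::nat. emeasure (config_of_points S) A = of_nat k)"
    if "A \<in> sets borel" for A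
    using that by (cases "finite {q \<in> S. fst q \<in> A}")
      (auto simp: emeasure_config_of_points emeasure_count_space_finite emeasure_count_space_infinite)
  then show ?thesis
    using emeasure_config_of_points_rel_compact[OF _ assms]
    by (auto simp: configs_def config_of_points_def[of S] of_nat_less_top)
qed

lemma points_in_config_of_points:
  assumes L: "compact L" and S: "S \<subseteq> config_points \<phi>"
  shows "points_in L (config_of_points S) = image_mset fst (mset_set {q \<in> S. fst q \<in> L})"
proof (rule multiset_eqI)
  fix x
  have fin: "finite {q \<in> S. fst q \<in> L}"
    using S by (intro finite_subset[OF _ finite_config_points_in[OF L]]) auto
  have "count (image_mset fst (mset_set {q \<in> S. fst q \<in> L})) x = card {q \<in> S. fst q \<in> L \<and> fst q = x}"
    using fin by (simp add: count_image_mset_eq_npoints npoints_def filter_mset_mset_set Collect_conj_eq[symmetric] conj_ac)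
  also have "\<dots> = (if x \<in> L then card {q \<in> S. fst q = x} else 0)"
    by (auto intro!: arg_cong[where f = card] simp: card_eq_0_iff)
  also have "\<dots> = count (points_in L (config_of_points S)) x"
    using emeasure_config_of_points_rel_compact[OF singleton_rel_compact S, of x]
    by (simp add: count_points_in[OF L config_of_points_in_configs[OF S]] measure_def)
  finally show "count (points_in L (config_of_points S)) x = count (image_mset fst (mset_set {q \<in> S. fst q \<in> L})) x"
    by simp
qed

lemma points_in_eq_config_points:
  assumes L: "compact L"
  shows "points_in L \<phi> = image_mset fst (mset_set {q \<in> config_points \<phi>. fst q \<in> L})"
proof (rule multiset_eqI)
  fix x
  obtain k :: nat where k: "emeasure \<phi> {x} = of_nat k" "{q \<in> config_points \<phi>. fst q = x} = Pair x ` {..<k}"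
    by (rule config_points_fibre)
  have "count (image_mset fst (mset_set {q \<in> config_points \<phi>. fst q \<in> L})) x =
      card {q \<in> config_points \<phi>. fst q \<in> L \<and> fst q = x}"
    using finite_config_points_in[OF L]
    by (simp add: count_image_mset_eq_npoints npoints_def filter_mset_mset_set Collect_conj_eq[symmetric] conj_ac)
  also have "\<dots> = (if x \<in> L then card {q \<in> config_points \<phi>. fst q = x} else 0)"
    by (auto intro!: arg_cong[where f = card] simp: card_eq_0_iff)
  also have "\<dots> = count (points_in L \<phi>) x"
    using k(1) by (simp add: k(2) card_image inj_on_def count_points_in[OF L \<phi>] measure_def)
  finally show "count (points_in L \<phi>) x = count (image_mset fst (mset_set {q \<in> config_points \<phi>. fst q \<in> L})) x"
    by simp
qed

end

text \<open>The part of a thinning that the marks in a finite set \<open>J\<close>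
  determine.\<close>

definition marked_points :: "('a \<times> nat) set \<Rightarrow> ('a \<times> nat \<Rightarrow> bool) \<Rightarrow> 'a multiset" where
  "marked_points J b = image_mset fst (mset_set {q \<in> J. b q})"

lemma marked_points_insert:
  assumes "finite J" "q \<notin> J"
  shows "marked_points (insert q J) b = (if b q then add_mset (fst q) (marked_points J b) else marked_points J b)"
proof (cases "b q")
  case True
  then have "{r \<in> insert q J. b r} = insert q {r \<in> J. b r}" by auto
  then show ?thesis using assms True by (simp add: marked_points_def)
next
  case False
  then have "{r \<in> insert q J. b r} = {r \<in> J. b r}" by auto
  then show ?thesis using False by (simp add: marked_points_def)
qed

lemma measurable_marked_points:
  assumes "finite J" "J \<subseteq> I"
  shows "marked_points J \<in> (\<Pi>\<^sub>M q\<in>I. measure_pmf (bernoulli_pmf p)) \<rightarrow>\<^sub>M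
    (multiset_space :: 'a::topological_space multiset measure)"
  using assms
proof (induction J)
  case empty
  then show ?case by (simp add: marked_points_def)
next
  case (insert q J)
  let ?P = "\<Pi>\<^sub>M q\<in>I. measure_pmf (bernoulli_pmf p)"
  have [measurable]: "marked_points J \<in> ?P \<rightarrow>\<^sub>M multiset_space" using insert by simp
  have "(\<lambda>b. b q) \<in> ?P \<rightarrow>\<^sub>M count_space UNIV"
    using measurable_component_singleton[of q I "\<lambda>_. measure_pmf (bernoulli_pmf p)"] insert.prems by simp
  then have [measurable]: "Measurable.pred ?P (\<lambda>b. b q)" by simp
  have "marked_points (insert q J) = (\<lambda>b. if b q then add_mset (fst q) (marked_points J b) else marked_points J b)"
    using marked_points_insert[OF insert(1,2)] by (simp add: fun_eq_iff)
  then show ?case by simp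
qed

text \<open>The product over the marks splits off one factor at a time, which reproduces the
  recursion of \<open>thin\<close>.\<close>

lemma nn_integral_marked_points:
  fixes J :: "('a::topological_space \<times> nat) set"
  assumes "finite J" and p: "0 \<le> p" "p \<le> 1" and "F \<in> borel_measurable multiset_space"
  shows "(\<integral>\<^sup>+b. F (marked_points J b) \<partial>(\<Pi>\<^sub>M q\<in>J. measure_pmf (bernoulli_pmf p))) =
    (\<integral>\<^sup>+\<psi>. F \<psi> \<partial>thin p (image_mset fst (mset_set J)))"
  using assms(1,4)
proof (induction J arbitrary: F)
  case empty
  show ?case by (simp add: marked_points_def PiM_empty nn_integral_count_space_finite)
next
  case (insert q J F)
  interpret product_sigma_finite "\<lambda>_. measure_pmf (bernoulli_pmf p)"
    by (intro product_sigma_finite.intro prob_space_imp_sigma_finite measure_pmf.prob_space_axioms)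
  let ?P = "\<lambda>J. \<Pi>\<^sub>M q\<in>J. measure_pmf (bernoulli_pmf p)"
  note [measurable] = insert.prems
  have [measurable]: "marked_points (insert q J) \<in> ?P (insert q J) \<rightarrow>\<^sub>M multiset_space"
    "marked_points J \<in> ?P J \<rightarrow>\<^sub>M multiset_space"
    using insert(1) by (auto intro!: measurable_marked_points)
  have upd: "marked_points J (b(q := y)) = marked_points J b" for b y
    using insert(2) unfolding marked_points_def by (intro arg_cong2[where f = image_mset] arg_cong[where f = mset_set]) auto
  have "(\<integral>\<^sup>+b. F (marked_points (insert q J) b) \<partial>?P (insert q J)) =
    (\<integral>\<^sup>+b. (\<integral>\<^sup>+y. F (marked_points (insert q J) (b(q := y))) \<partial>measure_pmf (bernoulli_pmf p)) \<partial>?P J)"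
    by (rule product_nn_integral_insert[OF insert(1,2)]) measurable
  also have "\<dots> = (\<integral>\<^sup>+b. ennreal p * F (add_mset (fst q) (marked_points J b)) + ennreal (1 - p) * F (marked_points J b) \<partial>?P J)"
    using p by (simp add: marked_points_insert[OF insert(1,2)] upd mult.commute)
  also have "\<dots> = ennreal p * (\<integral>\<^sup>+b. F (add_mset (fst q) (marked_points J b)) \<partial>?P J) +
      ennreal (1 - p) * (\<integral>\<^sup>+b. F (marked_points J b) \<partial>?P J)"
    by (simp add: nn_integral_add nn_integral_cmult)
  also have "(\<integral>\<^sup>+b. F (add_mset (fst q) (marked_points J b)) \<partial>?P J) =
      (\<integral>\<^sup>+\<psi>. F (add_mset (fst q) \<psi>) \<partial>thin p (image_mset fst (mset_set J)))"
    by (rule insert.IH) measurable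
  also have "(\<integral>\<^sup>+b. F (marked_points J b) \<partial>?P J) = (\<integral>\<^sup>+\<psi>. F \<psi> \<partial>thin p (image_mset fst (mset_set J)))"
    by (rule insert.IH) measurable
  finally show ?case
    using insert(1,2) by (simp add: nn_integral_thin_add_mset[OF p])
qed

text \<open>There may be uncountably many marks, but the mass of a relatively compact set depends on
  finitely many of them, and such masses generate the \<sigma>-algebra.\<close>

lemma measurable_config_of_marked_points:
  assumes \<phi>: "\<phi> \<in> configs"
  shows "(\<lambda>b. config_of_points {q \<in> config_points \<phi>. b q}) \<in>
    (\<Pi>\<^sub>M q\<in>config_points \<phi>. measure_pmf (bernoulli_pmf p)) \<rightarrow>\<^sub>M config_space"
proof (rule measurable_config_spaceI)
  let ?P = "\<Pi>\<^sub>M q\<in>config_points \<phi>. measure_pmf (bernoulli_pmf p)"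
  show "config_of_points {q \<in> config_points \<phi>. b q} \<in> configs" for b
    by (rule config_of_points_in_configs[OF \<phi>]) auto
  fix A :: "'a set" assume A: "A \<in> rel_compact_borel"
  let ?J = "{q \<in> config_points \<phi>. fst q \<in> A}"
  have fin: "finite ?J" by (rule finite_config_points_rel_compact[OF \<phi> A])
  have [measurable]: "marked_points ?J \<in> ?P \<rightarrow>\<^sub>M multiset_space"
    by (rule measurable_marked_points[OF fin]) auto
  have "emeasure (config_of_points {q \<in> config_points \<phi>. b q}) A = of_nat (size (marked_points ?J b))" for b
    by (subst emeasure_config_of_points_rel_compact[OF \<phi> A])
       (auto simp: marked_points_def intro!: arg_cong[where f = card])
  then show "(\<lambda>b. emeasure (config_of_points {q \<in> config_points \<phi>. b q}) A) \<in> borel_measurable ?P"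
    by simp
qed

text \<open>Inside \<open>L\<close> the kernel reads only the marks of the finitely many points in
  \<open>L\<close>, and these are distributed according to a finite product. This links the thinning
  of configurations with that of multisets.\<close>

lemma distr_thinning_kernel:
  assumes p: "0 \<le> p" "p \<le> 1" and \<phi>: "\<phi> \<in> configs" and L: "compact L"
  shows "distr (thinning_kernel p \<phi>) multiset_space (points_in L) = thin_law p (points_in L \<phi>)"
proof (rule measure_eqI_nn_integral)
  fix F :: "'a multiset \<Rightarrow> ennreal" assume "F \<in> borel_measurable (thin_law p (points_in L \<phi>))"
  then have F [measurable]: "F \<in> borel_measurable multiset_space" by simp
  let ?I = "config_points \<phi>"
  let ?J = "{q \<in> ?I. fst q \<in> L}"
  let ?P = "\<lambda>J. \<Pi>\<^sub>M q\<in>J. measure_pmf (bernoulli_pmf p)"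
  interpret B: product_prob_space "\<lambda>_. measure_pmf (bernoulli_pmf p)" ?I
    by (intro product_prob_spaceI measure_pmf.prob_space_axioms)
  note [measurable] = measurable_points_in[OF L] measurable_config_of_marked_points[OF \<phi>]
  have fin: "finite ?J" by (rule finite_config_points_in[OF \<phi> L])
  have [measurable]: "marked_points ?J \<in> ?P ?J \<rightarrow>\<^sub>M multiset_space"
    by (rule measurable_marked_points[OF fin]) auto
  have "points_in L (config_of_points {q \<in> ?I. b q}) = marked_points ?J (restrict b ?J)" for b
    unfolding marked_points_def
    by (subst points_in_config_of_points[OF \<phi> L])
       (auto intro!: arg_cong2[where f = image_mset] arg_cong[where f = mset_set])
  then have "(\<integral>\<^sup>+\<psi>. F \<psi> \<partial>distr (thinning_kernel p \<phi>) multiset_space (points_in L)) =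
    (\<integral>\<^sup>+b. F (marked_points ?J (restrict b ?J)) \<partial>?P ?I)"
    unfolding thinning_kernel_def by (simp add: nn_integral_distr distr_distr comp_def)
  also have "\<dots> = (\<integral>\<^sup>+b. F (marked_points ?J b) \<partial>distr (?P ?I) (?P ?J) (\<lambda>b. restrict b ?J))"
    by (subst nn_integral_distr) (auto intro!: measurable_restrict_subset)
  also have "distr (?P ?I) (?P ?J) (\<lambda>b. restrict b ?J) = ?P ?J"
    by (rule B.distr_PiM_restrict_finite[OF fin]) auto
  also have "(\<integral>\<^sup>+b. F (marked_points ?J b) \<partial>?P ?J) = (\<integral>\<^sup>+\<psi>. F \<psi> \<partial>thin p (points_in L \<phi>))"
    unfolding points_in_eq_config_points[OF \<phi> L] by (rule nn_integral_marked_points[OF fin p F])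
  also have "\<dots> = (\<integral>\<^sup>+\<psi>. F \<psi> \<partial>thin_law p (points_in L \<phi>))"
    by (rule nn_integral_thin_law[symmetric, OF F])
  finally show "(\<integral>\<^sup>+\<psi>. F \<psi> \<partial>distr (thinning_kernel p \<phi>) multiset_space (points_in L)) =
    (\<integral>\<^sup>+\<psi>. F \<psi> \<partial>thin_law p (points_in L \<phi>))" .
qed simp

section \<open>Joint law of a configuration and its thinning\<close>

definition thin_joint :: "real \<Rightarrow> 'a::topological_space multiset measure \<Rightarrow> ('a multiset \<times> 'a multiset) measure" where
  "thin_joint p Q = Q \<bind> (\<lambda>\<phi>. distr (thin_law p \<phi>) (multiset_space \<Otimes>\<^sub>M multiset_space) (Pair \<phi>))"

context
  fixes Q :: "'a::topological_space multiset measure" and p :: real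
  assumes prob_Q: "prob_space Q" and sets_Q [simp, measurable_cong]: "sets Q = sets multiset_space"
begin

lemma thin_joint_kernel:
  "(\<lambda>\<phi>. distr (thin_law p \<phi>) (multiset_space \<Otimes>\<^sub>M multiset_space) (Pair \<phi>)) \<in>
    Q \<rightarrow>\<^sub>M prob_algebra (multiset_space \<Otimes>\<^sub>M multiset_space)"
  by (rule measurable_distr_prob_space2[where M = multiset_space]) measurable

lemma prob_space_thin_joint: "prob_space (thin_joint p Q)"
  and sets_thin_joint: "sets (thin_joint p Q) = sets (multiset_space \<Otimes>\<^sub>M multiset_space)"
proof -
  have Q: "Q \<in> space (prob_algebra Q)" using prob_Q by (simp add: space_prob_algebra)
  show "prob_space (thin_joint p Q)" "sets (thin_joint p Q) = sets (multiset_space \<Otimes>\<^sub>M multiset_space)"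
    unfolding thin_joint_def using prob_space_bind'[OF Q thin_joint_kernel] sets_bind'[OF Q thin_joint_kernel] by auto
qed

lemma nn_integral_thin_joint:
  assumes [measurable]: "F \<in> borel_measurable (multiset_space \<Otimes>\<^sub>M multiset_space)"
  shows "(\<integral>\<^sup>+z. F z \<partial>thin_joint p Q) = (\<integral>\<^sup>+\<phi>. (\<integral>\<^sup>+\<psi>. F (\<phi>, \<psi>) \<partial>thin_law p \<phi>) \<partial>Q)"
  unfolding thin_joint_def
  by (subst nn_integral_bind[OF _ measurable_prob_algebraD[OF thin_joint_kernel]]) (auto simp: nn_integral_distr)

end

text \<open>On rectangles this is the defining equation of \<open>independent_thinning\<close>, with
  the kernel replaced by its image under \<open>points_in L\<close>.\<close>

lemma independent_thinning_joint:
  fixes \<Phi> \<Psi> :: "'w \<Rightarrow> 'a::metric_space measure"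
  assumes thin: "independent_thinning P p \<Phi> \<Psi>" and p: "0 \<le> p" "p \<le> 1" and L: "compact L"
  shows "distr P (multiset_space \<Otimes>\<^sub>M multiset_space) (\<lambda>\<omega>. (points_in L (\<Phi> \<omega>), points_in L (\<Psi> \<omega>))) =
    thin_joint p (distr P multiset_space (\<lambda>\<omega>. points_in L (\<Phi> \<omega>)))"
    (is "?D = thin_joint p ?Q")
proof -
  have \<Phi> [measurable]: "\<Phi> \<in> P \<rightarrow>\<^sub>M config_space" and \<Psi> [measurable]: "\<Psi> \<in> P \<rightarrow>\<^sub>M config_space" and "prob_space P"
    using thin by (auto simp: independent_thinning_def point_process_def)
  interpret P: prob_space P by fact
  note [measurable] = measurable_points_in[OF L]
  have prob_Q: "prob_space ?Q" by (rule P.prob_space_distr) measurable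
  have sets_Q: "sets ?Q = sets multiset_space" by simp
  let ?MM = "multiset_space \<Otimes>\<^sub>M multiset_space :: ('a multiset \<times> 'a multiset) measure"
  let ?E = "{a \<times> b | a b. a \<in> sets (multiset_space :: 'a multiset measure) \<and> b \<in> sets (multiset_space :: 'a multiset measure)}"
  show ?thesis
  proof (rule measure_eqI_generator_eq[OF Int_stable_pair_measure_generator, where A = "\<lambda>_. UNIV \<times> UNIV" and \<Omega> = "UNIV \<times> UNIV"])
    fix X assume "X \<in> ?E"
    then obtain A B where X: "X = A \<times> B" and A [measurable]: "A \<in> sets multiset_space" and B [measurable]: "B \<in> sets multiset_space"
      by blast
    let ?A = "points_in L -` A \<inter> configs" and ?B = "points_in L -` B \<inter> configs"
    have AB: "?A \<in> sets config_space" "?B \<in> sets config_space"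
      using measurable_sets[OF measurable_points_in[OF L]] A B by auto
    have conf: "\<Phi> \<omega> \<in> configs" "\<Psi> \<omega> \<in> configs" if "\<omega> \<in> space P" for \<omega>
      using that measurable_space[OF \<Phi>] measurable_space[OF \<Psi>] by auto
    have ker: "emeasure (thinning_kernel p (\<Phi> \<omega>)) ?B = emeasure (thin_law p (points_in L (\<Phi> \<omega>))) B"
      if "\<omega> \<in> space P" for \<omega>
      unfolding distr_thinning_kernel[OF p conf(1)[OF that] L, symmetric]
      by (subst emeasure_distr) (auto simp: thinning_kernel_def)
    have "emeasure ?D X = emeasure P {\<omega> \<in> space P. \<Phi> \<omega> \<in> ?A \<and> \<Psi> \<omega> \<in> ?B}"
      unfolding X using conf by (subst emeasure_distr) (auto intro!: arg_cong[where f = "emeasure P"])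
    also have "\<dots> = (\<integral>\<^sup>+\<omega>. emeasure (thinning_kernel p (\<Phi> \<omega>)) ?B * indicator ?A (\<Phi> \<omega>) \<partial>P)"
      using thin AB unfolding independent_thinning_def by blast
    also have "\<dots> = (\<integral>\<^sup>+\<omega>. emeasure (thin_law p (points_in L (\<Phi> \<omega>))) B * indicator A (points_in L (\<Phi> \<omega>)) \<partial>P)"
      by (intro nn_integral_cong) (auto simp: ker conf indicator_def)
    also have "\<dots> = (\<integral>\<^sup>+\<phi>. emeasure (thin_law p \<phi>) B * indicator A \<phi> \<partial>?Q)"
    proof -
      have [measurable]: "(\<lambda>\<phi>. emeasure (thin_law p \<phi>) B) \<in> borel_measurable multiset_space"
        using measurable_emeasure_kernel[OF measurable_prob_algebraD[OF measurable_thin_law] B] .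
      show ?thesis by (subst nn_integral_distr) auto
    qed
    also have "\<dots> = (\<integral>\<^sup>+\<phi>. (\<integral>\<^sup>+\<psi>. indicator X (\<phi>, \<psi>) \<partial>thin_law p \<phi>) \<partial>?Q)"
      by (intro nn_integral_cong) (simp add: X indicator_times nn_integral_cmult mult.commute)
    also have "\<dots> = emeasure (thin_joint p ?Q) X"
      using sets_thin_joint[OF prob_Q sets_Q, of p] unfolding X
      by (subst nn_integral_thin_joint[OF prob_Q sets_Q, symmetric]) auto
    finally show "emeasure ?D X = emeasure (thin_joint p ?Q) X" .
  next
    have "UNIV \<in> sets (multiset_space :: 'a multiset measure)"
      using sets.top[of "multiset_space :: 'a multiset measure"] by simp
    then show "range (\<lambda>_. UNIV \<times> UNIV) \<subseteq> ?E" by blast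
    have "prob_space ?D" by (rule P.prob_space_distr) measurable
    then show "emeasure ?D (UNIV \<times> UNIV) \<noteq> \<infinity>"
      by (simp add: prob_space.finite_measure finite_measure.emeasure_finite)
  qed (auto simp: sets_pair_measure sets_thin_joint[OF prob_Q sets_Q] sets.sets_into_space)
qed

text \<open>A thinning keeps no point in \<open>A\<close> if there was none. \<open>A\<close> is
  relatively compact because only for such sets does the \<sigma>-algebra on configurations make the
  mass measurable by construction.\<close>

lemma independent_thinning_null:
  assumes thin: "independent_thinning P p \<Phi> \<Psi>" and A: "A \<in> rel_compact_borel"
    and null: "AE \<omega> in P. emeasure (\<Phi> \<omega>) A = 0"
  shows "AE \<omega> in P. emeasure (\<Psi> \<omega>) A = 0"
proof -
  have \<Phi> [measurable]: "\<Phi> \<in> P \<rightarrow>\<^sub>M config_space" and \<Psi> [measurable]: "\<Psi> \<in> P \<rightarrow>\<^sub>M config_space"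
    using thin by (auto simp: independent_thinning_def point_process_def)
  note [measurable] = measurable_config_eval[OF A]
  let ?B = "{\<phi> \<in> space config_space. emeasure \<phi> A \<noteq> 0}"
  have B: "?B \<in> sets config_space" by measurable
  have ker: "emeasure (thinning_kernel p \<phi>) ?B = 0" if "\<phi> \<in> configs" "emeasure \<phi> A = 0" for \<phi>
  proof -
    have no: "{q \<in> config_points \<phi>. fst q \<in> A} = {}"
    proof safe
      fix x i assume "(x, i) \<in> config_points \<phi>" "fst (x, i) \<in> A"
      moreover then have "emeasure \<phi> {x} \<le> emeasure \<phi> A"
        using A that(1) by (intro emeasure_mono) (auto simp: configs_def rel_compact_borel_def)
      ultimately show "(x, i) \<in> {}" using that(2) by (auto simp: config_points_def)
    qed
    have e: "{q \<in> {q \<in> config_points \<phi>. b q}. fst q \<in> A} = {}" for b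
      using no by blast
    have "emeasure (config_of_points {q \<in> config_points \<phi>. b q}) A = 0" for b
      using emeasure_config_of_points_rel_compact[OF that(1) A, of "{q \<in> config_points \<phi>. b q}"]
      unfolding e by auto
    then show ?thesis
      unfolding thinning_kernel_def
      by (subst emeasure_distr[OF measurable_config_of_marked_points[OF that(1)] B]) simp
  qed
  have "emeasure P {\<omega> \<in> space P. \<Phi> \<omega> \<in> space config_space \<and> \<Psi> \<omega> \<in> ?B} =
    (\<integral>\<^sup>+\<omega>. emeasure (thinning_kernel p (\<Phi> \<omega>)) ?B * indicator (space config_space) (\<Phi> \<omega>) \<partial>P)"
    using thin B unfolding independent_thinning_def by blast
  also have "\<dots> = (\<integral>\<^sup>+\<omega>. 0 \<partial>P)"
  proof (rule nn_integral_cong_AE)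
    show "AE \<omega> in P. emeasure (thinning_kernel p (\<Phi> \<omega>)) ?B * indicator (space config_space) (\<Phi> \<omega>) = 0"
      using null AE_space
    proof eventually_elim
      case (elim \<omega>)
      then have "\<Phi> \<omega> \<in> configs" using measurable_space[OF \<Phi>] by simp
      then show ?case using ker elim by simp
    qed
  qed
  also have "{\<omega> \<in> space P. \<Phi> \<omega> \<in> space config_space \<and> \<Psi> \<omega> \<in> ?B} = {\<omega> \<in> space P. emeasure (\<Psi> \<omega>) A \<noteq> 0}"
    using measurable_space[OF \<Phi>] measurable_space[OF \<Psi>] by auto
  finally have "emeasure P {\<omega> \<in> space P. emeasure (\<Psi> \<omega>) A \<noteq> 0} = 0" by simp
  moreover have "{\<omega> \<in> space P. emeasure (\<Psi> \<omega>) A \<noteq> 0} \<in> sets P" by measurable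
  ultimately show ?thesis by (intro AE_I) auto
qed

section \<open>Superpositions of configurations\<close>

lemma emeasure_superposition:
  fixes \<psi> :: "'i \<Rightarrow> 'a::metric_space measure"
  assumes "finite I" "\<And>i. i \<in> I \<Longrightarrow> sets (\<psi> i) = sets borel" "A \<in> sets borel"
  shows "emeasure (superposition I \<psi>) A = (\<Sum>i\<in>I. emeasure (\<psi> i) A)"
proof (rule emeasure_measure_of[OF superposition_def])
  show sets: "A \<in> sets (superposition I \<psi>)"
    unfolding superposition_def using assms(3) by (simp add: sets_measure_of_conv)
  show "positive (sets (superposition I \<psi>)) (\<lambda>A. \<Sum>i\<in>I. emeasure (\<psi> i) A)"
    by (simp add: positive_def)
  show "countably_additive (sets (superposition I \<psi>)) (\<lambda>A. \<Sum>i\<in>I. emeasure (\<psi> i) A)"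
  proof (rule countably_additiveI)
    fix B :: "nat \<Rightarrow> 'a set" assume B: "range B \<subseteq> sets (superposition I \<psi>)" "disjoint_family B"
    have "sets (superposition I \<psi>) = sets borel"
      unfolding superposition_def using sets.sigma_sets_eq[of "borel :: 'a measure"] by (simp add: sets_measure_of_conv)
    then have "(\<Sum>j. emeasure (\<psi> i) (B j)) = emeasure (\<psi> i) (\<Union>(range B))" if "i \<in> I" for i
      using B assms(2)[OF that] by (intro suminf_emeasure) auto
    then show "(\<Sum>j. \<Sum>i\<in>I. emeasure (\<psi> i) (B j)) = (\<Sum>i\<in>I. emeasure (\<psi> i) (\<Union>(range B)))"
      by (subst suminf_sum) auto
  qed
qed auto

lemma superposition_in_configs:
  fixes \<psi> :: "'i \<Rightarrow> 'a::metric_space measure"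
  assumes "finite I" "\<And>i. i \<in> I \<Longrightarrow> \<psi> i \<in> configs"
  shows "superposition I \<psi> \<in> configs"
proof -
  have b: "sets (\<psi> i) = sets borel" if "i \<in> I" for i using assms(2)[OF that] by (simp add: configs_def)
  note e = emeasure_superposition[OF assms(1) b]
  have "(\<Sum>i\<in>J. emeasure (\<psi> i) A) = \<infinity> \<or> (\<exists>k::nat. (\<Sum>i\<in>J. emeasure (\<psi> i) A) = of_nat k)"
    if A: "A \<in> sets borel" and "finite J" "J \<subseteq> I" for A J
    using that(2,3)
  proof (induction J)
    case (insert i J)
    have "emeasure (\<psi> i) A = \<infinity> \<or> (\<exists>k::nat. emeasure (\<psi> i) A = of_nat k)"
      using assms(2)[of i] insert A by (auto simp: configs_def)
    then show ?case using insert by (auto simp: of_nat_add[symmetric] simp del: of_nat_add)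
  qed (auto intro: exI[of _ 0])
  moreover have "(\<Sum>i\<in>I. emeasure (\<psi> i) A) < \<infinity>" if "A \<in> rel_compact_borel" for A
    using assms that by (auto simp: configs_def less_top)
  moreover have "sets (superposition I \<psi>) = sets borel"
    unfolding superposition_def using sets.sigma_sets_eq[of "borel :: 'a measure"] by (simp add: sets_measure_of_conv)
  ultimately show ?thesis
    using assms(1) by (auto simp: configs_def e rel_compact_borel_def)
qed

section \<open>The Papangelou intensity of the superposition\<close>

lemma points_in_conf:
  assumes L: "compact L" and "set_mset \<psi> \<subseteq> L"
  shows "points_in L (conf \<psi>) = \<psi>"
proof (rule multiset_eqI)
  fix x
  have "npoints {x} \<psi> = count \<psi> x"
    using count_image_mset_eq_npoints[of "\<lambda>x. x" \<psi> x] by (simp add: vimage_def)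
  moreover have "x \<notin> L \<Longrightarrow> count \<psi> x = 0" using assms(2) by (auto simp: count_eq_zero_iff)
  ultimately show "count (points_in L (conf \<psi>)) x = count \<psi> x"
    by (simp add: count_points_in[OF L] measure_conf)
qed

lemma set_points_in: "compact L \<Longrightarrow> \<phi> \<in> configs \<Longrightarrow> set_mset (points_in L \<phi>) \<subseteq> L"
  by (auto simp: count_points_in count_greater_zero_iff[symmetric] simp del: count_greater_zero_iff split: if_splits)

text \<open>What concerns a single process: it is replaced by the law \<open>Q\<close> of its points
  in \<open>\<Lambda>\<close>, the measure \<open>l\<close> by its finite restriction
  \<open>l\<Lambda>\<close>, and \<open>c\<close> by the function \<open>cm\<close> on
  multisets.\<close>

locale compact_papangelou =
  fixes l :: "'a::metric_space measure" and \<Lambda> :: "'a set" and P :: "'w measure"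
    and \<Phi> :: "'w \<Rightarrow> 'a measure" and c :: "'a \<Rightarrow> 'a measure \<Rightarrow> real"
  assumes l: "radon_measure l" and \<Lambda>: "compact \<Lambda>"
    and \<Phi>_on: "point_process_on \<Lambda> P \<Phi>" and c: "papangelou_intensity l P \<Phi> c"
begin

lemma sets_l [simp, measurable_cong]: "sets l = sets borel"
  using l by (simp add: radon_measure_def)

lemma \<Lambda>_borel [measurable]: "\<Lambda> \<in> sets borel"
  using \<Lambda> by (simp add: borel_closed compact_imp_closed)

sublocale P: prob_space P
  using \<Phi>_on by (simp add: point_process_on_def point_process_def)

lemma \<Phi>_measurable [measurable]: "\<Phi> \<in> P \<rightarrow>\<^sub>M config_space"
  using \<Phi>_on by (simp add: point_process_on_def point_process_def)

lemma c_measurable [measurable]: "(\<lambda>(x, \<phi>). c x \<phi>) \<in> borel_measurable (borel \<Otimes>\<^sub>M config_space)"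
  using c by (simp add: papangelou_intensity_def)

lemma c_nonneg: "\<phi> \<in> configs \<Longrightarrow> 0 \<le> c x \<phi>"
  using c by (simp add: papangelou_intensity_def)

lemma pts_measurable [measurable]: "points_in \<Lambda> \<in> config_space \<rightarrow>\<^sub>M multiset_space"
  by (rule measurable_points_in[OF \<Lambda>])

definition Q :: "'a multiset measure" where
  "Q = distr P multiset_space (\<lambda>\<omega>. points_in \<Lambda> (\<Phi> \<omega>))"

definition l\<Lambda> :: "'a measure" where
  "l\<Lambda> = density l (indicator \<Lambda>)"

definition cm :: "'a \<Rightarrow> 'a multiset \<Rightarrow> real" where
  "cm x \<phi> = c x (conf \<phi>)"

lemma cm_nonneg: "0 \<le> cm x \<phi>"
  by (simp add: cm_def c_nonneg)

lemma cm_measurable [measurable]: "(\<lambda>(x, \<phi>). cm x \<phi>) \<in> borel_measurable (borel \<Otimes>\<^sub>M multiset_space)"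
  unfolding cm_def by measurable

lemma sets_Q [simp, measurable_cong]: "sets Q = sets multiset_space"
  by (simp add: Q_def)

lemma prob_space_Q: "prob_space Q"
  unfolding Q_def by (rule P.prob_space_distr) measurable

sublocale Q: prob_space Q by (rule prob_space_Q)

lemma sets_l\<Lambda> [simp, measurable_cong]: "sets l\<Lambda> = sets borel"
  by (simp add: l\<Lambda>_def)

lemma finite_l\<Lambda>: "finite_measure l\<Lambda>"
proof (rule finite_measureI)
  have "emeasure l\<Lambda> (space l\<Lambda>) = emeasure l \<Lambda>"
    using sets_eq_imp_space_eq[OF sets_l]
    by (simp add: l\<Lambda>_def emeasure_density)
  also have "\<dots> < \<infinity>" using l \<Lambda> unfolding radon_measure_def by blast
  finally show "emeasure l\<Lambda> (space l\<Lambda>) \<noteq> \<infinity>" by simp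
qed

sublocale l\<Lambda>: finite_measure l\<Lambda> by (rule finite_l\<Lambda>)

lemma nn_integral_l\<Lambda>:
  assumes [measurable]: "f \<in> borel_measurable borel"
  shows "(\<integral>\<^sup>+x. f x \<partial>l\<Lambda>) = (\<integral>\<^sup>+x. indicator \<Lambda> x * f x \<partial>l)"
  unfolding l\<Lambda>_def by (rule nn_integral_density) measurable

lemma AE_l\<Lambda>: "AE x in l\<Lambda>. x \<in> \<Lambda>"
  unfolding l\<Lambda>_def by (subst AE_density) (auto simp: indicator_def)

lemma conf_pts: "AE \<omega> in P. \<Phi> \<omega> = conf (points_in \<Lambda> (\<Phi> \<omega>))"
proof -
  have "AE \<omega> in P. emeasure (\<Phi> \<omega>) (- \<Lambda>) = 0"
    using \<Phi>_on by (simp add: point_process_on_def)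
  then show ?thesis using AE_space
  proof eventually_elim
    case (elim \<omega>)
    then have "\<Phi> \<omega> \<in> configs" using measurable_space[OF \<Phi>_measurable] by simp
    then show ?case using conf_points_in[OF \<Lambda> _ elim(1)] by simp
  qed
qed

text \<open>The test functions of \<open>papangelou_intensity\<close> are real-valued on
  configurations. The bound by 1 permits the passage from extended values, and composing with
  \<open>points_in \<Lambda>\<close> turns a function of multisets into one of
  configurations.\<close>

lemma gnz_Q:
  assumes u [measurable]: "(\<lambda>(x, \<psi>). u x \<psi>) \<in> borel_measurable (borel \<Otimes>\<^sub>M multiset_space)"
    and u1: "\<And>x \<psi>. u x \<psi> \<le> 1"
  shows "(\<integral>\<^sup>+\<phi>. point_sum u \<phi> \<partial>Q) = (\<integral>\<^sup>+x. (\<integral>\<^sup>+\<phi>. ennreal (cm x \<phi>) * u x \<phi> \<partial>Q) \<partial>l\<Lambda>)"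
proof -
  let ?X = "\<lambda>\<omega>. points_in \<Lambda> (\<Phi> \<omega>)"
  \<comment> \<open>The factor \<open>indicator \<Lambda> x\<close> restricts the right side to
    \<open>l\<Lambda>\<close>; on the left it changes nothing, since almost surely all points lie in
    \<open>\<Lambda>\<close>.\<close>
  define v :: "'a \<Rightarrow> 'a measure \<Rightarrow> real" where "v x \<phi> = indicator \<Lambda> x * enn2real (u x (points_in \<Lambda> \<phi>))" for x \<phi>
  have fin: "ennreal (enn2real (u x \<psi>)) = u x \<psi>" for x \<psi>
    using u1[of x \<psi>] by (intro ennreal_enn2real) (auto simp: top.not_eq_extremum[symmetric] top_unique)
  have "(\<lambda>(x, \<phi>). v x \<phi>) \<in> borel_measurable (borel \<Otimes>\<^sub>M config_space)"
    unfolding v_def by measurable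
  moreover have "\<forall>x. \<forall>\<phi>\<in>configs. 0 \<le> v x \<phi>" by (simp add: v_def)
  ultimately have main: "(\<integral>\<^sup>+\<omega>. (\<integral>\<^sup>+x. ennreal (v x (remove_point (\<Phi> \<omega>) x)) \<partial>\<Phi> \<omega>) \<partial>P)
          = (\<integral>\<^sup>+x. (\<integral>\<^sup>+\<omega>. ennreal (c x (\<Phi> \<omega>) * v x (\<Phi> \<omega>)) \<partial>P) \<partial>l)"
    using c unfolding papangelou_intensity_def by blast
  have "(\<integral>\<^sup>+\<omega>. (\<integral>\<^sup>+x. ennreal (v x (remove_point (\<Phi> \<omega>) x)) \<partial>\<Phi> \<omega>) \<partial>P) = (\<integral>\<^sup>+\<omega>. point_sum u (?X \<omega>) \<partial>P)"
  proof (rule nn_integral_cong_AE)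
    show "AE \<omega> in P. (\<integral>\<^sup>+x. ennreal (v x (remove_point (\<Phi> \<omega>) x)) \<partial>\<Phi> \<omega>) = point_sum u (?X \<omega>)"
      using conf_pts AE_space
    proof eventually_elim
      case (elim \<omega>)
      let ?\<psi> = "?X \<omega>"
      have "\<Phi> \<omega> \<in> configs" using measurable_space[OF \<Phi>_measurable elim(2)] by simp
      then have sub: "set_mset ?\<psi> \<subseteq> \<Lambda>" by (rule set_points_in[OF \<Lambda>])
      have "(\<integral>\<^sup>+x. ennreal (v x (remove_point (conf ?\<psi>) x)) \<partial>conf ?\<psi>) =
        (\<Sum>x\<in>#?\<psi>. ennreal (v x (remove_point (conf ?\<psi>) x)))"
        by (rule nn_integral_conf)
      also have "\<dots> = point_sum u ?\<psi>"
        unfolding point_sum_def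
      proof (rule sum_mset_cong_ennreal)
        fix x assume x: "x \<in># ?\<psi>"
        have "set_mset (?\<psi> - {#x#}) \<subseteq> \<Lambda>" using sub by (meson in_diffD subset_iff)
        then show "ennreal (v x (remove_point (conf ?\<psi>) x)) = u x (?\<psi> - {#x#})"
          using x sub by (auto simp: v_def conf_remove_point points_in_conf[OF \<Lambda>] fin)
      qed
      finally show ?case using elim(1) by simp
    qed
  qed
  also have "\<dots> = (\<integral>\<^sup>+\<phi>. point_sum u \<phi> \<partial>Q)"
    unfolding Q_def by (subst nn_integral_distr) (auto intro!: measurable_point_sum u)
  finally have 1: "(\<integral>\<^sup>+\<omega>. (\<integral>\<^sup>+x. ennreal (v x (remove_point (\<Phi> \<omega>) x)) \<partial>\<Phi> \<omega>) \<partial>P) = (\<integral>\<^sup>+\<phi>. point_sum u \<phi> \<partial>Q)" .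
  have 2: "(\<integral>\<^sup>+\<omega>. ennreal (c x (\<Phi> \<omega>) * v x (\<Phi> \<omega>)) \<partial>P) = indicator \<Lambda> x * (\<integral>\<^sup>+\<phi>. ennreal (cm x \<phi>) * u x \<phi> \<partial>Q)" for x
  proof -
    have "(\<integral>\<^sup>+\<omega>. ennreal (c x (\<Phi> \<omega>) * v x (\<Phi> \<omega>)) \<partial>P) =
      (\<integral>\<^sup>+\<omega>. indicator \<Lambda> x * (ennreal (cm x (?X \<omega>)) * u x (?X \<omega>)) \<partial>P)"
    proof (rule nn_integral_cong_AE)
      show "AE \<omega> in P. ennreal (c x (\<Phi> \<omega>) * v x (\<Phi> \<omega>)) = indicator \<Lambda> x * (ennreal (cm x (?X \<omega>)) * u x (?X \<omega>))"
        using conf_pts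
      proof eventually_elim
        case (elim \<omega>)
        then have "c x (\<Phi> \<omega>) = cm x (?X \<omega>)" by (simp add: cm_def)
        then show ?case
          by (auto simp: v_def indicator_def ennreal_mult cm_nonneg fin)
      qed
    qed
    also have "\<dots> = (\<integral>\<^sup>+\<phi>. indicator \<Lambda> x * (ennreal (cm x \<phi>) * u x \<phi>) \<partial>Q)"
      unfolding Q_def by (subst nn_integral_distr) auto
    also have "\<dots> = indicator \<Lambda> x * (\<integral>\<^sup>+\<phi>. ennreal (cm x \<phi>) * u x \<phi> \<partial>Q)"
      by (rule nn_integral_cmult) measurable
    finally show ?thesis .
  qed
  show ?thesis
    using main unfolding 1 2 by (subst nn_integral_l\<Lambda>) auto
qed

lemma emeasure_density_l\<Lambda>:
  assumes [measurable]: "m \<in> borel_measurable borel" "A \<in> sets borel"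
  shows "emeasure (density l\<Lambda> m) A = emeasure (density l m) (A \<inter> \<Lambda>)"
proof -
  have "emeasure (density l\<Lambda> m) A = (\<integral>\<^sup>+x. m x * indicator A x \<partial>l\<Lambda>)"
    by (rule emeasure_density) measurable
  also have "\<dots> = (\<integral>\<^sup>+x. m x * indicator (A \<inter> \<Lambda>) x \<partial>l)"
    by (subst nn_integral_l\<Lambda>) (auto intro!: nn_integral_cong simp: indicator_def)
  finally show ?thesis by (simp add: emeasure_density)
qed

text \<open>Testing the equation with \<open>indicator A x\<close> alone gives the intensity
  measure, and densities with respect to the finite measure \<open>l\<Lambda>\<close> are unique
  almost everywhere.\<close>

lemma mean_cm:
  assumes m [measurable]: "m \<in> borel_measurable borel" and int: "has_intensity_measure P \<Phi> (density l m)"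
    and fin: "emeasure (density l m) \<Lambda> < \<infinity>"
  shows "AE x in l\<Lambda>. (\<integral>\<^sup>+\<phi>. ennreal (cm x \<phi>) \<partial>Q) = m x" and "(\<integral>\<^sup>+x. m x \<partial>l\<Lambda>) < \<infinity>"
proof -
  let ?m' = "\<lambda>x. \<integral>\<^sup>+\<phi>. ennreal (cm x \<phi>) \<partial>Q"
  note dens = emeasure_density_l\<Lambda>[OF m]
  show fin': "(\<integral>\<^sup>+x. m x \<partial>l\<Lambda>) < \<infinity>"
    using fin dens[of UNIV] by (simp add: emeasure_density)
  have "density l\<Lambda> ?m' = density l\<Lambda> m"
  proof (rule measure_eqI)
    fix A assume "A \<in> sets (density l\<Lambda> ?m')"
    then have A [measurable]: "A \<in> sets borel" by simp
    have "emeasure (density l\<Lambda> ?m') A = (\<integral>\<^sup>+x. (\<integral>\<^sup>+\<phi>. ennreal (cm x \<phi>) * indicator A x \<partial>Q) \<partial>l\<Lambda>)"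
      by (simp add: emeasure_density nn_integral_multc)
    also have "\<dots> = (\<integral>\<^sup>+\<phi>. point_sum (\<lambda>x _. indicator A x) \<phi> \<partial>Q)"
      by (rule gnz_Q[symmetric]) (auto simp: indicator_def)
    also have "\<dots> = (\<integral>\<^sup>+\<phi>. of_nat (npoints A \<phi>) \<partial>Q)"
      by (simp add: point_sum_def npoints_sum_mset)
    also have "\<dots> = (\<integral>\<^sup>+\<omega>. of_nat (npoints A (points_in \<Lambda> (\<Phi> \<omega>))) \<partial>P)"
      unfolding Q_def by (subst nn_integral_distr) (auto intro: measurable_compose[OF measurable_npoints])
    also have "\<dots> = (\<integral>\<^sup>+\<omega>. emeasure (\<Phi> \<omega>) (A \<inter> \<Lambda>) \<partial>P)"
    proof (rule nn_integral_cong)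
      fix \<omega> assume "\<omega> \<in> space P"
      then have "\<Phi> \<omega> \<in> configs" using measurable_space[OF \<Phi>_measurable] by simp
      then show "of_nat (npoints A (points_in \<Lambda> (\<Phi> \<omega>))) = emeasure (\<Phi> \<omega>) (A \<inter> \<Lambda>)"
        by (rule npoints_points_in[OF \<Lambda> _ A])
    qed
    also have "\<dots> = emeasure (density l m) (A \<inter> \<Lambda>)"
      using int by (simp add: has_intensity_measure_def)
    also have "\<dots> = emeasure (density l\<Lambda> m) A" by (simp add: dens)
    finally show "emeasure (density l\<Lambda> ?m') A = emeasure (density l\<Lambda> m) A" .
  qed simp
  then show "AE x in l\<Lambda>. ?m' x = m x"
    by (subst l\<Lambda>.density_unique_iff[symmetric]) auto
qed

end

text \<open>The Leibniz rule for finitely many summands: \<open>Y k\<close> loses the point, and all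
  others enter as an additive parameter.\<close>

lemma point_sum_sum:
  assumes "finite S"
  shows "point_sum u (\<Sum>k\<in>S. Y k) = (\<Sum>k\<in>S. point_sum (\<lambda>x \<psi>. u x (\<psi> + (\<Sum>i\<in>S - {k}. Y i))) (Y k))"
  using assms
proof (induction S arbitrary: u)
  case (insert j S)
  let ?W = "\<Sum>i\<in>S. Y i"
  have "point_sum u (\<Sum>k\<in>insert j S. Y k) =
     point_sum (\<lambda>x \<psi>. u x (\<psi> + ?W)) (Y j) + point_sum (\<lambda>x \<psi>. u x (Y j + \<psi>)) ?W"
    using insert by (simp add: point_sum_plus)
  also have "point_sum (\<lambda>x \<psi>. u x (Y j + \<psi>)) ?W =
     (\<Sum>k\<in>S. point_sum (\<lambda>x \<psi>. u x (Y j + (\<psi> + (\<Sum>i\<in>S - {k}. Y i)))) (Y k))"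
    by (rule insert.IH)
  also have "\<dots> = (\<Sum>k\<in>S. point_sum (\<lambda>x \<psi>. u x (\<psi> + (\<Sum>i\<in>insert j S - {k}. Y i))) (Y k))"
  proof (rule sum.cong[OF refl])
    fix k assume "k \<in> S"
    then have "insert j S - {k} = insert j (S - {k})" using insert by auto
    then have "(\<Sum>i\<in>insert j S - {k}. Y i) = Y j + (\<Sum>i\<in>S - {k}. Y i)" using insert by simp
    then show "point_sum (\<lambda>x \<psi>. u x (Y j + (\<psi> + (\<Sum>i\<in>S - {k}. Y i)))) (Y k) =
      point_sum (\<lambda>x \<psi>. u x (\<psi> + (\<Sum>i\<in>insert j S - {k}. Y i))) (Y k)"
      by (simp add: ac_simps)
  qed
  finally show ?case using insert by (simp add: insert_Diff_if)
qed simp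

lemma measurable_sum_mset_space [measurable (raw)]:
  assumes "\<And>i. i \<in> S \<Longrightarrow> Y i \<in> N \<rightarrow>\<^sub>M multiset_space"
  shows "(\<lambda>\<omega>. \<Sum>i\<in>S. Y i \<omega>) \<in> N \<rightarrow>\<^sub>M multiset_space"
proof (cases "finite S")
  case True
  then show ?thesis using assms
  proof (induction S)
    case (insert i S)
    then have [measurable]: "Y i \<in> N \<rightarrow>\<^sub>M multiset_space" "(\<lambda>\<omega>. \<Sum>i\<in>S. Y i \<omega>) \<in> N \<rightarrow>\<^sub>M multiset_space" by auto
    show ?case using insert by simp
  qed simp
qed simp

context compact_papangelou
begin

text \<open>Each point of the superposition comes from one copy \<open>k\<close>.
  \<open>point_sum_thin\<close> gives the factor \<open>p\<close> and \<open>gnz_Q\<close> the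
  intensity at the unthinned \<open>X k\<close>, while the other copies are independent and act as a
  parameter \<open>r\<close>. Since \<open>gnz_Q\<close> replaces the reduced configuration by the
  full one, the test function finally sees the whole superposition.\<close>

lemma gnz_thinned_superposition:
  fixes R :: "'z measure" and X Y :: "'i \<Rightarrow> 'z \<Rightarrow> 'a multiset"
  assumes R: "prob_space R" and S: "finite S" and p: "0 \<le> p" "p \<le> 1"
    and indep: "prob_space.indep_vars R (\<lambda>_. multiset_space \<Otimes>\<^sub>M multiset_space) (\<lambda>k \<omega>. (X k \<omega>, Y k \<omega>)) S"
    and law: "\<And>k. k \<in> S \<Longrightarrow> distr R (multiset_space \<Otimes>\<^sub>M multiset_space) (\<lambda>\<omega>. (X k \<omega>, Y k \<omega>)) = thin_joint p Q"
    and u [measurable]: "(\<lambda>(x, \<psi>). u x \<psi>) \<in> borel_measurable (borel \<Otimes>\<^sub>M multiset_space)"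
    and u1: "\<And>x \<psi>. u x \<psi> \<le> 1"
  shows "(\<integral>\<^sup>+\<omega>. point_sum u (\<Sum>k\<in>S. Y k \<omega>) \<partial>R) =
    (\<integral>\<^sup>+x. (\<integral>\<^sup>+\<omega>. (ennreal p * (\<Sum>k\<in>S. ennreal (cm x (X k \<omega>)))) * u x (\<Sum>k\<in>S. Y k \<omega>) \<partial>R) \<partial>l\<Lambda>)"
proof -
  interpret R: prob_space R by fact
  let ?MM = "multiset_space \<Otimes>\<^sub>M multiset_space :: ('a multiset \<times> 'a multiset) measure"
  have XY: "(\<lambda>\<omega>. (X k \<omega>, Y k \<omega>)) \<in> R \<rightarrow>\<^sub>M ?MM" if "k \<in> S" for k
    using indep that unfolding R.indep_vars_def by blast
  have X: "X k \<in> R \<rightarrow>\<^sub>M multiset_space" and Y: "Y k \<in> R \<rightarrow>\<^sub>M multiset_space" if "k \<in> S" for k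
    using measurable_compose[OF XY[OF that] measurable_fst] measurable_compose[OF XY[OF that] measurable_snd] by auto
  let ?W = "\<lambda>\<omega>. \<Sum>k\<in>S. Y k \<omega>" and ?V = "\<lambda>k \<omega>. \<Sum>i\<in>S - {k}. Y i \<omega>"
  have W [measurable]: "?W \<in> R \<rightarrow>\<^sub>M multiset_space" by (rule measurable_sum_mset_space) (rule Y)
  have V: "?V k \<in> R \<rightarrow>\<^sub>M multiset_space" for k by (rule measurable_sum_mset_space) (auto intro: Y)
  have prob_TJ: "prob_space (thin_joint p Q)" and sets_TJ [measurable_cong]: "sets (thin_joint p Q) = sets ?MM"
    by (auto intro: prob_space_thin_joint prob_space_Q simp: sets_thin_joint[OF prob_space_Q])
  have ps: "(\<lambda>(\<psi>, r). point_sum (\<lambda>x \<xi>. u x (\<xi> + r)) \<psi>) \<in> borel_measurable ?MM"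
    using measurable_point_sum_param[of "\<lambda>z. u (fst (fst z)) (snd (fst z) + snd z)" multiset_space] by simp
  have summand: "(\<integral>\<^sup>+\<omega>. point_sum (\<lambda>x \<xi>. u x (\<xi> + ?V k \<omega>)) (Y k \<omega>) \<partial>R) =
     ennreal p * (\<integral>\<^sup>+x. (\<integral>\<^sup>+\<omega>. ennreal (cm x (X k \<omega>)) * u x (?W \<omega>) \<partial>R) \<partial>l\<Lambda>)" if k: "k \<in> S" for k
  proof -
    note [measurable] = X[OF k] Y[OF k] V[of k] ps
    let ?\<rho> = "distr R multiset_space (?V k)"
    interpret \<rho>: prob_space ?\<rho> by (rule R.prob_space_distr) measurable
    interpret TJ: prob_space "thin_joint p Q" by fact
    interpret l\<rho>: pair_sigma_finite l\<Lambda> ?\<rho> ..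
    have "R.indep_var (PiM {k} (\<lambda>_. ?MM)) (\<lambda>\<omega>. restrict (\<lambda>i. (X i \<omega>, Y i \<omega>)) {k})
        (PiM (S - {k}) (\<lambda>_. ?MM)) (\<lambda>\<omega>. restrict (\<lambda>i. (X i \<omega>, Y i \<omega>)) (S - {k}))"
      by (rule R.indep_var_restrict[OF indep]) (use k in auto)
    \<comment> \<open>Both variables of \<open>indep_var\<close> must have the same type; the
      component \<open>{#}\<close> is a dummy that makes the sum of the other copies a pair.\<close>
    then have "R.indep_var ?MM ((\<lambda>f. f k) \<circ> (\<lambda>\<omega>. restrict (\<lambda>i. (X i \<omega>, Y i \<omega>)) {k}))
        ?MM ((\<lambda>f. ({#}, \<Sum>i\<in>S - {k}. snd (f i))) \<circ> (\<lambda>\<omega>. restrict (\<lambda>i. (X i \<omega>, Y i \<omega>)) (S - {k})))"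
      by (rule R.indep_var_compose)
         (auto intro!: measurable_Pair measurable_sum_mset_space measurable_compose[OF _ measurable_snd])
    also have "((\<lambda>f. f k) \<circ> (\<lambda>\<omega>. restrict (\<lambda>i. (X i \<omega>, Y i \<omega>)) {k})) = (\<lambda>\<omega>. (X k \<omega>, Y k \<omega>))"
      by auto
    also have "((\<lambda>f. ({#}, \<Sum>i\<in>S - {k}. snd (f i))) \<circ> (\<lambda>\<omega>. restrict (\<lambda>i. (X i \<omega>, Y i \<omega>)) (S - {k}))) =
        (\<lambda>\<omega>. ({#}, ?V k \<omega>))"
      by (auto simp: fun_eq_iff intro!: sum.cong)
    finally have dist: "distr R (?MM \<Otimes>\<^sub>M ?MM) (\<lambda>\<omega>. ((X k \<omega>, Y k \<omega>), ({#}, ?V k \<omega>))) =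
        thin_joint p Q \<Otimes>\<^sub>M distr R ?MM (\<lambda>\<omega>. ({#}, ?V k \<omega>))"
      using law[OF k] by (auto simp: R.indep_var_distribution_eq)
    have joint: "(\<integral>\<^sup>+\<omega>. F ((X k \<omega>, Y k \<omega>), ?V k \<omega>) \<partial>R) = (\<integral>\<^sup>+r. (\<integral>\<^sup>+z. F (z, r) \<partial>thin_joint p Q) \<partial>?\<rho>)"
      if [measurable]: "F \<in> borel_measurable (?MM \<Otimes>\<^sub>M multiset_space)" for F
    proof -
      let ?\<rho>' = "distr R ?MM (\<lambda>\<omega>. ({#}, ?V k \<omega>))"
      interpret \<rho>': prob_space ?\<rho>' by (rule R.prob_space_distr) measurable
      interpret TJ\<rho>: pair_sigma_finite "thin_joint p Q" ?\<rho>' ..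
      have "(\<integral>\<^sup>+\<omega>. F ((X k \<omega>, Y k \<omega>), ?V k \<omega>) \<partial>R) =
        (\<integral>\<^sup>+y. F (fst y, snd (snd y)) \<partial>(thin_joint p Q \<Otimes>\<^sub>M ?\<rho>'))"
        unfolding dist[symmetric] by (subst nn_integral_distr) auto
      also have "\<dots> = (\<integral>\<^sup>+w. (\<integral>\<^sup>+z. F (z, snd w) \<partial>thin_joint p Q) \<partial>?\<rho>')"
        by (subst TJ\<rho>.nn_integral_snd[symmetric]) auto
      also have "\<dots> = (\<integral>\<^sup>+\<omega>. (\<integral>\<^sup>+z. F (z, ?V k \<omega>) \<partial>thin_joint p Q) \<partial>R)"
        by (subst nn_integral_distr) auto
      also have "\<dots> = (\<integral>\<^sup>+r. (\<integral>\<^sup>+z. F (z, r) \<partial>thin_joint p Q) \<partial>?\<rho>)"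
        by (subst nn_integral_distr) auto
      finally show ?thesis .
    qed
    have inner: "(\<integral>\<^sup>+z. point_sum (\<lambda>x \<xi>. u x (\<xi> + r)) (snd z) \<partial>thin_joint p Q) =
      ennreal p * (\<integral>\<^sup>+x. (\<integral>\<^sup>+z. ennreal (cm x (fst z)) * u x (snd z + r) \<partial>thin_joint p Q) \<partial>l\<Lambda>)" for r
    proof -
      \<comment> \<open>Averaging the test function over the thinning keeps it below 1, so
        \<open>gnz_Q\<close> applies to it.\<close>
      let ?u = "\<lambda>x \<phi>. \<integral>\<^sup>+\<psi>. u x (\<psi> + r) \<partial>thin_law p \<phi>"
      have um [measurable]: "(\<lambda>(x, \<phi>). ?u x \<phi>) \<in> borel_measurable (borel \<Otimes>\<^sub>M multiset_space)"
        unfolding split_beta'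
        by (rule nn_integral_measurable_subprob_algebra2[where N = multiset_space])
           (measurable, rule measurable_prob_algebraD, measurable)
      have u1': "?u x \<phi> \<le> 1" for x \<phi>
      proof -
        have "?u x \<phi> \<le> (\<integral>\<^sup>+\<psi>. 1 \<partial>thin_law p \<phi>)" by (intro nn_integral_mono u1)
        also have "\<dots> = 1" using prob_space.emeasure_space_1[OF prob_space_thin_law] by simp
        finally show ?thesis .
      qed
      have psr [measurable]: "point_sum (\<lambda>x \<xi>. u x (\<xi> + r)) \<in> borel_measurable multiset_space"
        by (rule measurable_point_sum) measurable
      have "(\<integral>\<^sup>+z. point_sum (\<lambda>x \<xi>. u x (\<xi> + r)) (snd z) \<partial>thin_joint p Q) =
        (\<integral>\<^sup>+\<phi>. (\<integral>\<^sup>+\<psi>. point_sum (\<lambda>x \<xi>. u x (\<xi> + r)) \<psi> \<partial>thin_law p \<phi>) \<partial>Q)"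
        by (subst nn_integral_thin_joint[OF prob_space_Q]) auto
      also have "\<dots> = (\<integral>\<^sup>+\<phi>. ennreal p * point_sum ?u \<phi> \<partial>Q)"
        by (intro nn_integral_cong) (simp add: nn_integral_thin_law point_sum_thin[OF p])
      also have "\<dots> = ennreal p * (\<integral>\<^sup>+\<phi>. point_sum ?u \<phi> \<partial>Q)"
        using measurable_point_sum[OF um] by (intro nn_integral_cmult) (simp cong: measurable_cong_sets)
      also have "(\<integral>\<^sup>+\<phi>. point_sum ?u \<phi> \<partial>Q) = (\<integral>\<^sup>+x. (\<integral>\<^sup>+\<phi>. ennreal (cm x \<phi>) * ?u x \<phi> \<partial>Q) \<partial>l\<Lambda>)"
        by (rule gnz_Q[OF um u1'])
      also have "\<dots> = (\<integral>\<^sup>+x. (\<integral>\<^sup>+z. ennreal (cm x (fst z)) * u x (snd z + r) \<partial>thin_joint p Q) \<partial>l\<Lambda>)"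
        by (intro nn_integral_cong, subst nn_integral_thin_joint[OF prob_space_Q])
           (auto intro!: nn_integral_cong simp: nn_integral_cmult)
      finally show ?thesis .
    qed
    have Wk: "?W \<omega> = Y k \<omega> + ?V k \<omega>" for \<omega>
      using k S by (simp add: sum.remove)
    have "(\<integral>\<^sup>+\<omega>. point_sum (\<lambda>x \<xi>. u x (\<xi> + ?V k \<omega>)) (Y k \<omega>) \<partial>R) =
      (\<integral>\<^sup>+r. (\<integral>\<^sup>+z. point_sum (\<lambda>x \<xi>. u x (\<xi> + r)) (snd z) \<partial>thin_joint p Q) \<partial>?\<rho>)"
      using joint[of "\<lambda>y. point_sum (\<lambda>x \<xi>. u x (\<xi> + snd y)) (snd (fst y))"]
        measurable_compose[OF _ ps, of "\<lambda>y. (snd (fst y), snd y)" "?MM \<Otimes>\<^sub>M multiset_space"] by simp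
    also have "\<dots> = (\<integral>\<^sup>+r. ennreal p * (\<integral>\<^sup>+x. (\<integral>\<^sup>+z. ennreal (cm x (fst z)) * u x (snd z + r) \<partial>thin_joint p Q) \<partial>l\<Lambda>) \<partial>?\<rho>)"
      unfolding inner ..
    also have "\<dots> = ennreal p * (\<integral>\<^sup>+r. (\<integral>\<^sup>+x. (\<integral>\<^sup>+z. ennreal (cm x (fst z)) * u x (snd z + r) \<partial>thin_joint p Q) \<partial>l\<Lambda>) \<partial>?\<rho>)"
      by (rule nn_integral_cmult) measurable
    also have "(\<integral>\<^sup>+r. (\<integral>\<^sup>+x. (\<integral>\<^sup>+z. ennreal (cm x (fst z)) * u x (snd z + r) \<partial>thin_joint p Q) \<partial>l\<Lambda>) \<partial>?\<rho>) =
      (\<integral>\<^sup>+x. (\<integral>\<^sup>+r. (\<integral>\<^sup>+z. ennreal (cm x (fst z)) * u x (snd z + r) \<partial>thin_joint p Q) \<partial>?\<rho>) \<partial>l\<Lambda>)"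
      by (rule l\<rho>.Fubini') measurable
    also have "\<dots> = (\<integral>\<^sup>+x. (\<integral>\<^sup>+\<omega>. ennreal (cm x (X k \<omega>)) * u x (?W \<omega>) \<partial>R) \<partial>l\<Lambda>)"
    proof (rule nn_integral_cong)
      fix x
      show "(\<integral>\<^sup>+r. (\<integral>\<^sup>+z. ennreal (cm x (fst z)) * u x (snd z + r) \<partial>thin_joint p Q) \<partial>?\<rho>) =
        (\<integral>\<^sup>+\<omega>. ennreal (cm x (X k \<omega>)) * u x (?W \<omega>) \<partial>R)"
        using joint[of "\<lambda>y. ennreal (cm x (fst (fst y))) * u x (snd (fst y) + snd y)"] by (simp add: Wk)
    qed
    finally show ?thesis .
  qed
  have meas1: "(\<lambda>\<omega>. point_sum (\<lambda>x \<xi>. u x (\<xi> + ?V k \<omega>)) (Y k \<omega>)) \<in> borel_measurable R" if "k \<in> S" for k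
    using measurable_compose[OF _ ps, of "\<lambda>\<omega>. (Y k \<omega>, ?V k \<omega>)" R] Y[OF that] V[of k] by simp
  have meas2: "(\<lambda>(x, \<omega>). ennreal (cm x (X k \<omega>)) * u x (?W \<omega>)) \<in> borel_measurable (borel \<Otimes>\<^sub>M R)" if "k \<in> S" for k
  proof -
    note [measurable] = X[OF that]
    show ?thesis by measurable
  qed
  have meas3 [measurable]: "(\<lambda>(x, \<omega>). \<Sum>k\<in>S. ennreal (cm x (X k \<omega>)) * u x (?W \<omega>)) \<in> borel_measurable (borel \<Otimes>\<^sub>M R)"
    using borel_measurable_sum[of S "\<lambda>k (x, \<omega>). ennreal (cm x (X k \<omega>)) * u x (?W \<omega>)", OF meas2]
    by (simp add: split_beta')
  have meas4: "(\<lambda>x. \<integral>\<^sup>+\<omega>. ennreal (cm x (X k \<omega>)) * u x (?W \<omega>) \<partial>R) \<in> borel_measurable l\<Lambda>"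
    and meas5: "(\<lambda>\<omega>. ennreal (cm x (X k \<omega>)) * u x (?W \<omega>)) \<in> borel_measurable R" if "k \<in> S" for k x
  proof -
    note [measurable] = X[OF that]
    show "(\<lambda>x. \<integral>\<^sup>+\<omega>. ennreal (cm x (X k \<omega>)) * u x (?W \<omega>) \<partial>R) \<in> borel_measurable l\<Lambda>"
      "(\<lambda>\<omega>. ennreal (cm x (X k \<omega>)) * u x (?W \<omega>)) \<in> borel_measurable R"
      by measurable
  qed
  have "(\<integral>\<^sup>+\<omega>. point_sum u (?W \<omega>) \<partial>R) =
    (\<Sum>k\<in>S. (\<integral>\<^sup>+\<omega>. point_sum (\<lambda>x \<xi>. u x (\<xi> + ?V k \<omega>)) (Y k \<omega>) \<partial>R))"
    unfolding point_sum_sum[OF S] by (rule nn_integral_sum) (rule meas1)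
  also have "\<dots> = (\<Sum>k\<in>S. ennreal p * (\<integral>\<^sup>+x. (\<integral>\<^sup>+\<omega>. ennreal (cm x (X k \<omega>)) * u x (?W \<omega>) \<partial>R) \<partial>l\<Lambda>))"
    by (intro sum.cong refl summand)
  also have "\<dots> = ennreal p * (\<integral>\<^sup>+x. (\<Sum>k\<in>S. \<integral>\<^sup>+\<omega>. ennreal (cm x (X k \<omega>)) * u x (?W \<omega>) \<partial>R) \<partial>l\<Lambda>)"
    unfolding sum_distrib_left[symmetric]
    by (intro arg_cong2[where f = times] refl nn_integral_sum[symmetric] meas4)
  also have "\<dots> = ennreal p * (\<integral>\<^sup>+x. (\<integral>\<^sup>+\<omega>. (\<Sum>k\<in>S. ennreal (cm x (X k \<omega>)) * u x (?W \<omega>)) \<partial>R) \<partial>l\<Lambda>)"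
    by (intro arg_cong2[where f = times] refl nn_integral_cong nn_integral_sum[symmetric] meas5)
  also have "\<dots> = (\<integral>\<^sup>+x. ennreal p * (\<integral>\<^sup>+\<omega>. (\<Sum>k\<in>S. ennreal (cm x (X k \<omega>)) * u x (?W \<omega>)) \<partial>R) \<partial>l\<Lambda>)"
    by (rule nn_integral_cmult[symmetric]) measurable
  also have "\<dots> = (\<integral>\<^sup>+x. (\<integral>\<^sup>+\<omega>. ennreal p * (\<Sum>k\<in>S. ennreal (cm x (X k \<omega>)) * u x (?W \<omega>)) \<partial>R) \<partial>l\<Lambda>)"
    by (intro nn_integral_cong nn_integral_cmult[symmetric]) measurable
  also have "\<dots> = (\<integral>\<^sup>+x. (\<integral>\<^sup>+\<omega>. (ennreal p * (\<Sum>k\<in>S. ennreal (cm x (X k \<omega>)))) * u x (?W \<omega>) \<partial>R) \<partial>l\<Lambda>)"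
    by (simp add: sum_distrib_right mult.assoc)
  finally show ?thesis .
qed

end

section \<open>Variance bound and the Poisson process\<close>

text \<open>Independence and zero means kill the cross terms, so second moments add.\<close>

lemma (in prob_space) second_moment_sum_indep:
  fixes Z :: "'i \<Rightarrow> 'a \<Rightarrow> real"
  assumes S: "finite S" and ind: "indep_vars (\<lambda>_. borel) Z S"
    and sq: "\<And>k. k \<in> S \<Longrightarrow> integrable M (\<lambda>\<omega>. (Z k \<omega>)\<^sup>2)"
    and mean: "\<And>k. k \<in> S \<Longrightarrow> expectation (Z k) = 0"
  shows "integrable M (\<lambda>\<omega>. (\<Sum>k\<in>S. Z k \<omega>)\<^sup>2)"
    and "expectation (\<lambda>\<omega>. (\<Sum>k\<in>S. Z k \<omega>)\<^sup>2) = (\<Sum>k\<in>S. expectation (\<lambda>\<omega>. (Z k \<omega>)\<^sup>2))"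
proof -
  have rv [measurable]: "random_variable borel (Z k)" if "k \<in> S" for k
    using ind that unfolding indep_vars_def by auto
  have int: "integrable M (Z k)" if "k \<in> S" for k
    using square_integrable_imp_integrable[OF rv[OF that] sq[OF that]] .
  have prod: "integrable M (\<lambda>\<omega>. Z k \<omega> * Z j \<omega>)" "expectation (\<lambda>\<omega>. Z k \<omega> * Z j \<omega>) =
      (if k = j then expectation (\<lambda>\<omega>. (Z k \<omega>)\<^sup>2) else 0)" if "k \<in> S" "j \<in> S" for k j
  proof -
    have "integrable M (\<lambda>\<omega>. Z k \<omega> * Z j \<omega>) \<and> (k \<noteq> j \<longrightarrow> expectation (\<lambda>\<omega>. Z k \<omega> * Z j \<omega>) = 0)"
    proof (cases "k = j")
      case True
      then show ?thesis using sq[OF that(1)] by (simp add: power2_eq_square)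
    next
      case False
      then have "indep_var (PiM {k} (\<lambda>_. borel)) (\<lambda>\<omega>. restrict (\<lambda>i. Z i \<omega>) {k})
          (PiM {j} (\<lambda>_. borel)) (\<lambda>\<omega>. restrict (\<lambda>i. Z i \<omega>) {j})"
        using that by (intro indep_var_restrict[OF ind]) auto
      then have "indep_var borel ((\<lambda>f. f k) \<circ> (\<lambda>\<omega>. restrict (\<lambda>i. Z i \<omega>) {k}))
          borel ((\<lambda>f. f j) \<circ> (\<lambda>\<omega>. restrict (\<lambda>i. Z i \<omega>) {j}))"
        by (rule indep_var_compose) auto
      then have "indep_var borel (Z k) borel (Z j)"
        by (simp add: comp_def)
      then show ?thesis
        using indep_var_lebesgue_integral[OF _ int[OF that(1)] int[OF that(2)]]
          indep_var_integrable[OF _ int[OF that(1)] int[OF that(2)]] mean that by simp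
    qed
    then show "integrable M (\<lambda>\<omega>. Z k \<omega> * Z j \<omega>)" "expectation (\<lambda>\<omega>. Z k \<omega> * Z j \<omega>) =
      (if k = j then expectation (\<lambda>\<omega>. (Z k \<omega>)\<^sup>2) else 0)"
      by (auto simp: power2_eq_square)
  qed
  have eq: "(\<Sum>k\<in>S. Z k \<omega>)\<^sup>2 = (\<Sum>k\<in>S. \<Sum>j\<in>S. Z k \<omega> * Z j \<omega>)" for \<omega>
    by (simp add: power2_eq_square sum_product)
  show "integrable M (\<lambda>\<omega>. (\<Sum>k\<in>S. Z k \<omega>)\<^sup>2)"
    unfolding eq by (intro Bochner_Integration.integrable_sum prod)
  have "expectation (\<lambda>\<omega>. (\<Sum>k\<in>S. Z k \<omega>)\<^sup>2) = (\<Sum>k\<in>S. \<Sum>j\<in>S. expectation (\<lambda>\<omega>. Z k \<omega> * Z j \<omega>))"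
    unfolding eq
    by (simp add: Bochner_Integration.integral_sum Bochner_Integration.integrable_sum prod(1))
  also have "\<dots> = (\<Sum>k\<in>S. expectation (\<lambda>\<omega>. (Z k \<omega>)\<^sup>2))"
    using S by (intro sum.cong refl) (simp add: prod(2))
  finally show "expectation (\<lambda>\<omega>. (\<Sum>k\<in>S. Z k \<omega>)\<^sup>2) = (\<Sum>k\<in>S. expectation (\<lambda>\<omega>. (Z k \<omega>)\<^sup>2))" .
qed

text \<open>The Cauchy-Schwarz inequality, read off from the fact that the variance of the absolute
  value is nonnegative.\<close>

lemma (in prob_space) expectation_abs_le_sqrt:
  fixes Z :: "'a \<Rightarrow> real"
  assumes [measurable]: "random_variable borel Z" and sq: "integrable M (\<lambda>\<omega>. (Z \<omega>)\<^sup>2)"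
    and V: "expectation (\<lambda>\<omega>. (Z \<omega>)\<^sup>2) \<le> V"
  shows "(\<integral>\<^sup>+\<omega>. ennreal \<bar>Z \<omega>\<bar> \<partial>M) \<le> ennreal (sqrt V)"
proof -
  have int: "integrable M Z" by (rule square_integrable_imp_integrable[OF _ sq]) measurable
  have "(expectation (\<lambda>\<omega>. \<bar>Z \<omega>\<bar>))\<^sup>2 \<le> expectation (\<lambda>\<omega>. \<bar>Z \<omega>\<bar>\<^sup>2)"
    using variance_positive[of "\<lambda>\<omega>. \<bar>Z \<omega>\<bar>"] variance_eq[of "\<lambda>\<omega>. \<bar>Z \<omega>\<bar>"] int sq by simp
  then have "(expectation (\<lambda>\<omega>. \<bar>Z \<omega>\<bar>))\<^sup>2 \<le> V" using V by simp
  then have "expectation (\<lambda>\<omega>. \<bar>Z \<omega>\<bar>) \<le> sqrt V" by (rule real_le_rsqrt)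
  then show ?thesis
    using int by (simp add: nn_integral_eq_integral ennreal_leI)
qed

lemma abs_diff_ennreal: "0 \<le> a \<Longrightarrow> 0 \<le> b \<Longrightarrow> abs_diff (ennreal a) (ennreal b) = ennreal \<bar>a - b\<bar>"
  by (cases "a \<le> b") (auto simp: abs_diff_def tdiff_def ennreal_minus)

context compact_papangelou
begin

lemma cm_moments:
  assumes sq: "integrable P (\<lambda>\<omega>. (c x (\<Phi> \<omega>))\<^sup>2)"
  shows "integrable Q (\<lambda>\<phi>. (cm x \<phi>)\<^sup>2)" and "integrable Q (cm x)"
    and "(\<integral>\<phi>. (cm x \<phi> - (\<integral>\<phi>. cm x \<phi> \<partial>Q))\<^sup>2 \<partial>Q) = P.variance (\<lambda>\<omega>. c x (\<Phi> \<omega>))"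
proof -
  let ?X = "\<lambda>\<omega>. points_in \<Lambda> (\<Phi> \<omega>)"
  have ae: "AE \<omega> in P. c x (\<Phi> \<omega>) = cm x (?X \<omega>)"
    using conf_pts by eventually_elim (simp add: cm_def)
  have [measurable]: "(\<lambda>\<omega>. c x (\<Phi> \<omega>)) \<in> borel_measurable P" by measurable
  show 1: "integrable Q (\<lambda>\<phi>. (cm x \<phi>)\<^sup>2)"
    unfolding Q_def
    by (subst integrable_distr_eq, measurable, rule Bochner_Integration.integrable_cong_AE_imp[OF sq])
       (use ae in auto)
  show "integrable Q (cm x)"
    by (rule Q.square_integrable_imp_integrable[OF _ 1]) measurable
  have tr: "(\<integral>\<phi>. f (cm x \<phi>) \<partial>Q) = (\<integral>\<omega>. f (c x (\<Phi> \<omega>)) \<partial>P)" if [measurable]: "f \<in> borel_measurable borel" for f :: "real \<Rightarrow> real"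
    unfolding Q_def
    by (subst integral_distr, measurable, rule integral_cong_AE) (use ae in auto)
  show "(\<integral>\<phi>. (cm x \<phi> - (\<integral>\<phi>. cm x \<phi> \<partial>Q))\<^sup>2 \<partial>Q) = P.variance (\<lambda>\<omega>. c x (\<Phi> \<omega>))"
    using tr[of "\<lambda>y. (y - (\<integral>\<phi>. cm x \<phi> \<partial>Q))\<^sup>2"] tr[of "\<lambda>y. y"] by simp
qed

text \<open>The average of \<open>n\<close> independent copies of \<open>cm x\<close> under
  \<open>Q\<close> has variance at most \<open>V / n\<close>, and the first absolute moment of its
  deviation is at most the square root of that. This is the origin of the factor
  \<open>1 / sqrt n\<close>.\<close>

lemma mean_deviation:
  fixes R :: "'z measure" and X :: "nat \<Rightarrow> 'z \<Rightarrow> 'a multiset"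
  assumes R: "prob_space R" and n: "1 \<le> n"
    and ind: "prob_space.indep_vars R (\<lambda>_. multiset_space) X {1..n}"
    and law: "\<And>k. k \<in> {1..n} \<Longrightarrow> distr R multiset_space (X k) = Q"
    and sq: "integrable P (\<lambda>\<omega>. (c x (\<Phi> \<omega>))\<^sup>2)" and var: "P.variance (\<lambda>\<omega>. c x (\<Phi> \<omega>)) \<le> V"
  shows "(\<integral>\<^sup>+\<omega>. abs_diff (ennreal (1 / real n) * (\<Sum>k\<in>{1..n}. ennreal (cm x (X k \<omega>)))) (\<integral>\<^sup>+\<phi>. ennreal (cm x \<phi>) \<partial>Q) \<partial>R)
    \<le> ennreal (1 / sqrt (real n)) * ennreal (sqrt V)"
proof -
  interpret R: prob_space R by fact
  have X: "X k \<in> R \<rightarrow>\<^sub>M multiset_space" if "k \<in> {1..n}" for k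
    using ind that unfolding R.indep_vars_def by blast
  define \<mu> where "\<mu> = (\<integral>\<phi>. cm x \<phi> \<partial>Q)"
  have \<mu>: "(\<integral>\<^sup>+\<phi>. ennreal (cm x \<phi>) \<partial>Q) = ennreal \<mu>" "0 \<le> \<mu>"
    unfolding \<mu>_def using cm_moments(2)[OF sq] by (auto simp: nn_integral_eq_integral cm_nonneg)
  \<comment> \<open>Division by \<open>n\<close> is built in, so that the sum over the copies is the
    deviation itself and each term has second moment at most \<open>V / n^2\<close>.\<close>
  define g where "g \<phi> = (cm x \<phi> - \<mu>) / real n" for \<phi>
  have [measurable]: "g \<in> borel_measurable multiset_space" unfolding g_def by measurable
  have Q_g: "integrable Q (\<lambda>\<phi>. (g \<phi>)\<^sup>2)" "(\<integral>\<phi>. g \<phi> \<partial>Q) = 0" "(\<integral>\<phi>. (g \<phi>)\<^sup>2 \<partial>Q) \<le> V / (real n)\<^sup>2"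
  proof -
    have e: "(cm x \<phi> - \<mu>)\<^sup>2 = (cm x \<phi>)\<^sup>2 - 2 * \<mu> * cm x \<phi> + \<mu>\<^sup>2" for \<phi>
      by (simp add: power2_diff)
    have "integrable Q (\<lambda>\<phi>. (cm x \<phi> - \<mu>)\<^sup>2)"
      unfolding e by (intro Bochner_Integration.integrable_add Bochner_Integration.integrable_diff integrable_mult_right
          cm_moments[OF sq]) simp
    then show "integrable Q (\<lambda>\<phi>. (g \<phi>)\<^sup>2)" by (simp add: g_def power_divide)
    show "(\<integral>\<phi>. g \<phi> \<partial>Q) = 0"
      using cm_moments(2)[OF sq] by (simp add: g_def \<mu>_def Q.prob_space)
    show "(\<integral>\<phi>. (g \<phi>)\<^sup>2 \<partial>Q) \<le> V / (real n)\<^sup>2"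
      using cm_moments(3)[OF sq] var by (simp add: g_def \<mu>_def power_divide divide_right_mono)
  qed
  have indg: "R.indep_vars (\<lambda>_. borel) (\<lambda>k \<omega>. g (X k \<omega>)) {1..n}"
    by (rule R.indep_vars_compose2[OF ind]) measurable
  have tr: "integrable R (\<lambda>\<omega>. f (X k \<omega>)) \<longleftrightarrow> integrable Q f" "(\<integral>\<omega>. f (X k \<omega>) \<partial>R) = (\<integral>\<phi>. f \<phi> \<partial>Q)"
    if "k \<in> {1..n}" "f \<in> borel_measurable multiset_space" for k and f :: "'a multiset \<Rightarrow> real"
    unfolding law[OF that(1), symmetric] using X[OF that(1)] that(2)
    by (auto simp: integrable_distr_eq integral_distr)
  let ?Z = "\<lambda>\<omega>. \<Sum>k\<in>{1..n}. g (X k \<omega>)"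
  have sq': "integrable R (\<lambda>\<omega>. (g (X k \<omega>))\<^sup>2)" "(\<integral>\<omega>. g (X k \<omega>) \<partial>R) = 0" "(\<integral>\<omega>. (g (X k \<omega>))\<^sup>2 \<partial>R) \<le> V / (real n)\<^sup>2"
    if "k \<in> {1..n}" for k
    using tr[OF that, of "\<lambda>\<phi>. (g \<phi>)\<^sup>2"] tr(2)[OF that, of g] Q_g by simp_all
  note Z2 = R.second_moment_sum_indep[OF _ indg sq'(1) sq'(2)]
  have "R.expectation (\<lambda>\<omega>. (?Z \<omega>)\<^sup>2) = (\<Sum>k\<in>{1..n}. R.expectation (\<lambda>\<omega>. (g (X k \<omega>))\<^sup>2))"
    by (rule Z2(2)) simp_all
  also have "\<dots> \<le> (\<Sum>k\<in>{1..n}. V / (real n)\<^sup>2)"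
    by (intro sum_mono sq'(3))
  also have "\<dots> = V / real n" using n by (simp add: power2_eq_square)
  finally have "(\<integral>\<^sup>+\<omega>. ennreal \<bar>?Z \<omega>\<bar> \<partial>R) \<le> ennreal (sqrt (V / real n))"
    using X by (intro R.expectation_abs_le_sqrt Z2(1)) (auto intro!: borel_measurable_sum)
  also have "\<dots> = ennreal (1 / sqrt (real n)) * ennreal (sqrt V)"
    by (simp add: real_sqrt_divide ennreal_mult'[symmetric])
  also have "(\<integral>\<^sup>+\<omega>. ennreal \<bar>?Z \<omega>\<bar> \<partial>R) =
    (\<integral>\<^sup>+\<omega>. abs_diff (ennreal (1 / real n) * (\<Sum>k\<in>{1..n}. ennreal (cm x (X k \<omega>)))) (ennreal \<mu>) \<partial>R)"
  proof (rule nn_integral_cong)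
    fix \<omega>
    let ?s = "\<Sum>k\<in>{1..n}. cm x (X k \<omega>)"
    have s: "0 \<le> ?s" by (intro sum_nonneg cm_nonneg)
    have "?Z \<omega> = (1 / real n) * ?s - \<mu>"
      using n by (simp add: g_def sum_subtractf diff_divide_distrib sum_divide_distrib[symmetric])
    moreover have "ennreal (1 / real n) * (\<Sum>k\<in>{1..n}. ennreal (cm x (X k \<omega>))) = ennreal ((1 / real n) * ?s)"
      unfolding sum_ennreal[OF cm_nonneg] by (rule ennreal_mult'[symmetric]) simp
    ultimately show "ennreal \<bar>?Z \<omega>\<bar> = abs_diff (ennreal (1 / real n) * (\<Sum>k\<in>{1..n}. ennreal (cm x (X k \<omega>)))) (ennreal \<mu>)"
      using s \<mu>(2) by (simp add: abs_diff_ennreal)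
  qed
  finally show ?thesis by (simp add: \<mu>)
qed

end

section \<open>From the Poisson process to the Poisson law of multisets\<close>

lemma poisson_process_null:
  assumes "poisson_process P \<zeta> M" "A \<in> rel_compact_borel" "emeasure M A = 0"
  shows "AE \<omega> in P. emeasure (\<zeta> \<omega>) A = 0"
proof -
  have \<zeta> [measurable]: "\<zeta> \<in> P \<rightarrow>\<^sub>M config_space" and "prob_space P"
    using assms by (auto simp: poisson_process_def point_process_def)
  interpret prob_space P by fact
  note [measurable] = measurable_config_eval[OF assms(2)]
  have "prob {\<omega> \<in> space P. emeasure (\<zeta> \<omega>) A = of_nat 0} = exp (- measure M A) * measure M A ^ 0 / fact 0"
    using assms unfolding poisson_process_def by blast
  then have "prob {\<omega> \<in> space P. emeasure (\<zeta> \<omega>) A = 0} = 1"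
    using assms(3) by (simp add: measure_def)
  then have "AE \<omega> in P. \<omega> \<in> {\<omega> \<in> space P. emeasure (\<zeta> \<omega>) A = 0}"
    by (subst (asm) prob_eq_1) auto
  then show ?thesis by eventually_elim simp
qed

text \<open>The cells of a labelling, intersected with \<open>L\<close>, are disjoint and relatively
  compact, so their counts are independent Poisson variables. Adding a label \<open>j\<close>
  changes one factor of the product formula, and the resulting recursion identifies the law by
  \<open>poisson_law_eqI\<close>.\<close>

lemma poisson_process_points_in:
  fixes M :: "'a::metric_space measure"
  assumes \<zeta>: "poisson_process P \<zeta> M" and L: "compact L"
    and M': "finite_measure M'" "sets M' = sets borel" "\<And>A. A \<in> sets borel \<Longrightarrow> emeasure M' A = emeasure M (A \<inter> L)"
  shows "poisson_law M' (distr P multiset_space (\<lambda>\<omega>. points_in L (\<zeta> \<omega>)))" (is "poisson_law M' ?Q")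
proof -
  have \<zeta>m [measurable]: "\<zeta> \<in> P \<rightarrow>\<^sub>M config_space" and "prob_space P"
    using \<zeta> by (auto simp: poisson_process_def point_process_def)
  interpret prob_space P by fact
  note [measurable] = measurable_points_in[OF L]
  have Lb [measurable]: "L \<in> sets borel" using L by (simp add: borel_closed compact_imp_closed)
  have rc: "A \<inter> L \<in> rel_compact_borel" if "A \<in> sets borel" for A
    using that L by (intro compact_rel_compact_borel[OF L]) auto
  have conf: "\<zeta> \<omega> \<in> configs" if "\<omega> \<in> space P" for \<omega>
    using measurable_space[OF \<zeta>m that] by simp
  have np: "npoints A (points_in L (\<zeta> \<omega>)) = k \<longleftrightarrow> emeasure (\<zeta> \<omega>) (A \<inter> L) = of_nat k"
    if "A \<in> sets borel" "\<omega> \<in> space P" for A \<omega> k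
    unfolding npoints_points_in[OF L conf[OF that(2)] that(1), symmetric] by simp
  define po where "po r k = exp (- r) * r ^ k / fact k" for r :: real and k :: nat
  have mM': "measure M' A = measure M (A \<inter> L)" if "A \<in> sets borel" for A
    using M'(3)[OF that] by (simp add: measure_def)
  have marg: "prob {\<omega> \<in> space P. emeasure (\<zeta> \<omega>) (A \<inter> L) = of_nat k} = po (measure M' A) k"
    if "A \<in> sets borel" for A k
    using \<zeta> rc[OF that] by (simp add: poisson_process_def mM'[OF that] po_def)
  obtain Q0 where Q0: "poisson_law M' Q0" using poisson_law_exists[OF M'(1,2)] by blast
  have "?Q = Q0"
  proof (rule poisson_law_eqI[OF Q0 M'(2)])
    show "prob_space ?Q" by (rule prob_space_distr) measurable
    have "emeasure ?Q {{#}} = emeasure P {\<omega> \<in> space P. emeasure (\<zeta> \<omega>) (UNIV \<inter> L) = of_nat 0}"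
    proof (subst emeasure_distr)
      have "(\<lambda>\<omega>. points_in L (\<zeta> \<omega>)) -` {{#}} \<inter> space P = {\<omega> \<in> space P. npoints UNIV (points_in L (\<zeta> \<omega>)) = 0}"
        by (auto simp: npoints_def)
      also have "\<dots> = {\<omega> \<in> space P. emeasure (\<zeta> \<omega>) (UNIV \<inter> L) = of_nat 0}"
        by (intro Collect_cong conj_cong refl np) auto
      finally show "emeasure P ((\<lambda>\<omega>. points_in L (\<zeta> \<omega>)) -` {{#}} \<inter> space P) =
        emeasure P {\<omega> \<in> space P. emeasure (\<zeta> \<omega>) (UNIV \<inter> L) = of_nat 0}" by simp
    qed auto
    also have "\<dots> = ennreal (exp (- measure M' UNIV))"
      using marg[of UNIV 0] by (simp add: emeasure_eq_measure po_def)
    finally show "emeasure ?Q {{#}} = ennreal (exp (- measure M' UNIV))" .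
  next
    fix f :: "'a \<Rightarrow> nat" and \<xi> j assume f: "labelling f"
    \<comment> \<open>\<open>j\<close> is included so that one index set serves both
      \<open>\<xi>\<close> and \<open>add_mset j \<xi>\<close>.\<close>
    let ?J = "range f \<union> set_mset \<xi> \<union> {j}" and ?A = "\<lambda>i. f -` {i}"
    have J: "finite ?J" using f by (simp add: labelling_def)
    have A: "?A i \<in> sets borel" for i
      using f measurable_sets[of f borel "count_space UNIV" "{i}"] by (simp add: labelling_def)
    have fam: "\<forall>(I::nat set) A. finite I \<and> A ` I \<subseteq> rel_compact_borel \<and> disjoint_family_on A I \<longrightarrow>
        indep_vars (\<lambda>_. borel) (\<lambda>i \<omega>. emeasure (\<zeta> \<omega>) (A i)) I"
      using \<zeta> unfolding poisson_process_def by blast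
    have disj: "disjoint_family_on (\<lambda>i. ?A i \<inter> L) ?J" by (auto simp: disjoint_family_on_def)
    have ind: "indep_vars (\<lambda>_. borel) (\<lambda>i \<omega>. emeasure (\<zeta> \<omega>) (?A i \<inter> L)) ?J"
      by (rule fam[rule_format, of ?J "\<lambda>i. ?A i \<inter> L"]) (use J disj rc A in blast)
    have prob: "emeasure ?Q (image_mset f -` {\<eta>}) = ennreal (\<Prod>i\<in>?J. po (measure M' (?A i)) (count \<eta> i))"
      if \<eta>: "set_mset \<eta> \<subseteq> ?J" for \<eta>
    proof -
      have [measurable]: "image_mset f -` {\<eta>} \<in> sets multiset_space"
        using measurable_sets[OF measurable_image_labelling[OF f], of "{\<eta>}"] by simp
      have iff: "image_mset f \<psi> = \<eta> \<longleftrightarrow> (\<forall>i\<in>?J. npoints (?A i) \<psi> = count \<eta> i)" for \<psi>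
        by (rule image_mset_eq_iff_npoints) (use \<eta> in blast)
      have "(\<lambda>\<omega>. points_in L (\<zeta> \<omega>)) -` (image_mset f -` {\<eta>}) \<inter> space P =
        (\<Inter>i\<in>?J. (\<lambda>\<omega>. emeasure (\<zeta> \<omega>) (?A i \<inter> L)) -` {of_nat (count \<eta> i)} \<inter> space P)"
      proof (rule set_eqI)
        fix \<omega>
        show "\<omega> \<in> (\<lambda>\<omega>. points_in L (\<zeta> \<omega>)) -` (image_mset f -` {\<eta>}) \<inter> space P \<longleftrightarrow>
          \<omega> \<in> (\<Inter>i\<in>?J. (\<lambda>\<omega>. emeasure (\<zeta> \<omega>) (?A i \<inter> L)) -` {of_nat (count \<eta> i)} \<inter> space P)"
        proof (cases "\<omega> \<in> space P")
          case True
          have "image_mset f (points_in L (\<zeta> \<omega>)) = \<eta> \<longleftrightarrow>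
            (\<forall>i\<in>?J. emeasure (\<zeta> \<omega>) (?A i \<inter> L) = of_nat (count \<eta> i))"
            unfolding iff by (intro ball_cong refl np A True)
          then show ?thesis using True by simp
        qed simp
      qed
      then have "emeasure ?Q (image_mset f -` {\<eta>}) =
        ennreal (prob (\<Inter>i\<in>?J. (\<lambda>\<omega>. emeasure (\<zeta> \<omega>) (?A i \<inter> L)) -` {of_nat (count \<eta> i)} \<inter> space P))"
        by (subst emeasure_distr) (auto simp: emeasure_eq_measure)
      also have "prob (\<Inter>i\<in>?J. (\<lambda>\<omega>. emeasure (\<zeta> \<omega>) (?A i \<inter> L)) -` {of_nat (count \<eta> i)} \<inter> space P) =
        (\<Prod>i\<in>?J. prob ((\<lambda>\<omega>. emeasure (\<zeta> \<omega>) (?A i \<inter> L)) -` {of_nat (count \<eta> i)} \<inter> space P))"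
        by (rule indep_varsD_finite[OF ind]) (use J in auto)
      also have "\<dots> = (\<Prod>i\<in>?J. po (measure M' (?A i)) (count \<eta> i))"
        using marg[OF A] by (intro prod.cong refl) (simp add: vimage_def Int_def conj_commute)
      finally show ?thesis .
    qed
    have po_Suc: "real (Suc k) * po r (Suc k) = r * po r k" for r k
      by (simp add: po_def field_simps del: of_nat_Suc)
    have po_nn: "0 \<le> po (measure M' A) k" for A k by (simp add: po_def)
    let ?pr = "\<Prod>i\<in>?J - {j}. po (measure M' (?A i)) (count \<xi> i)"
    have 1: "(\<Prod>i\<in>?J. po (measure M' (?A i)) (count (add_mset j \<xi>) i)) = po (measure M' (?A j)) (Suc (count \<xi> j)) * ?pr"
      using J by (subst prod.remove[of _ j]) (auto intro!: prod.cong)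
    have 2: "(\<Prod>i\<in>?J. po (measure M' (?A i)) (count \<xi> i)) = po (measure M' (?A j)) (count \<xi> j) * ?pr"
      using J by (subst prod.remove[of _ j]) auto
    have 3: "emeasure ?Q (image_mset f -` {add_mset j \<xi>}) = ennreal (po (measure M' (?A j)) (Suc (count \<xi> j)) * ?pr)"
      unfolding 1[symmetric] by (rule prob) auto
    have 4: "emeasure ?Q (image_mset f -` {\<xi>}) = ennreal (po (measure M' (?A j)) (count \<xi> j) * ?pr)"
      unfolding 2[symmetric] by (rule prob) auto
    have "of_nat (Suc (count \<xi> j)) * emeasure ?Q (image_mset f -` {add_mset j \<xi>}) =
      ennreal (real (Suc (count \<xi> j)) * (po (measure M' (?A j)) (Suc (count \<xi> j)) * ?pr))"
      unfolding ennreal_of_nat_eq_real_of_nat 3 by (rule ennreal_mult'[symmetric]) simp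
    also have "real (Suc (count \<xi> j)) * (po (measure M' (?A j)) (Suc (count \<xi> j)) * ?pr) =
      measure M' (?A j) * (po (measure M' (?A j)) (count \<xi> j) * ?pr)"
      using po_Suc[of "count \<xi> j" "measure M' (?A j)"] by (simp add: mult.assoc[symmetric] del: of_nat_Suc)
    also have "ennreal \<dots> = emeasure M' (?A j) * emeasure ?Q (image_mset f -` {\<xi>})"
      unfolding 4 finite_measure.emeasure_eq_measure[OF M'(1)] by (rule ennreal_mult') simp
    finally show "of_nat (Suc (count \<xi> j)) * emeasure ?Q (image_mset f -` {add_mset j \<xi>}) =
      emeasure M' (f -` {j}) * emeasure ?Q (image_mset f -` {\<xi>})" .
  qed simp
  then show ?thesis using Q0 by simp
qed

text \<open>A coupling of multisets is carried to configurations by applying \<open>conf\<close> in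
  both coordinates. Its cost does not increase, by the inequality for lower integrals under image
  measures.\<close>

lemma TV_star_law_distr_conf_le:
  fixes C :: "('a::metric_space multiset \<times> 'a multiset) measure"
  assumes C: "prob_space C" and [measurable_cong, simp]: "sets C = sets (multiset_space \<Otimes>\<^sub>M multiset_space)"
  shows "TV_star_law (distr (distr C multiset_space fst) config_space conf) (distr (distr C multiset_space snd) config_space conf)
    \<le> (\<integral>\<^sup>+w. TV_dist (conf (fst w)) (conf (snd w)) \<partial>C)"
proof -
  interpret C: prob_space C by fact
  let ?Q1 = "distr (distr C multiset_space fst) config_space conf"
  let ?Q2 = "distr (distr C multiset_space snd) config_space conf"
  let ?T = "\<lambda>w. (conf (fst w), conf (snd w))"
  have s: "sets (?Q1 \<Otimes>\<^sub>M ?Q2) = sets (config_space \<Otimes>\<^sub>M config_space)"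
    by (intro sets_pair_measure_cong) simp_all
  have T [measurable]: "?T \<in> C \<rightarrow>\<^sub>M config_space \<Otimes>\<^sub>M config_space" by measurable
  let ?D = "distr C (config_space \<Otimes>\<^sub>M config_space) ?T"
  have "?D \<in> couplings ?Q1 ?Q2"
    unfolding couplings_def
  proof (intro CollectI conjI)
    show "prob_space ?D" by (rule C.prob_space_distr[OF T])
    show "sets ?D = sets (?Q1 \<Otimes>\<^sub>M ?Q2)" by (simp add: s)
    have "distr ?D ?Q1 fst = distr ?D config_space fst" by (rule distr_cong) simp_all
    also have "\<dots> = ?Q1" by (simp add: distr_distr comp_def)
    finally show "distr ?D ?Q1 fst = ?Q1" .
    have "distr ?D ?Q2 snd = distr ?D config_space snd" by (rule distr_cong) simp_all
    also have "\<dots> = ?Q2" by (simp add: distr_distr comp_def)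
    finally show "distr ?D ?Q2 snd = ?Q2" .
  qed
  then have "TV_star_law ?Q1 ?Q2 \<le> (\<integral>\<^sup>+(\<omega>1, \<omega>2). TV_dist \<omega>1 \<omega>2 \<partial>?D)"
    unfolding TV_star_law_def by (rule INF_lower)
  also have "\<dots> \<le> (\<integral>\<^sup>+w. (case ?T w of (\<omega>1, \<omega>2) \<Rightarrow> TV_dist \<omega>1 \<omega>2) \<partial>C)"
    by (rule nn_integral_distr_le[OF T])
  finally show ?thesis by simp
qed

section \<open>The main estimate\<close>

theorem theorem5p11:
  fixes l :: "'a::metric_space measure"
    and \<Lambda> :: "'a set"
    and P :: "'w measure" and P' :: "'v measure" and P'' :: "'z measure"
    and \<Phi> :: "'w \<Rightarrow> 'a measure"
    and \<zeta> :: "'v \<Rightarrow> 'a measure"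
    and \<Phi>k \<Psi>k :: "nat \<Rightarrow> 'z \<Rightarrow> 'a measure"
    and c :: "'a \<Rightarrow> 'a measure \<Rightarrow> real"
    and m :: "'a \<Rightarrow> ennreal"
    and K :: "'a \<Rightarrow> real"
    and n :: nat
  assumes "locally_compact_space (euclidean :: 'a topology)"
    and "radon_measure l"
    and "compact \<Lambda>"
    and "point_process_on \<Lambda> P \<Phi>"
    and "papangelou_intensity l P \<Phi> c"
    and "m \<in> borel_measurable l"
    and "has_intensity_measure P \<Phi> (density l m)"
    and "poisson_process P' \<zeta> (density l m)"
    and "n \<ge> 1"
    and "prob_space P''"
    and copies: "\<And>k. k \<in> {1..n} \<Longrightarrow> distr P'' config_space (\<Phi>k k) = distr P config_space \<Phi>"
    and thinnings: "\<And>k. k \<in> {1..n} \<Longrightarrow> independent_thinning P'' (1 / real n) (\<Phi>k k) (\<Psi>k k)"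
    and independent: "prob_space.indep_vars P'' (\<lambda>_. config_space \<Otimes>\<^sub>M config_space)
           (\<lambda>k \<omega>. (\<Phi>k k \<omega>, \<Psi>k k \<omega>)) {1..n}"
    and "set_integrable l \<Lambda> K"
    and "\<And>x. x \<in> \<Lambda> \<Longrightarrow> 0 \<le> K x"
    and finite_variance: "\<And>x. x \<in> \<Lambda> \<Longrightarrow> integrable P (\<lambda>\<omega>. (c x (\<Phi> \<omega>))\<^sup>2)"
    and variance_le: "\<And>x. x \<in> \<Lambda> \<Longrightarrow> prob_space.variance P (\<lambda>\<omega>. c x (\<Phi> \<omega>)) \<le> K x"
  shows "TV_star P'' (\<lambda>\<omega>. superposition {1..n} (\<lambda>k. \<Psi>k k \<omega>)) P' \<zeta>
           \<le> ennreal (1 / sqrt (real n)) * (\<integral>\<^sup>+x\<in>\<Lambda>. ennreal (sqrt (K x)) \<partial>l)"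
proof -
  interpret cp: compact_papangelou l \<Lambda> P \<Phi> c
    by (rule compact_papangelou.intro) fact+
  interpret R: prob_space P'' by fact
  have p: "0 \<le> 1 / real n" "1 / real n \<le> 1" using \<open>n \<ge> 1\<close> by auto
  have L: "compact \<Lambda>" by fact
  have m [measurable]: "m \<in> borel_measurable borel"
    using \<open>m \<in> borel_measurable l\<close> by (simp cong: measurable_cong_sets)
  have radon: "radon_measure (density l m)" and \<zeta>_process: "point_process P' \<zeta>"
    using \<open>poisson_process P' \<zeta> (density l m)\<close> by (auto simp: poisson_process_def)
  interpret P': prob_space P' using \<zeta>_process by (simp add: point_process_def)
  have fin: "emeasure (density l m) \<Lambda> < \<infinity>" using radon L unfolding radon_measure_def by blast
  note mean = cp.mean_cm(1)[OF m \<open>has_intensity_measure P \<Phi> (density l m)\<close> fin]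
  note mass = cp.mean_cm(2)[OF m \<open>has_intensity_measure P \<Phi> (density l m)\<close> fin]
  have \<Phi>k [measurable]: "\<Phi>k k \<in> P'' \<rightarrow>\<^sub>M config_space" and \<Psi>k [measurable]: "\<Psi>k k \<in> P'' \<rightarrow>\<^sub>M config_space"
    if "k \<in> {1..n}" for k
    using thinnings[OF that] by (auto simp: independent_thinning_def point_process_def)
  have \<zeta>m [measurable]: "\<zeta> \<in> P' \<rightarrow>\<^sub>M config_space" using \<zeta>_process by (simp add: point_process_def)
  note pts [measurable] = measurable_points_in[OF L]

  define X Y where "X = (\<lambda>k \<omega>. points_in \<Lambda> (\<Phi>k k \<omega>))" and "Y = (\<lambda>k \<omega>. points_in \<Lambda> (\<Psi>k k \<omega>))"
  define W where "W = (\<lambda>\<omega>. \<Sum>k\<in>{1..n}. Y k \<omega>)"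
  define C where "C = (\<lambda>x \<omega>. ennreal (1 / real n) * (\<Sum>k\<in>{1..n}. ennreal (cp.cm x (X k \<omega>))))"
  define \<pi> where "\<pi> = distr P' multiset_space (\<lambda>\<omega>. points_in \<Lambda> (\<zeta> \<omega>))"
  have X [measurable]: "X k \<in> P'' \<rightarrow>\<^sub>M multiset_space" and Y [measurable]: "Y k \<in> P'' \<rightarrow>\<^sub>M multiset_space"
    if "k \<in> {1..n}" for k
    unfolding X_def Y_def using \<Phi>k[OF that] \<Psi>k[OF that] by (auto intro: measurable_compose[OF _ pts])
  have W [measurable]: "W \<in> P'' \<rightarrow>\<^sub>M multiset_space"
    unfolding W_def by (rule measurable_sum_mset_space) (rule Y)
  have lawX: "distr P'' multiset_space (X k) = cp.Q" if k: "k \<in> {1..n}" for k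
  proof -
    have "distr P'' multiset_space (X k) = distr (distr P'' config_space (\<Phi>k k)) multiset_space (points_in \<Lambda>)"
      unfolding X_def using \<Phi>k[OF k] by (subst distr_distr) (auto simp: comp_def)
    also have "\<dots> = cp.Q"
      unfolding copies[OF k] cp.Q_def by (subst distr_distr) (auto simp: comp_def)
    finally show ?thesis .
  qed
  have lawXY: "distr P'' (multiset_space \<Otimes>\<^sub>M multiset_space) (\<lambda>\<omega>. (X k \<omega>, Y k \<omega>)) = thin_joint (1 / real n) cp.Q"
    if k: "k \<in> {1..n}" for k
    using independent_thinning_joint[OF thinnings[OF k] p L] lawX[OF k] unfolding X_def Y_def by simp
  have indXY: "R.indep_vars (\<lambda>_. multiset_space \<Otimes>\<^sub>M multiset_space) (\<lambda>k \<omega>. (X k \<omega>, Y k \<omega>)) {1..n}"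
    using R.indep_vars_compose2[OF independent, of "\<lambda>_ z. (points_in \<Lambda> (fst z), points_in \<Lambda> (snd z))"
        "\<lambda>_. multiset_space \<Otimes>\<^sub>M multiset_space"]
    by (simp add: X_def Y_def)
  have indX: "R.indep_vars (\<lambda>_. multiset_space) X {1..n}"
    using R.indep_vars_compose2[OF indXY, of "\<lambda>_. fst" "\<lambda>_. multiset_space"] by simp
  have cX [measurable]: "(\<lambda>(x, \<omega>). ennreal (cp.cm x (X k \<omega>))) \<in> borel_measurable (borel \<Otimes>\<^sub>M P'')" if "k \<in> {1..n}" for k
  proof -
    note [measurable] = X[OF that]
    show ?thesis by measurable
  qed
  have C [measurable]: "(\<lambda>(x, \<omega>). C x \<omega>) \<in> borel_measurable (borel \<Otimes>\<^sub>M P'')"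
    using borel_measurable_sum[of "{1..n}" "\<lambda>k (x, \<omega>). ennreal (cp.cm x (X k \<omega>))", OF cX]
    unfolding C_def by (simp add: split_beta')
  have meanC: "(\<integral>\<^sup>+\<omega>. C x \<omega> \<partial>P'') = (\<integral>\<^sup>+\<phi>. ennreal (cp.cm x \<phi>) \<partial>cp.Q)" for x
  proof -
    have meas: "(\<lambda>\<omega>. ennreal (cp.cm x (X k \<omega>))) \<in> borel_measurable P''" if "k \<in> {1..n}" for k
    proof -
      note [measurable] = X[OF that]
      show ?thesis by measurable
    qed
    have tr: "(\<integral>\<^sup>+\<omega>. ennreal (cp.cm x (X k \<omega>)) \<partial>P'') = (\<integral>\<^sup>+\<phi>. ennreal (cp.cm x \<phi>) \<partial>cp.Q)" if "k \<in> {1..n}" for k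
      unfolding lawX[OF that, symmetric] using X[OF that] by (subst nn_integral_distr) auto
    have "(\<integral>\<^sup>+\<omega>. C x \<omega> \<partial>P'') = ennreal (1 / real n) * (\<integral>\<^sup>+\<omega>. (\<Sum>k\<in>{1..n}. ennreal (cp.cm x (X k \<omega>))) \<partial>P'')"
      unfolding C_def by (rule nn_integral_cmult) (intro borel_measurable_sum meas)
    also have "(\<integral>\<^sup>+\<omega>. (\<Sum>k\<in>{1..n}. ennreal (cp.cm x (X k \<omega>))) \<partial>P'') =
        (\<Sum>k\<in>{1..n}. (\<integral>\<^sup>+\<omega>. ennreal (cp.cm x (X k \<omega>)) \<partial>P''))"
      by (rule nn_integral_sum) (rule meas)
    also have "\<dots> = (\<Sum>k\<in>{1..n}. (\<integral>\<^sup>+\<phi>. ennreal (cp.cm x \<phi>) \<partial>cp.Q))"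
      by (intro sum.cong refl tr)
    also have "ennreal (1 / real n) * (\<Sum>k\<in>{1..n}. (\<integral>\<^sup>+\<phi>. ennreal (cp.cm x \<phi>) \<partial>cp.Q)) =
        (ennreal (1 / real n) * ennreal (real n)) * (\<integral>\<^sup>+\<phi>. ennreal (cp.cm x \<phi>) \<partial>cp.Q)"
      by (simp add: mult.assoc ennreal_of_nat_eq_real_of_nat)
    also have "ennreal (1 / real n) * ennreal (real n) = 1"
      using \<open>n \<ge> 1\<close> by (simp add: ennreal_mult[symmetric])
    finally show ?thesis by simp
  qed

  have sub: "A - \<Lambda> \<in> rel_compact_borel" if "A \<in> rel_compact_borel" for A
    using rel_compact_borel_Int[OF that, of "- \<Lambda>"] cp.\<Lambda>_borel by (simp add: Diff_eq)
  have split: "emeasure \<phi> A = of_nat (npoints A (points_in \<Lambda> \<phi>))"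
    if "\<phi> \<in> configs" "A \<in> rel_compact_borel" "emeasure \<phi> (A - \<Lambda>) = 0" for \<phi> A
  proof -
    have A: "A \<in> sets borel" using that by (simp add: rel_compact_borel_def)
    have "emeasure \<phi> (A \<inter> \<Lambda>) + emeasure \<phi> (A - \<Lambda>) = emeasure \<phi> ((A \<inter> \<Lambda>) \<union> (A - \<Lambda>))"
      using A cp.\<Lambda>_borel that(1) by (intro plus_emeasure) (auto simp: configs_def)
    also have "(A \<inter> \<Lambda>) \<union> (A - \<Lambda>) = A" by auto
    finally show ?thesis using that(3) npoints_points_in[OF L that(1) A] by simp
  qed

  have \<Lambda>_null: "AE \<omega> in P. emeasure (\<Phi> \<omega>) (- \<Lambda>) = 0"
    using \<open>point_process_on \<Lambda> P \<Phi>\<close> by (simp add: point_process_on_def)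
  \<comment> \<open>The intensity measure of \<open>\<Phi>\<close> vanishes outside
    \<open>\<Lambda>\<close>; in this way \<open>\<zeta>\<close>, given only through its intensity,
    is confined to \<open>\<Lambda>\<close>.\<close>
  have "emeasure (density l m) (- \<Lambda>) = (\<integral>\<^sup>+\<omega>. emeasure (\<Phi> \<omega>) (- \<Lambda>) \<partial>P)"
    using \<open>has_intensity_measure P \<Phi> (density l m)\<close> cp.\<Lambda>_borel by (simp add: has_intensity_measure_def)
  also have "\<dots> = (\<integral>\<^sup>+\<omega>. 0 \<partial>P)" by (rule nn_integral_cong_AE[OF \<Lambda>_null])
  finally have M_null: "emeasure (density l m) (- \<Lambda>) = 0" by simp
  have law\<zeta>: "distr P' config_space \<zeta> = distr \<pi> config_space conf"
  proof -
    have "distr P' config_space \<zeta> = distr P' config_space (\<lambda>\<omega>. conf (points_in \<Lambda> (\<zeta> \<omega>)))"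
    proof (rule distr_config_eqI)
      fix A :: "'a set" assume A: "A \<in> rel_compact_borel"
      have "emeasure (density l m) (A - \<Lambda>) \<le> emeasure (density l m) (- \<Lambda>)"
        using cp.\<Lambda>_borel by (intro emeasure_mono) auto
      then have "AE \<omega> in P'. emeasure (\<zeta> \<omega>) (A - \<Lambda>) = 0"
        using poisson_process_null[OF \<open>poisson_process P' \<zeta> (density l m)\<close> sub[OF A]] M_null by simp
      then show "AE \<omega> in P'. emeasure (\<zeta> \<omega>) A = emeasure (conf (points_in \<Lambda> (\<zeta> \<omega>))) A"
        using AE_space
      proof eventually_elim
        case (elim \<omega>)
        then show ?case
          using split[OF _ A elim(1)] measurable_space[OF \<zeta>m elim(2)] A
          by (simp add: emeasure_conf rel_compact_borel_def)
      qed
    qed measurable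
    also have "\<dots> = distr \<pi> config_space conf"
      unfolding \<pi>_def by (subst distr_distr) (auto simp: comp_def)
    finally show ?thesis .
  qed
  \<comment> \<open>Equality of laws suffices: on each relatively compact set the superposition
    almost surely has no mass outside \<open>\<Lambda>\<close>, with an exceptional event that may
    depend on the set.\<close>
  have lawW: "distr P'' config_space (\<lambda>\<omega>. superposition {1..n} (\<lambda>k. \<Psi>k k \<omega>)) =
    distr (distr P'' multiset_space W) config_space conf"
  proof -
    have confs: "\<Psi>k k \<omega> \<in> configs" if "k \<in> {1..n}" "\<omega> \<in> space P''" for k \<omega>
      using measurable_space[OF \<Psi>k[OF that(1)] that(2)] by simp
    have sup: "emeasure (superposition {1..n} (\<lambda>k. \<Psi>k k \<omega>)) A = (\<Sum>k\<in>{1..n}. emeasure (\<Psi>k k \<omega>) A)"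
      if "A \<in> rel_compact_borel" "\<omega> \<in> space P''" for A \<omega>
      using that confs[OF _ that(2)] by (intro emeasure_superposition) (auto simp: configs_def rel_compact_borel_def)
    have "distr P'' config_space (\<lambda>\<omega>. superposition {1..n} (\<lambda>k. \<Psi>k k \<omega>)) = distr P'' config_space (\<lambda>\<omega>. conf (W \<omega>))"
    proof (rule distr_config_eqI)
      show "(\<lambda>\<omega>. superposition {1..n} (\<lambda>k. \<Psi>k k \<omega>)) \<in> P'' \<rightarrow>\<^sub>M config_space"
      proof (rule measurable_config_spaceI)
        show "superposition {1..n} (\<lambda>k. \<Psi>k k \<omega>) \<in> configs" if "\<omega> \<in> space P''" for \<omega>
          by (rule superposition_in_configs) (use confs that in auto)
        fix A :: "'a set" assume A: "A \<in> rel_compact_borel"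
        have "(\<lambda>\<omega>. \<Sum>k\<in>{1..n}. emeasure (\<Psi>k k \<omega>) A) \<in> borel_measurable P''"
          by (intro borel_measurable_sum measurable_compose[OF \<Psi>k measurable_config_eval[OF A]])
        then show "(\<lambda>\<omega>. emeasure (superposition {1..n} (\<lambda>k. \<Psi>k k \<omega>)) A) \<in> borel_measurable P''"
          by (subst measurable_cong[OF sup[OF A]])
      qed
      show "(\<lambda>\<omega>. conf (W \<omega>)) \<in> P'' \<rightarrow>\<^sub>M config_space" by measurable
      fix A :: "'a set" assume A: "A \<in> rel_compact_borel"
      have null [measurable]: "{\<phi> \<in> configs. emeasure \<phi> (A - \<Lambda>) = 0} \<in> sets config_space"
        using measurable_sets[OF measurable_config_eval[OF sub[OF A]], of "{0}"]
        by (simp add: vimage_def Int_def conj_commute)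
      have "AE \<omega> in P''. emeasure (\<Psi>k k \<omega>) (A - \<Lambda>) = 0" if k: "k \<in> {1..n}" for k
      proof (rule independent_thinning_null[OF thinnings[OF k] sub[OF A]])
        have "AE \<omega> in P. emeasure (\<Phi> \<omega>) (A - \<Lambda>) = 0"
          using \<Lambda>_null AE_space
        proof eventually_elim
          case (elim \<omega>)
          then have "\<Phi> \<omega> \<in> configs" using measurable_space[OF cp.\<Phi>_measurable] by simp
          then have "emeasure (\<Phi> \<omega>) (A - \<Lambda>) \<le> emeasure (\<Phi> \<omega>) (- \<Lambda>)"
            using cp.\<Lambda>_borel by (intro emeasure_mono) (auto simp: configs_def)
          then show ?case using elim by simp
        qed
        \<comment> \<open>The null event passes from \<open>\<Phi>\<close> to its copy through the
          common law, and from there to the thinning.\<close>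
        then have "AE \<phi> in distr P config_space \<Phi>. emeasure \<phi> (A - \<Lambda>) = 0"
          using null by (subst AE_distr_iff) auto
        then show "AE \<omega> in P''. emeasure (\<Phi>k k \<omega>) (A - \<Lambda>) = 0"
          unfolding copies[OF k, symmetric] using \<Phi>k[OF k] null by (subst (asm) AE_distr_iff) auto
      qed
      then have "AE \<omega> in P''. \<forall>k\<in>{1..n}. emeasure (\<Psi>k k \<omega>) (A - \<Lambda>) = 0"
        by (simp add: AE_finite_all)
      then show "AE \<omega> in P''. emeasure (superposition {1..n} (\<lambda>k. \<Psi>k k \<omega>)) A = emeasure (conf (W \<omega>)) A"
        using AE_space
      proof eventually_elim
        case (elim \<omega>)
        have "emeasure (\<Psi>k k \<omega>) A = of_nat (npoints A (Y k \<omega>))" if "k \<in> {1..n}" for k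
          unfolding Y_def using split[OF confs[OF that elim(2)] A] elim(1) that by blast
        then have "emeasure (superposition {1..n} (\<lambda>k. \<Psi>k k \<omega>)) A = (\<Sum>k\<in>{1..n}. of_nat (npoints A (Y k \<omega>)))"
          unfolding sup[OF A elim(2)] by (intro sum.cong refl)
        also have "\<dots> = of_nat (npoints A (W \<omega>))"
          unfolding W_def by (simp add: npoints_sum)
        finally show ?case using A by (simp add: emeasure_conf rel_compact_borel_def)
      qed
    qed
    also have "\<dots> = distr (distr P'' multiset_space W) config_space conf"
      by (subst distr_distr) (auto simp: comp_def)
    finally show ?thesis .
  qed

  have finM': "finite_measure (density cp.l\<Lambda> m)"
    by (rule finite_measureI) (use mass sets_eq_imp_space_eq[OF cp.sets_l\<Lambda>] in \<open>simp add: emeasure_density\<close>)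
  have \<pi>_pois: "poisson_law (density cp.l\<Lambda> m) \<pi>"
    unfolding \<pi>_def
    by (rule poisson_process_points_in[OF \<open>poisson_process P' \<zeta> (density l m)\<close> L finM'])
       (auto intro: cp.emeasure_density_l\<Lambda>[OF m])
  interpret g: gnz cp.l\<Lambda> m P'' W C \<pi>
  proof (rule gnz.intro)
    show "finite_measure cp.l\<Lambda>" "sets cp.l\<Lambda> = sets borel" "prob_space P''"
      by (simp_all add: cp.finite_l\<Lambda> R.prob_space_axioms)
    show "AE x in cp.l\<Lambda>. (\<integral>\<^sup>+\<omega>. C x \<omega> \<partial>P'') = m x" using mean by (simp add: meanC)
    fix B :: "('a \<times> 'a multiset) set" assume [measurable]: "B \<in> sets (borel \<Otimes>\<^sub>M multiset_space)"
    show "(\<integral>\<^sup>+\<omega>. point_sum (\<lambda>x \<psi>. indicator B (x, \<psi>)) (W \<omega>) \<partial>P'') =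
      (\<integral>\<^sup>+x. (\<integral>\<^sup>+\<omega>. C x \<omega> * indicator B (x, W \<omega>) \<partial>P'') \<partial>cp.l\<Lambda>)"
      unfolding W_def C_def
      by (rule cp.gnz_thinned_superposition[OF R.prob_space_axioms _ p indXY lawXY])
         (auto simp: indicator_def)
  qed (use mass \<pi>_pois in auto)

  obtain h where h [measurable]: "h \<in> borel_measurable multiset_space"
    and dens: "distr P'' multiset_space W = density \<pi> h"
    and diff: "(\<integral>\<^sup>+x. (\<integral>\<^sup>+\<phi>. abs_diff (h (add_mset x \<phi>)) (h \<phi>) \<partial>\<pi>) \<partial>density cp.l\<Lambda> m) \<le>
      (\<integral>\<^sup>+x. (\<integral>\<^sup>+\<omega>. abs_diff (C x \<omega>) (m x) \<partial>P'') \<partial>cp.l\<Lambda>)"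
    using g.density_exists by blast
  have multiset_UNIV: "UNIV \<in> sets (multiset_space :: 'a multiset measure)"
    using sets.top[of "multiset_space :: 'a multiset measure"] by simp
  have "(\<integral>\<^sup>+\<phi>. h \<phi> \<partial>\<pi>) = emeasure (distr P'' multiset_space W) UNIV"
    unfolding dens using multiset_UNIV by (subst emeasure_density) auto
  also have "\<dots> = 1" using multiset_UNIV by (subst emeasure_distr) (auto simp: R.emeasure_space_1)
  finally have h1: "(\<integral>\<^sup>+\<phi>. h \<phi> \<partial>\<pi>) = 1" .

  let ?B = "ennreal (1 / sqrt (real n)) * (\<integral>\<^sup>+x\<in>\<Lambda>. ennreal (sqrt (K x)) \<partial>l)"
  \<comment> \<open>\<open>K\<close> is controlled on \<open>\<Lambda>\<close> only; cut off
    outside, it becomes a Borel function on the whole space.\<close>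
  let ?K = "\<lambda>x. indicator \<Lambda> x * K x"
  have K [measurable]: "?K \<in> borel_measurable borel"
    using borel_measurable_integrable[of l "\<lambda>x. indicator \<Lambda> x *\<^sub>R K x"] \<open>set_integrable l \<Lambda> K\<close>
    by (simp add: set_integrable_def cong: measurable_cong_sets)
  have "(\<integral>\<^sup>+x. (\<integral>\<^sup>+\<omega>. abs_diff (C x \<omega>) (m x) \<partial>P'') \<partial>cp.l\<Lambda>) \<le>
    (\<integral>\<^sup>+x. ennreal (1 / sqrt (real n)) * ennreal (sqrt (?K x)) \<partial>cp.l\<Lambda>)"
  proof (rule nn_integral_mono_AE)
    show "AE x in cp.l\<Lambda>. (\<integral>\<^sup>+\<omega>. abs_diff (C x \<omega>) (m x) \<partial>P'') \<le> ennreal (1 / sqrt (real n)) * ennreal (sqrt (?K x))"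
      using mean cp.AE_l\<Lambda>
    proof eventually_elim
      case (elim x)
      have K: "?K x = K x" using elim(2) by simp
      show ?case
        unfolding C_def elim(1)[symmetric] K
        by (rule cp.mean_deviation[OF R.prob_space_axioms \<open>n \<ge> 1\<close> indX lawX
              finite_variance[OF elim(2)] variance_le[OF elim(2)]])
    qed
  qed
  also have "\<dots> = ennreal (1 / sqrt (real n)) * (\<integral>\<^sup>+x. ennreal (sqrt (?K x)) \<partial>cp.l\<Lambda>)"
    by (rule nn_integral_cmult) measurable
  also have "(\<integral>\<^sup>+x. ennreal (sqrt (?K x)) \<partial>cp.l\<Lambda>) = (\<integral>\<^sup>+x\<in>\<Lambda>. ennreal (sqrt (K x)) \<partial>l)"
  proof -
    have "(\<lambda>x. ennreal (sqrt (?K x))) \<in> borel_measurable borel" by measurable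
    from cp.nn_integral_l\<Lambda>[OF this] show ?thesis
      by (auto intro!: nn_integral_cong simp: indicator_def)
  qed
  finally have J: "(\<integral>\<^sup>+x. (\<integral>\<^sup>+\<omega>. abs_diff (C x \<omega>) (m x) \<partial>P'') \<partial>cp.l\<Lambda>) \<le> ?B" .

  show ?thesis
  \<comment> \<open>An infinite bound holds trivially; this case split spares a proof that the
    square root of \<open>K\<close> is integrable.\<close>
  proof (cases "?B = \<infinity>")
    case False
    then obtain D where D: "?B = ennreal D" "0 \<le> D" by (cases ?B) auto
    show ?thesis
      unfolding D
    proof (rule ennreal_le_epsilon)
      \<comment> \<open>Each \<open>\<epsilon>\<close> has its own coupling, with its own number of
        increments; only the infimum over couplings is bounded by \<open>D\<close>.\<close>
      fix \<epsilon> :: real assume "0 < \<epsilon>"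
      have diff_le: "(\<integral>\<^sup>+x. (\<integral>\<^sup>+\<phi>. abs_diff (h (add_mset x \<phi>)) (h \<phi>) \<partial>\<pi>) \<partial>density cp.l\<Lambda> m) \<le> ennreal D"
        using order_trans[OF diff J] unfolding D(1) .
      have sets_M: "sets (density cp.l\<Lambda> m) = sets borel" by simp
      obtain Cp where Cp: "prob_space Cp" "sets Cp = sets (multiset_space \<Otimes>\<^sub>M multiset_space)"
        "distr Cp multiset_space fst = density \<pi> h" "distr Cp multiset_space snd = \<pi>"
        "(\<integral>\<^sup>+w. TV_dist (conf (fst w)) (conf (snd w)) \<partial>Cp) \<le> ennreal (D + \<epsilon>)"
        using coupling_exists[OF finM' sets_M \<pi>_pois h h1 diff_le D(2),
            of "\<lambda>w w'. TV_dist (conf w) (conf w')", OF TV_dist_conf_props \<open>0 < \<epsilon>\<close>]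
        by blast
      have "TV_star P'' (\<lambda>\<omega>. superposition {1..n} (\<lambda>k. \<Psi>k k \<omega>)) P' \<zeta> \<le> ennreal (D + \<epsilon>)"
        using TV_star_law_distr_conf_le[OF Cp(1,2)] Cp(5)
        unfolding TV_star_def law\<zeta> lawW dens Cp(3,4) by (rule order_trans)
      then show "TV_star P'' (\<lambda>\<omega>. superposition {1..n} (\<lambda>k. \<Psi>k k \<omega>)) P' \<zeta> \<le> ennreal D + ennreal \<epsilon>"
        using D(2) \<open>0 < \<epsilon>\<close> by simp
    qed
  qed simp
qed

end
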